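(* Let $\Sigma$ be a self-converse oriented graph on $n$ vertices with walk-matrix $W(\Sigma)$. Suppose that the Smith normal form of $W(\Sigma)$ is $$\mathrm{diag}(\underbrace{1,1,\ldots,1}_{\lceil n/2\rceil},\underbrace{2,2,\ldots,2,2d}_{\lfloor n/2\rfloor}),$$ i.e. the first $\lceil n/2\rceil$ diagonal entries equal $1$, the next $\lfloor n/2\rfloor-1$ entries equal $2$, and the last entry equals $2d$, where $d$ is any odd integer (not necessarily square-free). Then $\Sigma$ is determined by its generalized skew spectrum (DGSS).
   Context: An oriented graph $\Sigma$ on vertex set $\{v_1,\dots,v_n\}$ is a simple graph in which every edge has been given a direction. Its skew adjacency matrix $S=S(\Sigma)=(S_{ij})$ is the $n\times n$ matrix with $S_{ij}=1$ if $(v_i,v_j)$ is a (directed) edge, $S_{ij}=-1$ if $(v_j,v_i)$ is an edge, and $S_{ij}=0$ otherwise; thus $S^{\mathrm T}=-S$. The walk-matrix of $\Sigma$ is $W(\Sigma)=[e,Se,S^2e,\ldots,S^{n-1}e]$, where $e$ is the all-ones vector. The converse $\Sigma^{\mathrm T}$ is obtained by reversing every edge; $\Sigma$ is self-converse if it is isomorphic to $\Sigma^{\mathrm T}$, equivalently if there is a permutation matrix $P$ with $P^{\mathrm T}SP=S^{\mathrm T}=-S$. $\Sigma$ is determined by its generalized skew spectrum (DGSS) if every oriented graph $\Delta$ with $\mathrm{Spec}(S(\Sigma))=\mathrm{Spec}(S(\Delta))$ and $\mathrm{Spec}(J-S(\Sigma))=\mathrm{Spec}(J-S(\Delta))$ (where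 $J$ is the all-ones matrix) is isomorphic to $\Sigma$. The Smith normal form of a nonsingular integer matrix $M$ is the unique diagonal matrix $\mathrm{diag}(d_1,\ldots,d_n)$ with positive integers $d_i\mid d_{i+1}$ such that $M=U_1\,\mathrm{diag}(d_1,\dots,d_n)\,U_2$ for some integer matrices $U_1,U_2$ of determinant $\pm1$. *)

theory Defs
  imports "Jordan_Normal_Form.Determinant" "Jordan_Normal_Form.Char_Poly"
    "HOL-Computational_Algebra.Polynomial" Complex_Main
begin

definition oriented_graph :: "nat \<Rightarrow> (nat \<Rightarrow> nat \<Rightarrow> bool) \<Rightarrow> bool" where
  "oriented_graph n E \<longleftrightarrow>
     (\<forall>i j. E i j \<longrightarrow> i < n \<and> j < n) \<and>
     (\<forall>i. \<not> E i i) \<and> (\<forall>i j. E i j \<longrightarrow> \<not> E j i)"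

definition skew_adj :: "nat \<Rightarrow> (nat \<Rightarrow> nat \<Rightarrow> bool) \<Rightarrow> int mat" where
  "skew_adj n E = mat n n (\<lambda>(i, j). if E i j then 1 else if E j i then -1 else 0)"

definition walk_matrix :: "nat \<Rightarrow> (nat \<Rightarrow> nat \<Rightarrow> bool) \<Rightarrow> int mat" where
  "walk_matrix n E =
     mat n n (\<lambda>(i, k). ((skew_adj n E ^\<^sub>m k) *\<^sub>v vec n (\<lambda>_. 1)) $ i)"

definition converse_graph :: "(nat \<Rightarrow> nat \<Rightarrow> bool) \<Rightarrow> (nat \<Rightarrow> nat \<Rightarrow> bool)" where
  "converse_graph E = (\<lambda>i j. E j i)"

definition isomorphic_og :: "nat \<Rightarrow> (nat \<Rightarrow> nat \<Rightarrow> bool) \<Rightarrow> (nat \<Rightarrow> nat \<Rightarrow> bool) \<Rightarrow> bool" where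
  "isomorphic_og n E F \<longleftrightarrow>
     (\<exists>p. bij_betw p {..<n} {..<n} \<and> (\<forall>i<n. \<forall>j<n. E i j \<longleftrightarrow> F (p i) (p j)))"

definition self_converse :: "nat \<Rightarrow> (nat \<Rightarrow> nat \<Rightarrow> bool) \<Rightarrow> bool" where
  "self_converse n E \<longleftrightarrow> isomorphic_og n E (converse_graph E)"

definition spec :: "int mat \<Rightarrow> complex multiset" where
  "spec A = proots (char_poly (map_mat complex_of_int A))"

definition all_ones_mat :: "nat \<Rightarrow> int mat" where
  "all_ones_mat n = mat n n (\<lambda>_. 1)"

definition DGSS :: "nat \<Rightarrow> (nat \<Rightarrow> nat \<Rightarrow> bool) \<Rightarrow> bool" where
  "DGSS n E \<longleftrightarrow>
     (\<forall>F. oriented_graph n F \<longrightarrow>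
        spec (skew_adj n E) = spec (skew_adj n F) \<longrightarrow>
        spec (all_ones_mat n - skew_adj n E) = spec (all_ones_mat n - skew_adj n F) \<longrightarrow>
        isomorphic_og n E F)"

definition unimodular :: "nat \<Rightarrow> int mat \<Rightarrow> bool" where
  "unimodular n U \<longleftrightarrow> U \<in> carrier_mat n n \<and> (det U = 1 \<or> det U = -1)"

definition has_smith_form :: "nat \<Rightarrow> int mat \<Rightarrow> int list \<Rightarrow> bool" where
  "has_smith_form n M ds \<longleftrightarrow>
     length ds = n \<and> (\<forall>i<n. ds ! i > 0) \<and> (\<forall>i. Suc i < n \<longrightarrow> ds ! i dvd ds ! Suc i) \<and>
     (\<exists>U1 U2. unimodular n U1 \<and> unimodular n U2 \<and>
        M = U1 * mat n n (\<lambda>(i, j). if i = j then ds ! i else 0) * U2)"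

definition target_snf :: "nat \<Rightarrow> int \<Rightarrow> int list" where
  "target_snf n d = replicate ((n + 1) div 2) 1 @ replicate (n div 2 - 1) 2 @ [2 * d]"

end

theory Submission
  imports Defs "HOL-Computational_Algebra.Fundamental_Theorem_Algebra"
begin

text \<open>
  Write \<open>e\<close> for the all-ones vector and \<open>h k = e\<^sup>T S\<^sup>k e\<close>. The two spectra determine all the numbers \<open>h k\<close>,
  hence the Gram matrix of the walk vectors \<open>S\<^sup>k e\<close>. So for a graph with skew adjacency matrix \<open>T\<close>
  and the same generalized spectrum, the matrix \<open>Q = W(S) W(T)\<^sup>-\<^sup>1\<close> is rational orthogonal, fixes \<open>e\<close>
  and satisfies \<open>S Q = Q T\<close>. If \<open>Q\<close> is integral, it is a permutation matrix, so it remains to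
  show that its entries are integral at every prime \<open>p\<close>.

  Let \<open>L\<close> be the standard lattice localized at \<open>p\<close>. Both \<open>L\<close> and \<open>Q L\<close> are self-dual, stable under \<open>S\<close>
  and contain the lattice \<open>M\<close> spanned by the walk vectors; the claim is \<open>L = Q L\<close>.

  For odd \<open>p\<close> the quotient \<open>L / M\<close> is cyclic. An anti-automorphism \<open>P\<close> is an involution and splits
  \<open>L\<close> and \<open>M\<close> into eigenlattices, so \<open>M\<close> contains one of the two eigenlattices of \<open>L\<close>. By
  self-duality the same eigenlattice splits off \<open>Q L\<close>, and what is left of both \<open>L\<close> and \<open>Q L\<close> modulo \<open>M\<close>
  lies on one common line. Lattices on a line over a valuation ring are nested, and nested self-dual
  lattices are equal.

  For \<open>p = 2\<close> let \<open>u\<close> be integral with \<open>u / 2\<close> in \<open>Q L\<close>. Then \<open>W\<^sup>T u\<close> is even and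
  \<open>\<bar>S\<^sup>j u\<bar>\<^sup>2\<close> is divisible by 4 for all \<open>j\<close>. Modulo 2, \<open>u\<close> is a combination of the first \<open>\<lceil>n/2\<rceil>\<close> walk
  vectors, with coefficients \<open>v a\<close> say, and the norm condition becomes \<open>4 dvd (\<Sum>a. v a * h (2 a + 2 j))\<close>.
  This is a linear system whose matrix, after halving, is part of the Gram matrix and is invertible
  modulo 2; hence \<open>u\<close> is even.
\<close>

section \<open>Walk vectors and the generalized spectrum\<close>

abbreviation ones :: "nat \<Rightarrow> 'a :: semiring_1 vec" where
  "ones n \<equiv> vec n (\<lambda>_. 1)"

text \<open>The ring is left general because the argument modulo 2 works with the integer matrix,
  while the lattices are acted on by its image over the rationals.\<close>

definition walk_vec :: "'a :: comm_ring_1 mat \<Rightarrow> nat \<Rightarrow> 'a vec" where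
  "walk_vec S k = (S ^\<^sub>m k) *\<^sub>v ones (dim_row S)"

definition walk_count :: "'a :: comm_ring_1 mat \<Rightarrow> nat \<Rightarrow> 'a" where
  "walk_count S k = ones (dim_row S) \<bullet> walk_vec S k"

definition krylov_mat :: "'a :: comm_ring_1 mat \<Rightarrow> 'a mat" where
  "krylov_mat S = mat (dim_row S) (dim_row S) (\<lambda>(i, k). walk_vec S k $ i)"

lemma walk_vec_carrier [simp]: "S \<in> carrier_mat n n \<Longrightarrow> walk_vec S k \<in> carrier_vec n"
  by (auto simp: walk_vec_def intro!: mult_mat_vec_carrier[of _ n n] pow_carrier_mat)

lemma dim_walk_vec [simp]: "dim_vec (walk_vec S k) = dim_row S"
  by (cases k) (auto simp: walk_vec_def)

lemma walk_vec_0 [simp]: "S \<in> carrier_mat n n \<Longrightarrow> walk_vec S 0 = ones n"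
  by (auto simp: walk_vec_def)

lemma smult_one_mult_vec:
  fixes x :: "'a :: comm_ring_1 vec"
  assumes "x \<in> carrier_vec n"
  shows "(c \<cdot>\<^sub>m 1\<^sub>m n) *\<^sub>v x = c \<cdot>\<^sub>v x"
  using assms by (intro eq_vecI) auto

lemma pow_mat_Suc_left:
  fixes S :: "'a :: comm_ring_1 mat"
  assumes S: "S \<in> carrier_mat n n"
  shows "S ^\<^sub>m Suc k = S * S ^\<^sub>m k"
proof (induction k)
  case 0
  then show ?case using S by simp
next
  case (Suc k)
  have "S ^\<^sub>m Suc (Suc k) = (S * S ^\<^sub>m k) * S" using Suc by simp
  also have "\<dots> = S * (S ^\<^sub>m k * S)" using S by (intro assoc_mult_mat) auto
  finally show ?case by simp
qed

lemma walk_vec_Suc: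
  assumes S: "S \<in> carrier_mat n n"
  shows "walk_vec S (Suc k) = S *\<^sub>v walk_vec S k"
proof -
  have "walk_vec S (Suc k) = (S * S ^\<^sub>m k) *\<^sub>v ones n"
    using S unfolding walk_vec_def pow_mat_Suc_left[OF S] by simp
  also have "\<dots> = S *\<^sub>v (S ^\<^sub>m k *\<^sub>v ones n)"
    using S by (intro assoc_mult_mat_vec[of _ n n _ n]) (auto intro!: pow_carrier_mat)
  finally show ?thesis using S by (simp add: walk_vec_def)
qed

lemma krylov_mat_carrier [simp]: "S \<in> carrier_mat n n \<Longrightarrow> krylov_mat S \<in> carrier_mat n n"
  by (auto simp: krylov_mat_def)

lemma dim_krylov_mat [simp]:
  "dim_row (krylov_mat S) = dim_row S" "dim_col (krylov_mat S) = dim_row S"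
  by (simp_all add: krylov_mat_def)

lemma col_krylov_mat:
  "S \<in> carrier_mat n n \<Longrightarrow> k < n \<Longrightarrow> col (krylov_mat S) k = walk_vec S k"
  by (intro eq_vecI) (auto simp: krylov_mat_def)

lemma skew_scalar_prod:
  fixes S :: "'a :: comm_ring_1 mat"
  assumes S: "S \<in> carrier_mat n n" and skew: "S\<^sup>T = - S"
    and x: "x \<in> carrier_vec n" and y: "y \<in> carrier_vec n"
  shows "(S *\<^sub>v x) \<bullet> y = - (x \<bullet> (S *\<^sub>v y))"
proof -
  have "x \<bullet> (S *\<^sub>v y) = (S *\<^sub>v y) \<bullet> x" using S x y by (intro comm_scalar_prod[of _ n]) auto
  also have "\<dots> = y \<bullet> (S\<^sup>T *\<^sub>v x)"
    using transpose_vec_mult_scalar[OF S y x] transpose_vec_mult_scalar[of "S\<^sup>T" n n x y] S x y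
    by (metis comm_scalar_prod mult_mat_vec_carrier transpose_carrier_mat)
  also have "\<dots> = - (y \<bullet> (S *\<^sub>v x))" using skew S x y by simp
  also have "y \<bullet> (S *\<^sub>v x) = (S *\<^sub>v x) \<bullet> y"
    using S x y by (intro comm_scalar_prod[of _ n]) auto
  finally show ?thesis by simp
qed

text \<open>By skewness each \<open>S\<close> that moves from the left factor to the right one costs
  a sign.\<close>

lemma walk_vec_scalar_prod:
  fixes S :: "'a :: comm_ring_1 mat"
  assumes S: "S \<in> carrier_mat n n" and skew: "S\<^sup>T = - S"
  shows "walk_vec S a \<bullet> walk_vec S b = (-1) ^ a * walk_count S (a + b)"
proof (induction a arbitrary: b)
  case 0
  then show ?case using S by (simp add: walk_count_def)
next
  case (Suc a)
  have "walk_vec S (Suc a) \<bullet> walk_vec S b = - (walk_vec S a \<bullet> walk_vec S (Suc b))"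
    using S by (simp add: walk_vec_Suc[OF S] skew_scalar_prod[OF S skew])
  then show ?case by (simp add: Suc)
qed

text \<open>The scalar product of \<open>S^k e\<close> and \<open>e\<close> is symmetric, but moving
  an odd number of skew factors across it changes the sign.\<close>

lemma walk_count_odd:
  fixes S :: "'a :: {idom, ring_char_0} mat"
  assumes S: "S \<in> carrier_mat n n" and skew: "S\<^sup>T = - S" and "odd k"
  shows "walk_count S k = 0"
proof -
  have "walk_vec S k \<bullet> walk_vec S 0 = walk_vec S 0 \<bullet> walk_vec S k"
    using S by (intro comm_scalar_prod[of _ n]) auto
  then have "- walk_count S k = walk_count S k"
    using \<open>odd k\<close> unfolding walk_vec_scalar_prod[OF S skew] by simp
  then show ?thesis by simp
qed

text \<open>Both matrices involve \<open>S\<close> only through the walk counts, so they agree for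
  graphs with equal counts. The first will make \<open>Q\<close> orthogonal, the second will make it
  intertwine the two skew adjacency matrices.\<close>

lemma krylov_gram:
  fixes S :: "'a :: comm_ring_1 mat"
  assumes S: "S \<in> carrier_mat n n" and skew: "S\<^sup>T = - S"
  shows "(krylov_mat S)\<^sup>T * krylov_mat S = mat n n (\<lambda>(i, j). (-1) ^ i * walk_count S (i + j))"
    and "(krylov_mat S)\<^sup>T * (S * krylov_mat S) =
      mat n n (\<lambda>(i, j). (-1) ^ i * walk_count S (i + j + 1))"
proof -
  have K: "krylov_mat S \<in> carrier_mat n n" using S by simp
  show "(krylov_mat S)\<^sup>T * krylov_mat S = mat n n (\<lambda>(i, j). (-1) ^ i * walk_count S (i + j))"
    using S by (intro eq_matI)
      (auto simp: col_krylov_mat[OF S] walk_vec_scalar_prod[OF S skew])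
  have "col (S * krylov_mat S) j = walk_vec S (Suc j)" if "j < n" for j
    using that by (subst col_mult2[OF S K]) (auto simp: col_krylov_mat[OF S] walk_vec_Suc[OF S])
  then have "((krylov_mat S)\<^sup>T * (S * krylov_mat S)) $$ (i, j) = (-1) ^ i * walk_count S (i + j + 1)"
    if "i < n" "j < n" for i j
    using S that by (simp add: col_krylov_mat[OF S] walk_vec_scalar_prod[OF S skew] del: col_mult2)
  then show "(krylov_mat S)\<^sup>T * (S * krylov_mat S) =
      mat n n (\<lambda>(i, j). (-1) ^ i * walk_count S (i + j + 1))"
    using S by (intro eq_matI) auto
qed

section \<open>Walk counts from the two characteristic polynomials\<close>

lemma det_rank_one_update:
  fixes M :: "'a :: idom mat"
  assumes M: "M \<in> carrier_mat n n" and u: "u \<in> carrier_vec n" and v: "v \<in> carrier_vec n"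
    and nz: "det M \<noteq> 0"
  shows "det (M + mat n n (\<lambda>(i, j). u $ i * v $ j)) = det M + v \<bullet> (adj_mat M *\<^sub>v u)"
proof -
  define U where "U = mat n 1 (\<lambda>(i, j). u $ i)"
  define V where "V = mat 1 n (\<lambda>(i, j). v $ j)"
  define c where "c = v \<bullet> (adj_mat M *\<^sub>v u)"
  have U: "U \<in> carrier_mat n 1" and V: "V \<in> carrier_mat 1 n" by (auto simp: U_def V_def)
  note A = adj_mat[OF M]
  \<comment> \<open>This is the matrix determinant lemma: the determinant of the bordered matrix
    \<open>?X\<close> is computed in two ways. Column operations that clear the lower left block
    turn the upper left block into \<open>M + U * V\<close>.\<close>
  let ?X = "four_block_mat M (- U) V (1\<^sub>m 1)"
  have X: "?X \<in> carrier_mat (n + 1) (n + 1)" using M by (intro four_block_carrier_mat) auto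
  have one: "1\<^sub>m n \<in> carrier_mat n n" "1\<^sub>m 1 \<in> carrier_mat 1 1" by auto
  have UV: "U * V = mat n n (\<lambda>(i, j). u $ i * v $ j)"
    by (intro eq_matI) (auto simp: U_def V_def scalar_prod_def)
  have "?X * four_block_mat (1\<^sub>m n) (0\<^sub>m n 1) (- V) (1\<^sub>m 1) =
      four_block_mat (M * 1\<^sub>m n + - U * - V) (M * 0\<^sub>m n 1 + - U * 1\<^sub>m 1)
        (V * 1\<^sub>m n + 1\<^sub>m 1 * - V) (V * 0\<^sub>m n 1 + 1\<^sub>m 1 * 1\<^sub>m 1)"
    using M U V by (intro mult_four_block_mat) auto
  also have "\<dots> = four_block_mat (M + U * V) (- U) (0\<^sub>m 1 n) (1\<^sub>m 1)"
    using M U V by (intro cong_four_block_mat) auto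
  finally have "det ?X * det (four_block_mat (1\<^sub>m n) (0\<^sub>m n 1) (- V) (1\<^sub>m 1)) =
      det (four_block_mat (M + U * V) (- U) (0\<^sub>m 1 n) (1\<^sub>m 1))"
    using V by (subst det_mult[OF X, symmetric]) (auto intro!: four_block_carrier_mat)
  moreover have "det (four_block_mat (1\<^sub>m n) (0\<^sub>m n 1) (- V) (1\<^sub>m 1)) = (1 :: 'a)"
    using V by (subst det_four_block_mat_upper_right_zero) auto
  moreover have "det (four_block_mat (M + U * V) (- U) (0\<^sub>m 1 n) (1\<^sub>m 1)) = det (M + U * V)"
    using M U V by (subst det_four_block_mat_lower_left_zero) auto
  ultimately have d1: "det ?X = det (M + U * V)" by simp
  \<comment> \<open>\<open>?Y\<close> is chosen so that \<open>?X * ?Y\<close> is block lower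
    triangular, with the adjugate standing in for an inverse of \<open>M\<close>. Cancelling
    \<open>det M ^ n\<close>, which is also \<open>det ?Y\<close>, leaves the claim.\<close>
  let ?Y = "four_block_mat (adj_mat M) (adj_mat M * U) (0\<^sub>m 1 n) (det M \<cdot>\<^sub>m 1\<^sub>m 1)"
  have Y: "?Y \<in> carrier_mat (n + 1) (n + 1)" using A by (intro four_block_carrier_mat) auto
  have VAU: "V * (adj_mat M * U) = c \<cdot>\<^sub>m 1\<^sub>m 1"
  proof (rule eq_matI)
    have r: "row V 0 = v" using v by (auto simp: V_def)
    have "col U 0 = u" using u by (auto simp: U_def)
    then have "col (adj_mat M * U) 0 = adj_mat M *\<^sub>v u" using col_mult2[OF A(1) U, of 0] by simp
    with r show "(V * (adj_mat M * U)) $$ (i, j) = (c \<cdot>\<^sub>m 1\<^sub>m 1) $$ (i, j)"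
      if "i < dim_row (c \<cdot>\<^sub>m 1\<^sub>m 1)" "j < dim_col (c \<cdot>\<^sub>m 1\<^sub>m 1)" for i j
      using that U V by (auto simp: c_def)
  qed (use U V in auto)
  have MAU: "M * (adj_mat M * U) = det M \<cdot>\<^sub>m U"
    using assoc_mult_mat[OF M A(1) U] A(2) U by (simp add: mult_smult_assoc_mat[OF one(1) U])
  have "?X * ?Y = four_block_mat (M * adj_mat M + - U * 0\<^sub>m 1 n)
        (M * (adj_mat M * U) + - U * (det M \<cdot>\<^sub>m 1\<^sub>m 1))
        (V * adj_mat M + 1\<^sub>m 1 * 0\<^sub>m 1 n) (V * (adj_mat M * U) + 1\<^sub>m 1 * (det M \<cdot>\<^sub>m 1\<^sub>m 1))"
    using M U V A by (intro mult_four_block_mat) auto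
  also have "\<dots> = four_block_mat (det M \<cdot>\<^sub>m 1\<^sub>m n) (0\<^sub>m n 1) (V * adj_mat M) ((c + det M) \<cdot>\<^sub>m 1\<^sub>m 1)"
    unfolding MAU VAU A(2) using M U V A
    by (intro cong_four_block_mat) (auto simp: mult_smult_distrib[of _ n 1] intro!: eq_matI)
  finally have XY: "?X * ?Y = \<dots>" .
  have "det ?X * det ?Y = det (?X * ?Y)" by (rule det_mult[OF X Y, symmetric])
  also have "\<dots> = det M ^ n * (c + det M)"
    unfolding XY using V A
    by (subst det_four_block_mat_upper_right_zero) (auto simp: det_smult)
  also have "det ?Y = det (adj_mat M) * det M"
    using U A by (subst det_four_block_mat_lower_left_zero) (auto simp: det_smult)
  also have "\<dots> = det (M * adj_mat M)" using det_mult[OF M A(1)] by simp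
  also have "\<dots> = det M ^ n" unfolding A(2) by (simp add: det_smult)
  finally have "det ?X = c + det M" using nz by simp
  then show ?thesis using d1 UV by (simp add: c_def add.commute)
qed

text \<open>Each entry of the adjugate is, up to sign, a minor of size \<open>n - 1\<close> of a
  matrix whose entries have degree at most 1.\<close>

lemma degree_adj_char_poly_matrix:
  fixes A :: "'a :: idom mat"
  assumes A: "A \<in> carrier_mat n n" and i: "i < n" and j: "j < n"
  shows "degree (adj_mat (char_poly_matrix A) $$ (i, j)) < n"
proof -
  let ?M = "char_poly_matrix A"
  have M: "?M \<in> carrier_mat n n" using A by simp
  have deg: "degree (?M $$ (k, l)) \<le> 1" if "k < n" "l < n" for k l
    using that A by (auto simp: char_poly_matrix_def degree_add_le)
  have "degree (det (mat_delete ?M j i)) \<le> 1 * (n - 1)"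
  proof (rule degree_det_le)
    show "mat_delete ?M j i \<in> carrier_mat (n - 1) (n - 1)" using M by auto
    show "degree (mat_delete ?M j i $$ (k, l)) \<le> 1" if "k < n - 1" "l < n - 1" for k l
      using that M i j deg by (auto simp: mat_delete_def)
  qed
  moreover have "degree (cofactor ?M j i) \<le> degree (det (mat_delete ?M j i))"
    unfolding cofactor_def by (cases "even (j + i)") auto
  moreover have "adj_mat ?M $$ (i, j) = cofactor ?M j i"
    using M i j by (simp add: adj_mat_def)
  ultimately show ?thesis using i by simp
qed

text \<open>With \<open>x\<close> the indeterminate, this is
  \<open>(S^i e)^T adj(x I - S) e\<close>: the resolvent form
  \<open>(S^i e)^T (x I - S)^(-1) e\<close>, multiplied by the characteristic polynomial of
  \<open>S\<close> so that it becomes a polynomial.\<close>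

definition walk_gen :: "'a :: comm_ring_1 mat \<Rightarrow> nat \<Rightarrow> 'a poly" where
  "walk_gen S i = (\<Sum>j<dim_row S.
     [:walk_vec S i $ j:] * (adj_mat (char_poly_matrix S) *\<^sub>v ones (dim_row S)) $ j)"

text \<open>The first claim is a rank one update of \<open>x I - S\<close>. The recursion follows
  from \<open>S adj(x I - S) = x adj(x I - S) - (char_poly S) I\<close> and skewness. Comparing
  coefficients of \<open>x^n\<close> in it gives the last claim.\<close>

lemma walk_count_eq_coeff:
  fixes S :: "'a :: {idom, ring_char_0} mat"
  assumes S: "S \<in> carrier_mat n n" and skew: "S\<^sup>T = - S" and n: "n > 0"
  shows "char_poly (mat n n (\<lambda>_. 1) - S) = char_poly S - walk_gen S 0"
    and "walk_gen S (Suc i) = Polynomial.smult (walk_count S i) (char_poly S) - [:0, 1:] * walk_gen S i"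
    and "walk_count S i = coeff (walk_gen S i) (n - 1)"
proof -
  define \<phi> where "\<phi> = char_poly S"
  define b where "b = adj_mat (char_poly_matrix S) *\<^sub>v ones n"
  define c where "c = (\<lambda>i. \<Sum>j<n. [:walk_vec S i $ j:] * b $ j)"
  have c: "walk_gen S i = c i" for i using S by (simp add: walk_gen_def c_def b_def)
  define M where "M = char_poly_matrix S"
  have M: "M \<in> carrier_mat n n" using S by (simp add: M_def)
  note A = adj_mat[OF M]
  have b: "b \<in> carrier_vec n" using A(1) by (auto simp: b_def M_def[symmetric] intro!: mult_mat_vec_carrier)
  have \<phi>: "\<phi> = det M" by (simp add: \<phi>_def M_def char_poly_def)
  have nz: "det M \<noteq> 0" using degree_monic_char_poly[OF S] by (auto simp: \<phi>[symmetric] \<phi>_def)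
  have c0: "c 0 = ones n \<bullet> b" using S b by (simp add: c_def scalar_prod_def atLeast0LessThan one_pCons)
  show "char_poly (mat n n (\<lambda>_. 1) - S) = char_poly S - walk_gen S 0"
  proof -
    let ?J = "mat n n (\<lambda>_. 1) :: 'a mat"
    have JS: "?J - S \<in> carrier_mat n n" using S by (simp add: minus_carrier_mat)
    have sk: "S $$ (j, i) = - S $$ (i, j)" if "i < n" "j < n" for i j
      using skew S that by (metis carrier_matD index_transpose_mat(1) index_uminus_mat(1))
    \<comment> \<open>Transposing turns \<open>J - S\<close> into \<open>J + S\<close> by skewness,
      and \<open>x I - S - J\<close> differs from \<open>M\<close> by the rank one matrix
      \<open>- e e^T\<close>.\<close>
    have eq: "char_poly_matrix (?J - S)\<^sup>T = M + mat n n (\<lambda>(i, j). (- ones n) $ i * ones n $ j)"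
    proof (rule eq_matI)
      show "char_poly_matrix (?J - S)\<^sup>T $$ (i, j) =
          (M + mat n n (\<lambda>(i, j). (- ones n) $ i * ones n $ j)) $$ (i, j)"
        if "i < dim_row (M + mat n n (\<lambda>(i, j). (- ones n) $ i * ones n $ j))"
          "j < dim_col (M + mat n n (\<lambda>(i, j). (- ones n) $ i * ones n $ j))" for i j
        using that S sk[of i j] by (auto simp: char_poly_matrix_def M_def one_pCons)
    qed (use S in \<open>auto simp: char_poly_matrix_def M_def\<close>)
    have "char_poly (?J - S) = char_poly ((?J - S)\<^sup>T)" using JS by simp
    also have "\<dots> = det (M + mat n n (\<lambda>(i, j). (- ones n) $ i * ones n $ j))"
      by (simp only: char_poly_def eq)
    also have "\<dots> = det M + ones n \<bullet> (adj_mat M *\<^sub>v (- ones n))"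
      using M nz by (intro det_rank_one_update) auto
    also have "adj_mat M *\<^sub>v (- ones n) = - b"
      using A(1) by (intro eq_vecI) (auto simp: b_def M_def[symmetric] scalar_prod_uminus_right)
    also have "ones n \<bullet> (- b) = - c 0" using b c0 by simp
    finally show ?thesis by (simp add: c \<phi> \<phi>_def[symmetric])
  qed
  have Mb: "M *\<^sub>v b = \<phi> \<cdot>\<^sub>v ones n"
  proof -
    have "M *\<^sub>v b = (M * adj_mat M) *\<^sub>v ones n"
      using M A(1) by (simp add: b_def M_def[symmetric] assoc_mult_mat_vec[of _ n n _ n])
    then show ?thesis unfolding A(2) \<phi> by (simp add: smult_one_mult_vec)
  qed
  have row: "[:0, 1:] * b $ j - (\<Sum>l<n. [:S $$ (j, l):] * b $ l) = \<phi>" if "j < n" for j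
  proof -
    have "\<phi> = (M *\<^sub>v b) $ j" using that unfolding Mb by simp
    also have "\<dots> = (\<Sum>l<n. M $$ (j, l) * b $ l)"
      using that M b by (simp add: scalar_prod_def atLeast0LessThan)
    also have "\<dots> = (\<Sum>l<n. (if l = j then [:0, 1:] * b $ j else 0) - [:S $$ (j, l):] * b $ l)"
      using that S by (intro sum.cong) (auto simp: M_def char_poly_matrix_def algebra_simps)
    also have "\<dots> = [:0, 1:] * b $ j - (\<Sum>l<n. [:S $$ (j, l):] * b $ l)"
      using that by (simp add: sum_subtractf)
    finally show ?thesis by simp
  qed
  have rec: "c (Suc i) = Polynomial.smult (walk_count S i) \<phi> - [:0, 1:] * c i" for i
  proof -
    have "Polynomial.smult (walk_count S i) \<phi> = (\<Sum>j<n. [:walk_vec S i $ j:] * \<phi>)"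
      using S by (simp add: walk_count_def scalar_prod_def atLeast0LessThan smult_sum)
    also have "\<dots> = (\<Sum>j<n. [:walk_vec S i $ j:] * ([:0, 1:] * b $ j - (\<Sum>l<n. [:S $$ (j, l):] * b $ l)))"
      using row by simp
    also have "\<dots> = [:0, 1:] * c i - (\<Sum>j<n. \<Sum>l<n. [:walk_vec S i $ j:] * [:S $$ (j, l):] * b $ l)"
      by (simp add: c_def algebra_simps sum_subtractf sum_distrib_left)
    also have "(\<Sum>j<n. \<Sum>l<n. [:walk_vec S i $ j:] * [:S $$ (j, l):] * b $ l) =
        (\<Sum>l<n. \<Sum>j<n. [:walk_vec S i $ j:] * [:S $$ (j, l):] * b $ l)"
      by (rule sum.swap)
    also have "\<dots> = - c (Suc i)"
    proof -
      have "(\<Sum>j<n. [:walk_vec S i $ j:] * [:S $$ (j, l):] * b $ l) = - ([:walk_vec S (Suc i) $ l:] * b $ l)"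
        if "l < n" for l
      proof -
        have sk: "S $$ (j, l) = - S $$ (l, j)" if "j < n" for j
          using skew S that \<open>l < n\<close> by (metis carrier_matD index_transpose_mat(1) index_uminus_mat(1))
        have "walk_vec S (Suc i) $ l = (\<Sum>j<n. S $$ (l, j) * walk_vec S i $ j)"
          using that S by (simp add: walk_vec_Suc[OF S] scalar_prod_def atLeast0LessThan)
        then show ?thesis
          by (simp add: sk smult_sum sum_negf[symmetric] mult.commute)
      qed
      then show ?thesis by (simp add: c_def sum_negf)
    qed
    finally show ?thesis by simp
  qed
  then show "walk_gen S (Suc i) =
      Polynomial.smult (walk_count S i) (char_poly S) - [:0, 1:] * walk_gen S i"
    unfolding c \<phi>_def[symmetric] .
  have degb: "degree (b $ j) < n" if "j < n" for j
  proof -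
    have "b $ j = (\<Sum>l<n. adj_mat M $$ (j, l))"
      using that A(1) by (simp add: b_def M_def[symmetric] scalar_prod_def atLeast0LessThan)
    then show ?thesis
      using degree_adj_char_poly_matrix[OF S that] n
      by (auto simp: M_def intro!: degree_sum_less)
  qed
  have coeffc: "coeff (c i) k = 0" if "n \<le> k" for i k
  proof -
    have "coeff (b $ j) k = 0" if "j < n" for j
      using degb[OF that] \<open>n \<le> k\<close> by (intro coeff_eq_0) simp
    then show ?thesis by (simp add: c_def coeff_sum)
  qed
  \<comment> \<open>In degree \<open>n\<close> the left side vanishes by the degree bound,
    \<open>\<phi>\<close> is monic, and the remaining term is the coefficient of \<open>c i\<close>
    in degree \<open>n - 1\<close>.\<close>
  have "coeff (c (Suc i)) n = walk_count S i * coeff \<phi> n - coeff ([:0, 1:] * c i) n"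
    by (simp add: rec)
  moreover have "coeff \<phi> n = 1" using degree_monic_char_poly[OF S] by (simp add: \<phi>_def)
  moreover have "coeff ([:0, 1:] * c i) n = coeff (c i) (n - 1)"
    using n by (cases n) auto
  ultimately show "walk_count S i = coeff (walk_gen S i) (n - 1)" by (simp add: coeffc c)
qed

text \<open>Induction on \<open>i\<close>: the two characteristic polynomials give
  \<open>walk_gen S 0\<close>, and the coefficient of \<open>walk_gen S i\<close> in degree
  \<open>n - 1\<close> is the walk count that the recursion needs for the next step.\<close>

lemma walk_count_determined:
  fixes S T :: "'a :: {idom, ring_char_0} mat"
  assumes S: "S \<in> carrier_mat n n" "S\<^sup>T = - S" and T: "T \<in> carrier_mat n n" "T\<^sup>T = - T" and n: "n > 0"
    and eq1: "char_poly S = char_poly T"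
    and eq2: "char_poly (mat n n (\<lambda>_. 1) - S) = char_poly (mat n n (\<lambda>_. 1) - T)"
  shows "walk_count S i = walk_count T i"
proof -
  note wS = walk_count_eq_coeff[OF S n] and wT = walk_count_eq_coeff[OF T n]
  have "walk_gen S i = walk_gen T i" for i
  proof (induction i)
    case 0
    then show ?case using wS(1) wT(1) eq1 eq2 by simp
  next
    case (Suc i)
    then have "walk_count S i = walk_count T i" by (simp add: wS(3) wT(3))
    with Suc show ?case by (simp only: wS(2) wT(2) eq1)
  qed
  then show ?thesis by (simp add: wS(3) wT(3))
qed

lemma complex_monic_eq_if_proots_eq:
  fixes p q :: "complex poly"
  assumes "lead_coeff p = 1" "lead_coeff q = 1" "proots p = proots q"
  shows "p = q"
proof -
  have "r = (\<Prod>x\<in>#proots r. [:- x, 1:])" if "lead_coeff r = 1" for r :: "complex poly"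
    using complex_poly_decompose_multiset[of r] that by simp
  with assms show ?thesis by metis
qed

text \<open>Characteristic polynomials are monic, so over the complex numbers their roots with
  multiplicity determine them, and the integers embed injectively.\<close>

lemma char_poly_eq_if_spec_eq:
  assumes A: "A \<in> carrier_mat n n" and B: "B \<in> carrier_mat n n" and eq: "spec A = spec B"
  shows "char_poly A = char_poly B"
proof -
  have "char_poly (map_mat complex_of_int A) = char_poly (map_mat complex_of_int B)"
    using degree_monic_char_poly[of "map_mat complex_of_int A" n]
      degree_monic_char_poly[of "map_mat complex_of_int B" n] A B eq
    by (intro complex_monic_eq_if_proots_eq) (auto simp: spec_def)
  then show ?thesis
    unfolding of_int_hom.char_poly_hom[OF A] of_int_hom.char_poly_hom[OF B]
    by simp
qed

section \<open>The prime 2\<close>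

text \<open>A pigeonhole form of linear dependence modulo 2: there are \<open>2^(r+1)\<close> sets
  of columns but only \<open>2^r\<close> parity vectors, and the difference of two sets with the
  same parity vector is a relation.\<close>

lemma parity_dependency:
  fixes A :: "nat \<Rightarrow> nat \<Rightarrow> int"
  obtains c :: "nat \<Rightarrow> int" and m where "m \<le> r" "odd (c m)" "\<And>i. i > m \<Longrightarrow> c i = 0"
    "\<And>k. k < r \<Longrightarrow> even (\<Sum>i\<le>m. A k i * c i)"
proof -
  let ?f = "\<lambda>X. {k. k < r \<and> odd (\<Sum>i\<in>X. A k i)}"
  have "?f ` Pow {..r} \<subseteq> Pow {..<r}" by auto
  then have "card (?f ` Pow {..r}) \<le> card (Pow {..<r})" by (intro card_mono) auto
  also have "\<dots> < card (Pow {..r})" by (simp add: card_Pow)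
  finally have "\<not> inj_on ?f (Pow {..r})" using pigeonhole by blast
  then obtain X Y where XY: "X \<subseteq> {..r}" "Y \<subseteq> {..r}" "X \<noteq> Y" "?f X = ?f Y"
    unfolding inj_on_def by blast
  define c :: "nat \<Rightarrow> int" where "c i = of_bool (i \<in> X) - of_bool (i \<in> Y)" for i
  have sub: "{i. odd (c i)} \<subseteq> {..r}" using XY by (auto simp: c_def)
  have fin: "finite {i. odd (c i)}" using finite_subset[OF sub] by simp
  have ne: "{i. odd (c i)} \<noteq> {}" using XY by (auto simp: c_def)
  \<comment> \<open>Taking the largest index with an odd coefficient makes the last coefficient of
    the relation invertible modulo 2. Beyond \<open>m\<close> the coefficients are even and lie in
    \<open>{-1, 0, 1}\<close>, so they vanish.\<close>
  define m where "m = Max {i. odd (c i)}"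
  have m: "odd (c m)" using Max_in[OF fin ne] by (simp add: m_def)
  have gt: "c i = 0" if "i > m" for i
  proof -
    have "even (c i)" using that Max_ge[OF fin, of i] by (force simp: m_def)
    then show ?thesis by (auto simp: c_def split: if_splits)
  qed
  have "even (\<Sum>i\<le>m. A k i * c i)" if "k < r" for k
  proof -
    have mr: "m \<le> r" using m sub by auto
    have "(\<Sum>i\<le>m. A k i * c i) = (\<Sum>i\<le>r. A k i * c i)"
      using mr gt by (intro sum.mono_neutral_left) auto
    also have "\<dots> = (\<Sum>i\<in>X. A k i) - (\<Sum>i\<in>Y. A k i)"
    proof -
      have "(\<Sum>i\<le>r. A k i * of_bool (i \<in> Z)) = (\<Sum>i\<in>Z. A k i)" if "Z \<subseteq> {..r}" for Z
        using that by (intro sum.mono_neutral_cong_right) auto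
      then show ?thesis using XY(1,2) by (simp add: c_def right_diff_distrib sum_subtractf)
    qed
    also have "even \<dots>" using XY(4) that by auto
    finally show ?thesis .
  qed
  moreover have "m \<le> r" using m sub by auto
  ultimately show ?thesis using m gt by (intro that)
qed

text \<open>Symmetry pairs the off-diagonal terms, and twice an even number is divisible by
  4.\<close>

lemma quadratic_form_mod_4:
  fixes g :: "nat \<Rightarrow> nat \<Rightarrow> int" and v :: "nat \<Rightarrow> int"
  assumes sym: "\<And>a b. g a b = g b a" and ev: "\<And>a b. a \<noteq> b \<Longrightarrow> even (g a b)"
  shows "4 dvd (\<Sum>a<r. \<Sum>b<r. v a * v b * g a b) - (\<Sum>a<r. v a * v a * g a a)"
proof (induction r)
  case (Suc r)
  have "even (\<Sum>a<r. v a * v r * g a r)" using ev by (intro dvd_sum) auto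
  then obtain q where q: "(\<Sum>a<r. v a * v r * g a r) = 2 * q" by (elim dvdE)
  have "(\<Sum>b<r. v r * v b * g r b) = 2 * q"
    unfolding q[symmetric] using sym by (intro sum.cong) auto
  then have "(\<Sum>a<Suc r. \<Sum>b<Suc r. v a * v b * g a b) - (\<Sum>a<Suc r. v a * v a * g a a) =
      (\<Sum>a<r. \<Sum>b<r. v a * v b * g a b) - (\<Sum>a<r. v a * v a * g a a) + 4 * q"
    using q by (simp add: sum.distrib)
  moreover have "4 dvd \<dots>" using Suc by (intro dvd_add) auto
  ultimately show ?case by (simp only:)
qed simp

text \<open>Strong induction that halves the index: up to sign \<open>h (2 m)\<close> is the squared
  length of \<open>S^m e\<close>, which modulo 2 is the sum of its entries, that is
  \<open>h m\<close>. Odd indices give 0.\<close>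

lemma even_walk_count:
  fixes S :: "int mat"
  assumes S: "S \<in> carrier_mat n n" and skew: "S\<^sup>T = - S" and "k > 0"
  shows "even (walk_count S k)"
  using \<open>k > 0\<close>
proof (induction k rule: less_induct)
  case (less k)
  show ?case
  proof (cases "even k")
    case True
    then obtain m where m: "k = m + m" by (metis evenE mult_2)
    have "even (walk_count S m)" using less m by simp
    have wc: "walk_count S m = (\<Sum>i<n. walk_vec S m $ i)"
      using S by (simp add: walk_count_def scalar_prod_def atLeast0LessThan)
    have "walk_vec S m \<bullet> walk_vec S m = (\<Sum>i<n. walk_vec S m $ i * walk_vec S m $ i)"
      using S by (simp add: scalar_prod_def atLeast0LessThan)
    then have "walk_vec S m \<bullet> walk_vec S m - walk_count S m =
        (\<Sum>i<n. walk_vec S m $ i * walk_vec S m $ i - walk_vec S m $ i)"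
      by (simp add: wc sum_subtractf)
    also have "even \<dots>" by (intro dvd_sum) auto
    finally have "even (walk_vec S m \<bullet> walk_vec S m)" using \<open>even (walk_count S m)\<close> by simp
    then show ?thesis
      unfolding walk_vec_scalar_prod[OF S skew] m by (cases "even m") auto
  qed (simp add: walk_count_odd[OF S skew])
qed

section \<open>Smith normal form: determinant and relations modulo 2\<close>

lemma det_diagonal:
  fixes f :: "nat \<Rightarrow> 'a :: comm_ring_1"
  shows "det (mat n n (\<lambda>(i, j). if i = j then f i else 0)) = (\<Prod>i<n. f i)"
  by (subst det_upper_triangular[of _ n])
    (auto simp: prod_list_diag_prod atLeast0LessThan intro!: upper_triangularI)

lemma diagonal_mult_vec:
  fixes f :: "nat \<Rightarrow> 'a :: comm_ring_1"
  assumes x: "x \<in> carrier_vec n"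
  shows "mat n n (\<lambda>(i, j). if i = j then f i else 0) *\<^sub>v x = vec n (\<lambda>i. f i * x $ i)"
proof (rule eq_vecI)
  fix i assume "i < dim_vec (vec n (\<lambda>i. f i * x $ i))"
  then have i: "i < n" by simp
  have "(mat n n (\<lambda>(i, j). if i = j then f i else 0) *\<^sub>v x) $ i = (\<Sum>j<n. (if i = j then f i else 0) * x $ j)"
    using i x by (simp add: scalar_prod_def atLeast0LessThan)
  also have "\<dots> = (\<Sum>j<n. if j = i then f i * x $ i else 0)" by (intro sum.cong) auto
  finally show "(mat n n (\<lambda>(i, j). if i = j then f i else 0) *\<^sub>v x) $ i = vec n (\<lambda>i. f i * x $ i) $ i"
    using i by simp
qed simp

lemma target_snf_nth:
  assumes "n \<ge> 2" "i < n"
  shows "target_snf n d ! i = (if i < (n + 1) div 2 then 1 else if i < n - 1 then 2 else 2 * d)"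
proof -
  consider "i < (n + 1) div 2" | "(n + 1) div 2 \<le> i" "i < n - 1" | "i = n - 1" using assms by linarith
  then show ?thesis
  proof cases
    case 2
    then have "i - (n + 1) div 2 < n div 2 - 1" "\<not> i < (n + 1) div 2" using assms by linarith+
    with 2 show ?thesis by (simp add: target_snf_def nth_append)
  next
    case 3
    then have "i - (n + 1) div 2 = n div 2 - 1" "\<not> i < (n + 1) div 2" using assms by linarith+
    with 3 show ?thesis by (simp add: target_snf_def nth_append)
  qed (simp add: target_snf_def nth_append)
qed

lemma prod_target_snf:
  assumes "n \<ge> 2"
  shows "(\<Prod>i<n. target_snf n d ! i) = 2 ^ (n div 2) * d"
proof -
  have len: "length (target_snf n d) = n" using assms by (simp add: target_snf_def)
  have "(\<Prod>i<n. target_snf n d ! i) = prod_list (target_snf n d)"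
    using len by (simp add: prod.list_conv_set_nth atLeast0LessThan)
  also have "\<dots> = 2 ^ (n div 2) * d"
    using assms by (cases "n div 2") (auto simp: target_snf_def)
  finally show ?thesis .
qed

lemma smith_form_det:
  assumes "has_smith_form n M ds"
  shows "\<exists>s. (s = 1 \<or> s = -1) \<and> det M = s * (\<Prod>i<n. ds ! i)"
proof -
  obtain U1 U2 where U: "unimodular n U1" "unimodular n U2"
      "M = U1 * mat n n (\<lambda>(i, j). if i = j then ds ! i else 0) * U2"
    using assms unfolding has_smith_form_def by blast
  have "det M = det U1 * (\<Prod>i<n. ds ! i) * det U2"
  proof -
    define D where "D = mat n n (\<lambda>(i, j). if i = j then ds ! i else 0)"
    have c: "U1 \<in> carrier_mat n n" "D \<in> carrier_mat n n" "U2 \<in> carrier_mat n n"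
      using U by (auto simp: unimodular_def D_def)
    have "det M = det (U1 * D) * det U2"
      unfolding U(3) D_def[symmetric] using c by (intro det_mult mult_carrier_mat)
    also have "det (U1 * D) = det U1 * det D" using c by (intro det_mult)
    finally show ?thesis by (simp add: D_def det_diagonal)
  qed
  then show ?thesis using U(1,2) unfolding unimodular_def
    by (intro exI[of _ "det U1 * det U2"]) auto
qed

text \<open>Modulo 2 only the first \<open>r\<close> rows of \<open>U2\<close> survive
  multiplication by the diagonal matrix, so a relation among the first \<open>r + 1\<close> columns
  of these rows carries over to the columns of \<open>M\<close>.\<close>

lemma smith_form_parity_relation:
  assumes sf: "has_smith_form n M ds" and ev: "\<And>i. r \<le> i \<Longrightarrow> i < n \<Longrightarrow> even (ds ! i)" and r: "r < n"
  obtains c :: "nat \<Rightarrow> int" and m where "m \<le> r" "odd (c m)"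
    "\<And>j. j < n \<Longrightarrow> even (\<Sum>i\<le>m. c i * M $$ (j, i))"
proof -
  obtain U1 U2 where U: "unimodular n U1" "unimodular n U2"
      "M = U1 * mat n n (\<lambda>(i, j). if i = j then ds ! i else 0) * U2"
    using sf unfolding has_smith_form_def by blast
  have c1: "U1 \<in> carrier_mat n n" and c2: "U2 \<in> carrier_mat n n"
    using U by (auto simp: unimodular_def)
  define D where "D = mat n n (\<lambda>(i, j). if i = j then ds ! i else 0)"
  have D: "D \<in> carrier_mat n n" by (simp add: D_def)
  have M: "M $$ (j, i) = (\<Sum>k<n. U1 $$ (j, k) * ds ! k * U2 $$ (k, i))" if "j < n" "i < n" for i j
  proof -
    have "M = U1 * (D * U2)" unfolding U(3) D_def[symmetric] using c1 c2 D by (intro assoc_mult_mat)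
    moreover have "(D * U2) $$ (k, i) = ds ! k * U2 $$ (k, i)" if "k < n" for k
    proof -
      have "(D * U2) $$ (k, i) = (D *\<^sub>v col U2 i) $ k" using that \<open>i < n\<close> D c2 by simp
      also have "\<dots> = ds ! k * U2 $$ (k, i)"
        using that \<open>i < n\<close> c2 unfolding D_def by (subst diagonal_mult_vec) auto
      finally show ?thesis .
    qed
    ultimately show ?thesis using that c1 c2 D
      by (auto simp: scalar_prod_def atLeast0LessThan mult.assoc intro!: sum.cong)
  qed
  obtain c :: "nat \<Rightarrow> int" and m where cm: "m \<le> r" "odd (c m)" "\<And>i. i > m \<Longrightarrow> c i = 0"
    "\<And>k. k < r \<Longrightarrow> even (\<Sum>i\<le>m. U2 $$ (k, i) * c i)"
    by (rule parity_dependency[of r "\<lambda>k i. U2 $$ (k, i)"]) (rule that)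
  have "even (\<Sum>i\<le>m. c i * M $$ (j, i))" if j: "j < n" for j
  proof -
    have "(\<Sum>i\<le>m. c i * M $$ (j, i)) = (\<Sum>i\<le>m. \<Sum>k<n. U1 $$ (j, k) * ds ! k * (U2 $$ (k, i) * c i))"
      using cm(1) r j by (intro sum.cong) (auto simp: M sum_distrib_left mult_ac)
    also have "\<dots> = (\<Sum>k<n. U1 $$ (j, k) * ds ! k * (\<Sum>i\<le>m. U2 $$ (k, i) * c i))"
      by (subst sum.swap) (simp add: sum_distrib_left)
    also have "even \<dots>"
    proof (rule dvd_sum)
      fix k assume "k \<in> {..<n}"
      then show "even (U1 $$ (j, k) * ds ! k * (\<Sum>i\<le>m. U2 $$ (k, i) * c i))"
        using cm(4)[of k] ev[of k] by (cases "k < r") auto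
    qed
    finally show ?thesis .
  qed
  then show ?thesis using cm(1,2) by (intro that)
qed

text \<open>The odd coefficient \<open>c m\<close> expresses \<open>S^m e\<close> modulo 2 by lower
  walk vectors, so the span of the first \<open>m\<close> of them is stable under \<open>S\<close>
  modulo 2.\<close>

lemma walk_vec_reduce_mod_2:
  fixes S :: "int mat"
  assumes S: "S \<in> carrier_mat n n" and odd: "odd (c m)"
    and rel: "\<And>j. j < n \<Longrightarrow> even (\<Sum>i\<le>m. c i * walk_vec S i $ j)"
  shows "\<exists>v. \<forall>j<n. even (walk_vec S k $ j - (\<Sum>i<m. v i * walk_vec S i $ j))"
proof -
  let ?red = "\<lambda>k v. \<forall>j<n. even (walk_vec S k $ j - (\<Sum>i<m. v i * walk_vec S i $ j))"
  \<comment> \<open>The case \<open>i = m\<close> is included because the induction below applies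
    \<open>S\<close> to \<open>S^i e\<close> with \<open>i < m\<close>, which leads as far as index
    \<open>m\<close>.\<close>
  have base: "\<exists>v. ?red i v" if "i \<le> m" for i
  proof (cases "i = m")
    case True
    have "even (walk_vec S m $ j - (\<Sum>i<m. c i * walk_vec S i $ j))" if "j < n" for j
    proof -
      have "(\<Sum>i\<le>m. c i * walk_vec S i $ j) = (\<Sum>i<m. c i * walk_vec S i $ j) + c m * walk_vec S m $ j"
        by (simp add: lessThan_Suc_atMost[symmetric])
      then show ?thesis using rel[OF that] odd by auto
    qed
    then show ?thesis using True by blast
  next
    case False
    have "(\<Sum>l<m. of_bool (l = i) * walk_vec S l $ j) = walk_vec S i $ j" for j
    proof -
      have "(\<Sum>l<m. of_bool (l = i) * walk_vec S l $ j) = (\<Sum>l<m. if l = i then walk_vec S i $ j else 0)"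
        by (intro sum.cong) auto
      then show ?thesis using False that by simp
    qed
    then show ?thesis by (intro exI[of _ "\<lambda>l. of_bool (l = i)"]) simp
  qed
  then have "\<forall>i\<in>{..m}. \<exists>v. ?red i v" by simp
  from bchoice[OF this] obtain V where V: "\<And>i. i \<le> m \<Longrightarrow> ?red i (V i)" by auto
  show ?thesis
  proof (induction k)
    case 0
    then show ?case using base[of 0] by blast
  next
    case (Suc k)
    then obtain v where v: "?red k v" by blast
    have "even (walk_vec S (Suc k) $ j - (\<Sum>l<m. (\<Sum>i<m. v i * V (Suc i) l) * walk_vec S l $ j))"
      if j: "j < n" for j
    proof -
      have Sx: "walk_vec S (Suc k) $ j = (\<Sum>l<n. S $$ (j, l) * walk_vec S k $ l)" for k
        using j S by (simp add: walk_vec_Suc[OF S] scalar_prod_def atLeast0LessThan)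
      have "walk_vec S (Suc k) $ j - (\<Sum>i<m. v i * walk_vec S (Suc i) $ j) =
          (\<Sum>l<n. S $$ (j, l) * (walk_vec S k $ l - (\<Sum>i<m. v i * walk_vec S i $ l)))"
        unfolding Sx by (simp add: right_diff_distrib sum_subtractf sum_distrib_left mult_ac)
          (rule sum.swap)
      also have "even \<dots>" using v by (intro dvd_sum) auto
      finally have 1: "even (walk_vec S (Suc k) $ j - (\<Sum>i<m. v i * walk_vec S (Suc i) $ j))" .
      have "(\<Sum>i<m. v i * walk_vec S (Suc i) $ j) - (\<Sum>l<m. (\<Sum>i<m. v i * V (Suc i) l) * walk_vec S l $ j) =
          (\<Sum>i<m. v i * (walk_vec S (Suc i) $ j - (\<Sum>l<m. V (Suc i) l * walk_vec S l $ j)))"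
        by (simp add: right_diff_distrib sum_subtractf sum_distrib_left sum_distrib_right mult_ac)
          (rule sum.swap)
      also have "even \<dots>" using V j by (intro dvd_sum) (auto simp: Suc_le_eq)
      finally show ?thesis using 1 by auto
    qed
    then show ?case by (intro exI[of _ "\<lambda>l. \<Sum>i<m. v i * V (Suc i) l"]) simp
  qed
qed

text \<open>There are \<open>ceil(n/2)\<close> even indices below \<open>n\<close>, as many as there
  are leading ones in the Smith form. So coefficients indexed by \<open>a < ceil(n/2)\<close> can be
  spread over the even positions of a vector of length \<open>n\<close>.\<close>

lemma sum_even_indices:
  fixes f :: "nat \<Rightarrow> 'a :: comm_monoid_add"
  shows "(\<Sum>k<n. if even k then f (k div 2) else 0) = (\<Sum>a<(n + 1) div 2. f a)"
proof (induction n)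
  case (Suc n)
  show ?case
  proof (cases "even n")
    case True
    then obtain m where "n = 2 * m" by (elim evenE)
    with Suc show ?thesis by simp
  next
    case False
    then obtain m where "n = 2 * m + 1" by (elim oddE)
    with Suc show ?thesis by simp
  qed
qed simp

lemma mult_mat_smult_vec:
  fixes A :: "'a :: comm_ring_1 mat"
  assumes A: "A \<in> carrier_mat nr nc" and x: "x \<in> carrier_vec nc"
  shows "A *\<^sub>v (c \<cdot>\<^sub>v x) = c \<cdot>\<^sub>v (A *\<^sub>v x)"
  using assms by (intro eq_vecI) (auto simp: scalar_prod_smult_distrib[of _ nc])

lemma pow_mult_walk_vec:
  assumes S: "S \<in> carrier_mat n n"
  shows "S ^\<^sub>m j *\<^sub>v walk_vec S a = walk_vec S (a + j)"
proof (induction j)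
  case 0
  show ?case using S walk_vec_carrier[OF S, of a] by simp
next
  case (Suc j)
  have "S ^\<^sub>m Suc j *\<^sub>v walk_vec S a = S *\<^sub>v (S ^\<^sub>m j *\<^sub>v walk_vec S a)"
    unfolding pow_mat_Suc_left[OF S]
    using S by (intro assoc_mult_mat_vec[of _ n n _ n]) (auto intro!: pow_carrier_mat)
  then show ?case by (simp add: Suc walk_vec_Suc[OF S])
qed

lemma mult_mat_vec_sum:
  fixes A :: "'a :: comm_ring_1 mat"
  assumes A: "A \<in> carrier_mat n n" and f: "\<And>a. f a \<in> carrier_vec n" and i: "i < n"
  shows "(A *\<^sub>v vec n (\<lambda>j. \<Sum>a<r. v a * f a $ j)) $ i = (\<Sum>a<r. v a * (A *\<^sub>v f a) $ i)"
proof -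
  have "(A *\<^sub>v f a) $ i = (\<Sum>j<n. A $$ (i, j) * f a $ j)" for a
    using A f[of a] i by (simp add: scalar_prod_def atLeast0LessThan)
  moreover have "(A *\<^sub>v vec n (\<lambda>j. \<Sum>a<r. v a * f a $ j)) $ i =
      (\<Sum>j<n. A $$ (i, j) * (\<Sum>a<r. v a * f a $ j))"
    using A i by (simp add: scalar_prod_def atLeast0LessThan)
  ultimately show ?thesis
    by (simp add: sum_distrib_left mult_ac) (rule sum.swap)
qed

text \<open>In the Gram matrix of the walk vectors every entry is even, except the one in position
  \<open>(0, 0)\<close> for odd \<open>n\<close>; so \<open>n\<close> (resp. \<open>n - 1\<close>) columns can be halved, and the hypothesis on
  \<open>det W\<close> says that the resulting integer matrix \<open>K\<close> is invertible modulo 2.\<close>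

lemma krylov_gram_halved:
  fixes S :: "int mat"
  assumes S: "S \<in> carrier_mat n n" and skew: "S\<^sup>T = - S" and n: "n > 0"
    and detW: "det (krylov_mat S) = 2 ^ (n div 2) * q" "odd q"
  obtains K where "K \<in> carrier_mat n n" "odd (det K)"
    "\<And>x. x \<in> carrier_vec n \<Longrightarrow> (krylov_mat S)\<^sup>T *\<^sub>v (krylov_mat S *\<^sub>v x) =
       K *\<^sub>v vec n (\<lambda>i. (if i = 0 \<and> odd n then 1 else 2) * x $ i)"
proof -
  define W where "W = krylov_mat S"
  have W: "W \<in> carrier_mat n n" using S by (simp add: W_def)
  define f :: "nat \<Rightarrow> int" where "f i = (if i = 0 \<and> odd n then 1 else 2)" for i
  define C where "C = mat n n (\<lambda>(i, j). if i = j then f i else 0)"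
  define K where "K = mat n n (\<lambda>(i, j). ((-1) ^ i * walk_count S (i + j)) div f j)"
  have C: "C \<in> carrier_mat n n" and K: "K \<in> carrier_mat n n" by (auto simp: C_def K_def)
  have w0: "walk_count S 0 = int n"
    using S by (simp add: walk_count_def scalar_prod_def)
  have f_dvd: "f j dvd (-1) ^ i * walk_count S (i + j)" if "j < n" for i j
  proof (cases "i + j = 0")
    case True
    then show ?thesis using w0 by (auto simp: f_def)
  next
    case False
    then show ?thesis using even_walk_count[OF S skew, of "i + j"] by (auto simp: f_def)
  qed
  have G: "W\<^sup>T * W = K * C"
  proof -
    have "(K * C) $$ (i, j) = (-1) ^ i * walk_count S (i + j)" if "i < n" "j < n" for i j
    proof -
      have "(K * C) $$ (i, j) = (\<Sum>k<n. K $$ (i, k) * (if k = j then f k else 0))"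
        using that K C by (simp add: scalar_prod_def atLeast0LessThan C_def)
      also have "\<dots> = (\<Sum>k<n. if k = j then K $$ (i, j) * f j else 0)"
        by (intro sum.cong) auto
      also have "\<dots> = (-1) ^ i * walk_count S (i + j)"
        using that f_dvd[of j i] by (simp add: K_def)
      finally show ?thesis .
    qed
    then show ?thesis unfolding W_def krylov_gram(1)[OF S skew] using K C by (intro eq_matI) auto
  qed
  have "det C = 2 ^ (2 * (n div 2))"
  proof -
    obtain m where m: "n = Suc m" using n by (cases n) auto
    have "det C = (\<Prod>i<n. f i)" unfolding C_def by (rule det_diagonal)
    also have "\<dots> = f 0 * 2 ^ m" unfolding m prod.lessThan_Suc_shift by (simp add: f_def)
    also have "\<dots> = 2 ^ (2 * (n div 2))"
    proof (cases "even n")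
      case True
      then have "2 * (n div 2) = Suc m" using m by simp
      then show ?thesis using True by (simp add: f_def)
    next
      case False
      then have "2 * (n div 2) = m" using m by simp
      then show ?thesis using False by (simp add: f_def)
    qed
    finally show ?thesis .
  qed
  moreover have "det (W\<^sup>T * W) = det W * det W" using W by (simp add: det_mult[of _ n] det_transpose)
  \<comment> \<open>The power of 2 in the square of \<open>det W\<close> is exactly
    \<open>det C\<close>, which leaves the odd square \<open>q * q\<close> for
    \<open>det K\<close>.\<close>
  ultimately have "det K * 2 ^ (2 * (n div 2)) = (2 ^ (n div 2) * q) * (2 ^ (n div 2) * q)"
    using G det_mult[OF K C] detW(1) by (simp add: W_def)
  also have "\<dots> = q * q * 2 ^ (2 * (n div 2))" by (simp add: mult_2 power_add)
  finally have "det K = q * q" by simp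
  then have "odd (det K)" using detW(2) by simp
  moreover have "W\<^sup>T *\<^sub>v (W *\<^sub>v x) = K *\<^sub>v vec n (\<lambda>i. f i * x $ i)" if x: "x \<in> carrier_vec n" for x
  proof -
    have "W\<^sup>T *\<^sub>v (W *\<^sub>v x) = (K * C) *\<^sub>v x" using W x by (simp add: G[symmetric] assoc_mult_mat_vec[of _ n n _ n])
    also have "\<dots> = K *\<^sub>v (C *\<^sub>v x)" using K C x by (intro assoc_mult_mat_vec)
    finally show ?thesis unfolding C_def diagonal_mult_vec[OF x] .
  qed
  ultimately show ?thesis using K unfolding W_def f_def by (intro that)
qed

text \<open>Multiplying \<open>K x\<close> by the adjugate gives \<open>det K\<close> times
  \<open>x\<close>, and an odd factor does not affect parity.\<close>

lemma odd_det_even_vec: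
  fixes K :: "int mat"
  assumes K: "K \<in> carrier_mat n n" and odd: "odd (det K)" and x: "x \<in> carrier_vec n"
    and ev: "\<And>i. i < n \<Longrightarrow> even ((K *\<^sub>v x) $ i)" and i: "i < n"
  shows "even (x $ i)"
proof -
  note A = adj_mat[OF K]
  have "det K * x $ i = ((adj_mat K * K) *\<^sub>v x) $ i"
    using i x by (simp add: A(3) smult_one_mult_vec)
  also have "(adj_mat K * K) *\<^sub>v x = adj_mat K *\<^sub>v (K *\<^sub>v x)"
    using A(1) K x by (intro assoc_mult_mat_vec)
  also have "\<dots> $ i = (\<Sum>j<n. adj_mat K $$ (i, j) * (K *\<^sub>v x) $ j)"
    using A(1) K i by (simp add: scalar_prod_def atLeast0LessThan)
  also have "even \<dots>" using ev by (intro dvd_sum) auto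
  finally show ?thesis using odd by simp
qed

lemma krylov_mat_mult_vec:
  assumes S: "S \<in> carrier_mat n n" and x: "x \<in> carrier_vec n"
  shows "krylov_mat S *\<^sub>v x = vec n (\<lambda>i. \<Sum>k<n. x $ k * walk_vec S k $ i)"
  using S x by (intro eq_vecI) (auto simp: krylov_mat_def scalar_prod_def atLeast0LessThan mult.commute)

text \<open>In the application \<open>u = 2 y\<close> for a vector \<open>y\<close> of the lattice
  \<open>Q L\<close> with \<open>2 y\<close> integral. Then \<open>orth\<close> and
  \<open>norm\<close> record that the scalar products of \<open>y\<close> with the walk vectors and
  of \<open>S^j y\<close> with itself are integral at 2.\<close>

lemma two_divisible_if_isotropic:
  fixes S :: "int mat" and d :: int
  assumes S: "S \<in> carrier_mat n n" and skew: "S\<^sup>T = - S" and n: "n \<ge> 2" and d: "odd d"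
    and sf: "has_smith_form n (krylov_mat S) (target_snf n d)"
    and u: "u \<in> carrier_vec n"
    and orth: "\<And>k. k < n \<Longrightarrow> even (walk_vec S k \<bullet> u)"
    and norm: "\<And>j. 4 dvd (S ^\<^sub>m j *\<^sub>v u) \<bullet> (S ^\<^sub>m j *\<^sub>v u)"
    and i: "i < n"
  shows "even (u $ i)"
proof -
  define W where "W = krylov_mat S"
  define r where "r = (n + 1) div 2"
  have W: "W \<in> carrier_mat n n" using S by (simp add: W_def)
  have WT: "W\<^sup>T *\<^sub>v x = vec n (\<lambda>k. walk_vec S k \<bullet> x)" if "x \<in> carrier_vec n" for x
    using S that by (intro eq_vecI) (auto simp: W_def col_krylov_mat[OF S])
  have r: "r < n" "0 < r" using n by (auto simp: r_def)
  obtain s where s: "s = 1 \<or> s = -1" "det W = s * (2 ^ (n div 2) * d)"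
    using smith_form_det[OF sf] unfolding prod_target_snf[OF n] W_def by blast
  then have "det (krylov_mat S) = 2 ^ (n div 2) * (s * d)" "odd (s * d)" "det W \<noteq> 0"
    using d by (auto simp: W_def)
  note dW = this
  have "n > 0" using n by simp
  obtain K where K: "K \<in> carrier_mat n n" "odd (det K)"
    and WK: "\<And>x. x \<in> carrier_vec n \<Longrightarrow> W\<^sup>T *\<^sub>v (W *\<^sub>v x) =
       K *\<^sub>v vec n (\<lambda>i. (if i = 0 \<and> odd n then 1 else 2) * x $ i)"
    by (rule krylov_gram_halved[OF S skew \<open>n > 0\<close> dW(1,2), folded W_def]) (rule that)

  have "even (target_snf n d ! i)" if "r \<le> i" "i < n" for i
    using that target_snf_nth[OF n, of i d] by (auto simp: r_def)
  then obtain c m where m: "m \<le> r" and cm: "odd (c m)"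
    and rel: "\<And>j. j < n \<Longrightarrow> even (\<Sum>i\<le>m. c i * krylov_mat S $$ (j, i))"
    by (rule smith_form_parity_relation[OF sf _ r(1)]) (assumption, assumption, rule that)
  have "even (\<Sum>i\<le>m. c i * walk_vec S i $ j)" if "j < n" for j
  proof -
    have "(\<Sum>i\<le>m. c i * walk_vec S i $ j) = (\<Sum>i\<le>m. c i * krylov_mat S $$ (j, i))"
      using m r(1) that S by (intro sum.cong) (auto simp: krylov_mat_def)
    then show ?thesis using rel[OF that] by simp
  qed
  then have "\<forall>k. \<exists>v. \<forall>j<n. even (walk_vec S k $ j - (\<Sum>i<m. v i * walk_vec S i $ j))"
    using walk_vec_reduce_mod_2[of S n c m] S cm by simp
  from choice[OF this]
  obtain V where V: "\<And>k j. j < n \<Longrightarrow> even (walk_vec S k $ j - (\<Sum>i<m. V k i * walk_vec S i $ j))"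
    by auto

  define t where "t = vec n (\<lambda>k. (walk_vec S k \<bullet> u) div 2)"
  have t: "t \<in> carrier_vec n" by (simp add: t_def)
  define y where "y = adj_mat K *\<^sub>v t"
  have y: "y \<in> carrier_vec n" using adj_mat(1)[OF K(1)] t by (auto simp: y_def intro: mult_mat_vec_carrier)
  \<comment> \<open>Multiplying the coordinates of \<open>x\<close> by the factors in
    \<open>WK\<close> gives \<open>2 y\<close>, so the Gram matrix maps \<open>x\<close> to
    \<open>2 K y = 2 (det K) t\<close>, which is \<open>W^T U\<close> for the odd multiple
    \<open>U\<close> of \<open>u\<close>. As \<open>W^T\<close> is injective, \<open>U\<close> is an
    integral combination of walk vectors.\<close>
  define x where "x = vec n (\<lambda>i. (if i = 0 \<and> odd n then 2 else 1) * y $ i)"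
  have x: "x \<in> carrier_vec n" by (simp add: x_def)
  define U where "U = det K \<cdot>\<^sub>v u"
  have U: "U \<in> carrier_vec n" using u by (simp add: U_def)
  have "W *\<^sub>v x = U"
  proof -
    have "vec n (\<lambda>i. (if i = 0 \<and> odd n then 1 else 2) * x $ i) = 2 \<cdot>\<^sub>v y"
      using y by (intro eq_vecI) (auto simp: x_def)
    then have "W\<^sup>T *\<^sub>v (W *\<^sub>v x) = 2 \<cdot>\<^sub>v (K *\<^sub>v y)"
      unfolding WK[OF x] by (simp add: mult_mat_smult_vec[OF K(1) y])
    also have "K *\<^sub>v y = (K * adj_mat K) *\<^sub>v t"
      using adj_mat(1)[OF K(1)] K(1) t by (simp add: y_def assoc_mult_mat_vec[of _ n n _ n])
    also have "\<dots> = det K \<cdot>\<^sub>v t" unfolding adj_mat(2)[OF K(1)] using t by (rule smult_one_mult_vec)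
    also have "2 \<cdot>\<^sub>v (det K \<cdot>\<^sub>v t) = W\<^sup>T *\<^sub>v U"
    proof (rule eq_vecI)
      fix k assume "k < dim_vec (W\<^sup>T *\<^sub>v U)"
      then have k: "k < n" using W by simp
      have "2 * ((walk_vec S k \<bullet> u) div 2) = walk_vec S k \<bullet> u" using orth[OF k] by simp
      then show "(2 \<cdot>\<^sub>v (det K \<cdot>\<^sub>v t)) $ k = (W\<^sup>T *\<^sub>v U) $ k"
        using k u walk_vec_carrier[OF S, of k] unfolding WT[OF U]
        by (simp add: t_def U_def)
    qed (use W t in auto)
    finally have eq: "W\<^sup>T *\<^sub>v (W *\<^sub>v x) = W\<^sup>T *\<^sub>v U" .
    have Wx: "W *\<^sub>v x \<in> carrier_vec n" using W x by simp
    have "W\<^sup>T *\<^sub>v (W *\<^sub>v x - U) = 0\<^sub>v n"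
      using mult_minus_distrib_mat_vec[of "W\<^sup>T" n n "W *\<^sub>v x" U] W Wx U eq by simp
    moreover have "det (W\<^sup>T) \<noteq> 0" using \<open>det W \<noteq> 0\<close> det_transpose[OF W] by simp
    ultimately have "W *\<^sub>v x - U = 0\<^sub>v n"
      using det_0_iff_vec_prod_zero[of "W\<^sup>T" n] W minus_carrier_vec[OF Wx U] by auto
    then have "(W *\<^sub>v x) $ i = U $ i" if "i < n" for i
      using that index_minus_vec(1)[of i U "W *\<^sub>v x"] U by (simp del: index_minus_vec)
    then show ?thesis using W U by (intro eq_vecI) (auto simp del: index_mult_mat_vec)
  qed
  then have Ux: "U $ j = (\<Sum>k<n. x $ k * walk_vec S k $ j)" if "j < n" for j
    using krylov_mat_mult_vec[OF S x] that by (auto simp: W_def)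

  \<comment> \<open>\<open>v0\<close> collects the coefficients after each walk vector is reduced
    modulo 2, padded with 0 from \<open>m\<close> to \<open>r\<close>. The representatives 0 and 1
    in \<open>v\<close> provide \<open>v a * v a = v a\<close>.\<close>
  define v0 where "v0 a = (if a < m then \<Sum>k<n. x $ k * V k a else 0)" for a
  define v where "v a = v0 a mod 2" for a
  have v01: "v a = 0 \<or> v a = 1" for a unfolding v_def by auto
  have Uv: "even (U $ j - (\<Sum>a<r. v a * walk_vec S a $ j))" if j: "j < n" for j
  proof -
    have "(\<Sum>a<r. v0 a * walk_vec S a $ j) = (\<Sum>a<m. v0 a * walk_vec S a $ j)"
      using m by (intro sum.mono_neutral_right) (auto simp: v0_def)
    also have "\<dots> = (\<Sum>a<m. (\<Sum>k<n. x $ k * V k a) * walk_vec S a $ j)" by (simp add: v0_def)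
    finally have "U $ j - (\<Sum>a<r. v0 a * walk_vec S a $ j) =
        (\<Sum>k<n. x $ k * (walk_vec S k $ j - (\<Sum>a<m. V k a * walk_vec S a $ j)))"
      unfolding Ux[OF j]
      by (simp add: right_diff_distrib sum_subtractf sum_distrib_left sum_distrib_right mult_ac)
        (rule sum.swap)
    also have "even \<dots>" using V[OF j] by (intro dvd_sum) auto
    finally have 1: "even (U $ j - (\<Sum>a<r. v0 a * walk_vec S a $ j))" .
    have "(\<Sum>a<r. v0 a * walk_vec S a $ j) - (\<Sum>a<r. v a * walk_vec S a $ j) =
        (\<Sum>a<r. (v0 a - v a) * walk_vec S a $ j)"
      by (simp add: left_diff_distrib sum_subtractf)
    also have "even \<dots>" by (intro dvd_sum) (auto simp: v_def)
    finally show ?thesis using 1 by auto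
  qed
  \<comment> \<open>The pairing of \<open>U\<close> with \<open>e\<close> is even, and modulo 2 it
    equals \<open>v 0 * n\<close>, because the walk counts of positive index are even.\<close>
  have v0: "v 0 = 0" if "odd n"
  proof -
    have "(\<Sum>j<n. U $ j - (\<Sum>a<r. v a * walk_vec S a $ j)) =
        det K * (walk_vec S 0 \<bullet> u) - (\<Sum>a<r. v a * walk_count S a)"
      using S u U by (simp add: sum_subtractf U_def scalar_prod_def walk_count_def atLeast0LessThan
          sum_distrib_left sum.swap[of _ "{..<n}" "{..<r}"])
    moreover have "even (\<Sum>j<n. U $ j - (\<Sum>a<r. v a * walk_vec S a $ j))"
      using Uv by (intro dvd_sum) auto
    ultimately have "even (\<Sum>a<r. v a * walk_count S a)" using orth[of 0] n by auto
    moreover have "(\<Sum>a<r. v a * walk_count S a) =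
        v 0 * walk_count S 0 + (\<Sum>a<r - 1. v (Suc a) * walk_count S (Suc a))"
      using r(2) sum.lessThan_Suc_shift[of "\<lambda>a. v a * walk_count S a" "r - 1"] by simp
    moreover have "even (\<Sum>a<r - 1. v (Suc a) * walk_count S (Suc a))"
      using even_walk_count[OF S skew] by (intro dvd_sum) auto
    moreover have "walk_count S 0 = int n" using S by (simp add: walk_count_def scalar_prod_def)
    ultimately show ?thesis using that v01[of 0] by auto
  qed

  define w where "w = vec n (\<lambda>j. \<Sum>a<r. v a * walk_vec S a $ j)"
  define b where "b = vec n (\<lambda>j. (U $ j - w $ j) div 2)"
  have w: "w \<in> carrier_vec n" and b: "b \<in> carrier_vec n" by (auto simp: w_def b_def)
  have Uwb: "U = w + 2 \<cdot>\<^sub>v b"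
    using U Uv by (intro eq_vecI) (auto simp: w_def b_def)
  \<comment> \<open>Apply \<open>S^j\<close> to \<open>U = w + 2 b\<close> and take squared lengths:
    modulo 4 the terms with \<open>b\<close> drop out, and \<open>quadratic_form_mod_4\<close>
    leaves only the diagonal terms in the expansion for \<open>w\<close>.\<close>
  have hsum: "4 dvd (\<Sum>a<r. v a * walk_count S (2 * a + 2 * j))" for j
  proof -
    define g where "g a b = walk_vec S (a + j) \<bullet> walk_vec S (b + j)" for a b
    let ?P = "S ^\<^sub>m j"
    have P: "?P \<in> carrier_mat n n" using S by (rule pow_carrier_mat)
    have Pw: "?P *\<^sub>v w \<in> carrier_vec n" and Pb: "?P *\<^sub>v b \<in> carrier_vec n" using P w b by auto
    have PU: "?P *\<^sub>v U = ?P *\<^sub>v w + 2 \<cdot>\<^sub>v (?P *\<^sub>v b)"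
      unfolding Uwb using P w b by (simp add: mult_add_distrib_mat_vec[of _ n n] mult_mat_smult_vec[OF P b])
    have "?P *\<^sub>v U = det K \<cdot>\<^sub>v (?P *\<^sub>v u)" unfolding U_def using P u by (rule mult_mat_smult_vec)
    then have "(?P *\<^sub>v U) \<bullet> (?P *\<^sub>v U) = det K * det K * ((?P *\<^sub>v u) \<bullet> (?P *\<^sub>v u))"
      using P u by simp
    then have "4 dvd (?P *\<^sub>v U) \<bullet> (?P *\<^sub>v U)" using norm[of j] by simp
    moreover have "(?P *\<^sub>v U) \<bullet> (?P *\<^sub>v U) =
        (?P *\<^sub>v w) \<bullet> (?P *\<^sub>v w) + 4 * ((?P *\<^sub>v w) \<bullet> (?P *\<^sub>v b) + (?P *\<^sub>v b) \<bullet> (?P *\<^sub>v b))"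
      unfolding PU using Pw Pb comm_scalar_prod[OF Pw Pb]
      by (simp add: add_scalar_prod_distrib[of _ n] scalar_prod_add_distrib[of _ n])
    moreover have "(?P *\<^sub>v w) \<bullet> (?P *\<^sub>v w) = (\<Sum>a<r. \<Sum>b<r. v a * v b * g a b)"
    proof -
      have Pwi: "(?P *\<^sub>v w) $ i = (\<Sum>a<r. v a * walk_vec S (a + j) $ i)" if "i < n" for i
        unfolding w_def
        using mult_mat_vec_sum[OF P, of "walk_vec S" i v r] that S
        by (simp add: pow_mult_walk_vec[OF S])
      have "(?P *\<^sub>v w) \<bullet> (?P *\<^sub>v w) = (\<Sum>i<n. (?P *\<^sub>v w) $ i * (?P *\<^sub>v w) $ i)"
        by (simp only: scalar_prod_def carrier_vecD[OF Pw] atLeast0LessThan)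
      also have "\<dots> = (\<Sum>i<n. \<Sum>a<r. \<Sum>b<r. v a * v b * (walk_vec S (a + j) $ i * walk_vec S (b + j) $ i))"
        by (intro sum.cong) (auto simp: Pwi sum_product mult_ac simp del: index_mult_mat_vec)
      also have "\<dots> = (\<Sum>a<r. \<Sum>i<n. \<Sum>b<r. v a * v b * (walk_vec S (a + j) $ i * walk_vec S (b + j) $ i))"
        by (rule sum.swap)
      also have "\<dots> = (\<Sum>a<r. \<Sum>b<r. \<Sum>i<n. v a * v b * (walk_vec S (a + j) $ i * walk_vec S (b + j) $ i))"
        by (intro sum.cong refl sum.swap)
      also have "\<dots> = (\<Sum>a<r. \<Sum>b<r. v a * v b * g a b)"
        using S by (simp add: g_def scalar_prod_def atLeast0LessThan sum_distrib_left)
      finally show ?thesis .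
    qed
    ultimately have "4 dvd (\<Sum>a<r. \<Sum>b<r. v a * v b * g a b)"
      by (simp add: dvd_add_left_iff)
    moreover have "4 dvd (\<Sum>a<r. \<Sum>b<r. v a * v b * g a b) - (\<Sum>a<r. v a * v a * g a a)"
    proof (rule quadratic_form_mod_4)
      show "g a b = g b a" for a b
        unfolding g_def using S by (intro comm_scalar_prod[of _ n]) auto
      show "even (g a b)" if "a \<noteq> b" for a b
      proof -
        have "a + j + (b + j) > 0" using that by linarith
        then show ?thesis
          unfolding g_def walk_vec_scalar_prod[OF S skew] using even_walk_count[OF S skew] by simp
      qed
    qed
    ultimately have diag: "4 dvd (\<Sum>a<r. v a * v a * g a a)"
      by (subst (asm) dvd_diff_right_iff) auto
    \<comment> \<open>The diagonal terms are the wanted ones up to signs, and changing a sign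
      changes an even term by a multiple of 4. For \<open>a = j = 0\<close> the term is even since
      \<open>n\<close> is even or \<open>v 0 = 0\<close>.\<close>
    have "4 dvd (\<Sum>a<r. v a * v a * g a a) - (\<Sum>a<r. v a * walk_count S (2 * a + 2 * j))"
      unfolding sum_subtractf[symmetric]
    proof (rule dvd_sum)
      fix a
      have ev: "even (v a * walk_count S (2 * a + 2 * j))"
      proof (cases "2 * a + 2 * j = 0")
        case True
        then have "walk_count S (2 * a + 2 * j) = int n" "a = 0"
          using S by (auto simp: walk_count_def scalar_prod_def)
        then show ?thesis using v0 by (cases "odd n") auto
      next
        case False
        then show ?thesis using even_walk_count[OF S skew, of "2 * a + 2 * j"] by simp
      qed
      have "g a a = (-1) ^ (a + j) * walk_count S (2 * a + 2 * j)"
      proof -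
        have "a + j + (a + j) = 2 * a + 2 * j" by simp
        then show ?thesis unfolding g_def walk_vec_scalar_prod[OF S skew] by (simp only:)
      qed
      moreover have "v a * v a = v a" using v01[of a] by auto
      ultimately have "v a * v a * g a a - v a * walk_count S (2 * a + 2 * j) =
          ((-1) ^ (a + j) - 1) * (v a * walk_count S (2 * a + 2 * j))"
        by (simp only:) (simp only: left_diff_distrib right_diff_distrib mult_1 mult.left_commute)
      moreover have "(2 :: int) dvd (-1) ^ (a + j) - 1" by simp
      ultimately show "4 dvd v a * v a * g a a - v a * walk_count S (2 * a + 2 * j)"
        using ev mult_dvd_mono[of 2 "(-1) ^ (a + j) - 1" 2 "v a * walk_count S (2 * a + 2 * j)"] by simp
    qed
    then show ?thesis using diag by (subst (asm) dvd_diff_right_iff) auto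
  qed

  \<comment> \<open>With the coefficients on even positions, row \<open>i\<close> of the Gram matrix
    applied to \<open>vt\<close> is, up to sign, the sum of \<open>v a * h (2 a + i)\<close>: zero
    for odd \<open>i\<close>, divisible by 4 by \<open>hsum\<close> for even \<open>i\<close>. As
    \<open>vt\<close> vanishes at 0 for odd \<open>n\<close>, the same vector is
    \<open>2 K vt\<close>, so \<open>K vt\<close> is even.\<close>
  define vt where "vt = vec n (\<lambda>k. if even k then v (k div 2) else 0)"
  have vt: "vt \<in> carrier_vec n" by (simp add: vt_def)
  have "even (vt $ k)" if k: "k < n" for k
  proof (rule odd_det_even_vec[OF K vt _ k])
    fix i assume i: "i < n"
    have "vec n (\<lambda>i. (if i = 0 \<and> odd n then 1 else 2) * vt $ i) = 2 \<cdot>\<^sub>v vt"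
      using v0 by (intro eq_vecI) (auto simp: vt_def)
    then have "2 * (K *\<^sub>v vt) $ i = (W\<^sup>T *\<^sub>v (W *\<^sub>v vt)) $ i"
      unfolding WK[OF vt] using K(1) i by (simp add: mult_mat_smult_vec[OF K(1) vt])
    also have "\<dots> = ((W\<^sup>T * W) *\<^sub>v vt) $ i"
      using W vt by (simp add: assoc_mult_mat_vec[of _ n n _ n])
    also have "\<dots> = (\<Sum>k<n. (-1) ^ i * walk_count S (i + k) * vt $ k)"
      unfolding W_def krylov_gram(1)[OF S skew] using i vt
      by (simp add: scalar_prod_def atLeast0LessThan)
    also have "\<dots> = (\<Sum>k<n. if even k then (-1) ^ i * walk_count S (i + 2 * (k div 2)) * v (k div 2) else 0)"
      by (intro sum.cong) (auto simp: vt_def)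
    also have "\<dots> = (\<Sum>a<r. (-1) ^ i * walk_count S (i + 2 * a) * v a)"
      unfolding r_def by (rule sum_even_indices[of "\<lambda>a. (-1) ^ i * walk_count S (i + 2 * a) * v a"])
    also have "\<dots> = (-1) ^ i * (\<Sum>a<r. v a * walk_count S (2 * a + i))"
      by (simp add: sum_distrib_left mult_ac add.commute)
    also have "4 dvd \<dots>"
    proof (cases "even i")
      case True
      then show ?thesis using hsum[of "i div 2"] by simp
    next
      case False
      then show ?thesis by (simp add: walk_count_odd[OF S skew])
    qed
    finally show "even ((K *\<^sub>v vt) $ i)" by presburger
  qed
  then have "even (vt $ (2 * a))" if "a < r" for a using that by (simp add: r_def)
  then have "even (v a)" if "a < r" for a
    using that by (simp add: vt_def r_def)
  then have "v a = 0" if "a < r" for a using that v01[of a] by fastforce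
  then have "even (U $ i)" using Uv[OF i] by simp
  then show ?thesis using i u K(2) by (simp add: U_def)
qed

section \<open>Self-dual lattices over a localization of the integers\<close>

text \<open>The localization of the integers at \<open>p\<close>, inside the rationals. Since
  \<open>p dvd 0\<close>, the condition on \<open>b\<close> also keeps the denominator
  nonzero.\<close>

definition loc_int :: "int \<Rightarrow> rat set" where
  "loc_int p = {of_int a / of_int b | a b. \<not> p dvd b}"

lemma loc_intI: "\<not> p dvd b \<Longrightarrow> of_int a / of_int b \<in> loc_int p"
  by (auto simp: loc_int_def)

lemma loc_intE:
  assumes "t \<in> loc_int p"
  obtains a b where "t = of_int a / of_int b" "\<not> p dvd b" "b \<noteq> 0"
  using assms by (auto simp: loc_int_def)

lemma loc_int_of_int:
  assumes "prime p"
  shows "of_int a \<in> loc_int p"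
  using loc_intI[of p 1 a] assms by (auto simp: prime_int_iff)

lemma loc_int_add:
  assumes "prime p" "s \<in> loc_int p" "t \<in> loc_int p"
  shows "s + t \<in> loc_int p"
proof -
  obtain a b where s: "s = of_int a / of_int b" "\<not> p dvd b" "b \<noteq> 0"
    using assms(2) by (rule loc_intE)
  obtain c d where t: "t = of_int c / of_int d" "\<not> p dvd d" "d \<noteq> 0"
    using assms(3) by (rule loc_intE)
  note * = s t
  then have "s + t = of_int (a * d + c * b) / of_int (b * d)" by (simp add: add_frac_eq)
  moreover have "\<not> p dvd b * d" using * assms(1) by (simp add: prime_dvd_mult_iff)
  ultimately show ?thesis using loc_intI[of p "b * d"] by (simp only: not_False_eq_True)
qed

lemma loc_int_mult:
  assumes "prime p" "s \<in> loc_int p" "t \<in> loc_int p"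
  shows "s * t \<in> loc_int p"
proof -
  obtain a b where s: "s = of_int a / of_int b" "\<not> p dvd b" "b \<noteq> 0"
    using assms(2) by (rule loc_intE)
  obtain c d where t: "t = of_int c / of_int d" "\<not> p dvd d" "d \<noteq> 0"
    using assms(3) by (rule loc_intE)
  note * = s t
  then have "s * t = of_int (a * c) / of_int (b * d)" by simp
  moreover have "\<not> p dvd b * d" using * assms(1) by (simp add: prime_dvd_mult_iff)
  ultimately show ?thesis using loc_intI[of p "b * d"] by (simp only: not_False_eq_True)
qed

lemma loc_int_diff:
  assumes "prime p" "s \<in> loc_int p" "t \<in> loc_int p"
  shows "s - t \<in> loc_int p"
  using loc_int_add[OF assms(1,2) loc_int_mult[OF assms(1) loc_int_of_int[OF assms(1), of "-1"] assms(3)]]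
  by simp

lemma loc_int_0: "prime p \<Longrightarrow> 0 \<in> loc_int p"
  using loc_int_of_int[of p 0] by simp

lemma loc_int_sum:
  assumes "prime p" "\<And>i. i \<in> I \<Longrightarrow> f i \<in> loc_int p"
  shows "sum f I \<in> loc_int p"
  using assms(2) by (induction I rule: infinite_finite_induct) (auto simp: loc_int_0 loc_int_add assms(1))

text \<open>The localization is a local ring: a fraction is a unit unless \<open>p\<close> divides
  its numerator.\<close>

lemma loc_int_unit_or_multiple:
  assumes "t \<in> loc_int p"
  shows "t \<noteq> 0 \<and> 1 / t \<in> loc_int p \<or> (\<exists>s\<in>loc_int p. t = of_int p * s)"
proof -
  obtain a b where *: "t = of_int a / of_int b" "\<not> p dvd b" "b \<noteq> 0" using assms by (rule loc_intE)
  show ?thesis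
  proof (cases "p dvd a")
    case True
    then obtain a' where "a = p * a'" by (elim dvdE)
    with *(1) have "t = of_int p * (of_int a' / of_int b)" by simp
    then show ?thesis using loc_intI[OF *(2), of a'] by blast
  next
    case False
    then have "a \<noteq> 0" by auto
    with * False show ?thesis using loc_intI[of p a b] by simp
  qed
qed

text \<open>Non-units are multiples of \<open>p\<close>, and so is a sum of them, but 1 is
  not.\<close>

lemma loc_int_three_summands:
  assumes p: "prime p" and "r \<in> loc_int p" "s \<in> loc_int p" "t \<in> loc_int p" and sum: "r + s + t = 1"
  shows "r \<noteq> 0 \<and> 1 / r \<in> loc_int p \<or> s \<noteq> 0 \<and> 1 / s \<in> loc_int p \<or> t \<noteq> 0 \<and> 1 / t \<in> loc_int p"
proof (rule ccontr)
  assume "\<not> ?thesis"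
  then have "\<exists>s\<in>loc_int p. r = of_int p * s" "\<exists>t\<in>loc_int p. s = of_int p * t" "\<exists>s\<in>loc_int p. t = of_int p * s"
    using loc_int_unit_or_multiple[OF assms(2)] loc_int_unit_or_multiple[OF assms(3)]
      loc_int_unit_or_multiple[OF assms(4)] by argo+
  then obtain r' s' t' where
    *: "r' \<in> loc_int p" "s' \<in> loc_int p" "t' \<in> loc_int p" "r = of_int p * r'" "s = of_int p * s'" "t = of_int p * t'"
    by blast
  then have "r' + s' + t' \<in> loc_int p" using p by (intro loc_int_add)
  then obtain a b where ab: "r' + s' + t' = of_int a / of_int b" "\<not> p dvd b" "b \<noteq> 0" by (rule loc_intE)
  have "of_int p * (r' + s' + t') = 1" using * sum by (simp add: algebra_simps)
  then have "of_int p * (of_int a / of_int b :: rat) = 1" by (simp only: ab(1))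
  then have "of_int (p * a) = (of_int b :: rat)" using ab(3) by (simp add: field_simps)
  then have "p * a = b" by (simp only: of_int_eq_iff)
  then show False using ab(2) by auto
qed

lemma rat_fraction:
  fixes t :: rat
  obtains a b where "t = of_int a / of_int b" "coprime a b" "b > 0"
proof -
  obtain a b where "quotient_of t = (a, b)" by fastforce
  then show ?thesis
    using quotient_of_div[of t a b] quotient_of_coprime[of t a b] quotient_of_denom_pos[of t a b]
    by (intro that[of a b]) auto
qed

text \<open>The valuation ring property: \<open>p\<close> cannot divide both parts of a reduced
  fraction.\<close>

lemma loc_int_total:
  assumes p: "prime p"
  shows "t \<in> loc_int p \<or> t \<noteq> 0 \<and> 1 / t \<in> loc_int p"
proof -
  obtain a b where ab: "t = of_int a / of_int b" "coprime a b" "b > 0"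
    by (rule rat_fraction)
  show ?thesis
  proof (cases "p dvd b")
    case False
    then show ?thesis using ab loc_intI[of p b a] by simp
  next
    case True
    then have "\<not> p dvd a" using ab(2) p by (meson coprime_def not_prime_unit)
    then have "a \<noteq> 0" "of_int b / of_int a \<in> loc_int p" by (auto intro: loc_intI)
    then show ?thesis using ab by simp
  qed
qed

text \<open>A prime factor of the reduced denominator would contradict membership at that prime.
  This is the passage from the local statements to integrality of \<open>Q\<close>.\<close>

lemma Ints_if_all_loc_int:
  assumes "\<And>p. prime p \<Longrightarrow> t \<in> loc_int p"
  shows "t \<in> \<int>"
proof -
  obtain a b where ab: "t = of_int a / of_int b" "coprime a b" "b > 0"
    by (rule rat_fraction)
  have "b = 1"
  proof (rule ccontr)
    assume "b \<noteq> 1"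
    then obtain p where p: "prime p" "p dvd b"
      using ab(3) prime_divisor_exists[of b] by auto
    obtain c d where cd: "t = of_int c / of_int d" "\<not> p dvd d" "d \<noteq> 0"
      using assms[OF p(1)] by (rule loc_intE)
    have "of_int (a * d) = (of_int (c * b) :: rat)" using ab cd by (simp add: field_simps)
    then have "a * d = c * b" by (simp only: of_int_eq_iff)
    then have "p dvd a * d" using p(2) by simp
    then have "p dvd a" using p cd by (simp add: prime_dvd_mult_iff)
    then show False using ab(2) p by (meson coprime_def not_prime_unit)
  qed
  then show ?thesis using ab by simp
qed

section \<open>Self-dual lattices and the comparison of two of them\<close>

definition self_dual :: "int \<Rightarrow> nat \<Rightarrow> rat vec set \<Rightarrow> bool" where
  "self_dual p n X \<longleftrightarrow> X = {x \<in> carrier_vec n. \<forall>y\<in>X. x \<bullet> y \<in> loc_int p}"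

definition loc_lattice :: "int \<Rightarrow> nat \<Rightarrow> rat vec set" where
  "loc_lattice p n = {x \<in> carrier_vec n. \<forall>i<n. x $ i \<in> loc_int p}"

lemma self_dual_carrier: "self_dual p n X \<Longrightarrow> x \<in> X \<Longrightarrow> x \<in> carrier_vec n"
  unfolding self_dual_def by blast

lemma self_dual_scalar_prod: "self_dual p n X \<Longrightarrow> x \<in> X \<Longrightarrow> y \<in> X \<Longrightarrow> x \<bullet> y \<in> loc_int p"
  unfolding self_dual_def by blast

lemma self_dual_memI:
  "self_dual p n X \<Longrightarrow> x \<in> carrier_vec n \<Longrightarrow> (\<And>y. y \<in> X \<Longrightarrow> x \<bullet> y \<in> loc_int p) \<Longrightarrow> x \<in> X"
  unfolding self_dual_def by blast

text \<open>The definition of \<open>self_dual\<close> lists no closure conditions; a set equal to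
  its own dual is a module over the localization because the scalar product is bilinear.\<close>

lemma self_dual_add:
  assumes "prime p" "self_dual p n X" "x \<in> X" "y \<in> X"
  shows "x + y \<in> X"
proof (rule self_dual_memI[OF assms(2)])
  note c = self_dual_carrier[OF assms(2)]
  show "x + y \<in> carrier_vec n" using c assms(3,4) by simp
  show "(x + y) \<bullet> z \<in> loc_int p" if "z \<in> X" for z
    using add_scalar_prod_distrib[OF c[OF assms(3)] c[OF assms(4)] c[OF that]]
      self_dual_scalar_prod[OF assms(2)] that assms by (simp add: loc_int_add)
qed

lemma self_dual_smult:
  assumes "prime p" "self_dual p n X" "c \<in> loc_int p" "x \<in> X"
  shows "c \<cdot>\<^sub>v x \<in> X"
proof (rule self_dual_memI[OF assms(2)])
  note car = self_dual_carrier[OF assms(2)]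
  show "c \<cdot>\<^sub>v x \<in> carrier_vec n" using car assms(4) by simp
  show "(c \<cdot>\<^sub>v x) \<bullet> z \<in> loc_int p" if "z \<in> X" for z
    using car[OF assms(4)] car[OF that] self_dual_scalar_prod[OF assms(2)] that assms
    by (simp add: loc_int_mult)
qed

lemma self_dual_diff:
  assumes p: "prime p" and X: "self_dual p n X" "x \<in> X" "y \<in> X"
  shows "x - y \<in> X"
proof -
  have "x + (-1) \<cdot>\<^sub>v y \<in> X"
    using self_dual_add[OF p X(1,2)] self_dual_smult[OF p X(1) _ X(3)] loc_int_of_int[OF p, of "-1"] by simp
  moreover have "x + (-1) \<cdot>\<^sub>v y = x - y"
    using self_dual_carrier[OF X(1)] X(2,3) by (intro eq_vecI) auto
  ultimately show ?thesis by simp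
qed

lemma self_dual_zero:
  assumes p: "prime p" and X: "self_dual p n X"
  shows "0\<^sub>v n \<in> X"
proof (rule self_dual_memI[OF X])
  show "0\<^sub>v n \<bullet> y \<in> loc_int p" if "y \<in> X" for y
    using self_dual_carrier[OF X that] loc_int_0[OF p] by simp
qed simp

text \<open>Taking duals reverses inclusions.\<close>

lemma self_dual_subset_eq:
  assumes "self_dual p n X" "self_dual p n Y" "X \<subseteq> Y"
  shows "X = Y"
  using assms unfolding self_dual_def by blast

text \<open>If some \<open>z0\<close> of \<open>Z\<close> lies in \<open>Y\<close> but not in
  \<open>X\<close>, then every \<open>z = t z0\<close> in \<open>Z\<close> and \<open>X\<close> has
  \<open>t\<close> in the valuation ring, as otherwise \<open>1 / t\<close> would be in it and
  \<open>z0\<close> would be in \<open>X\<close>. Hence one of \<open>X\<close> and \<open>Y\<close>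
  contains the other, and self-duality gives equality.\<close>

lemma self_dual_eq_if_common_line:
  assumes p: "prime p" and X: "self_dual p n X" and Y: "self_dual p n Y"
    and M: "M \<subseteq> X" "M \<subseteq> Y"
    and line: "\<And>z0 z. z0 \<in> Z \<Longrightarrow> z \<in> Z \<Longrightarrow> z0 \<noteq> 0\<^sub>v n \<Longrightarrow> \<exists>t. z = t \<cdot>\<^sub>v z0"
    and decX: "\<And>x. x \<in> X \<Longrightarrow> \<exists>m\<in>M. \<exists>z\<in>Z \<inter> X. x = m + z"
    and decY: "\<And>y. y \<in> Y \<Longrightarrow> \<exists>m\<in>M. \<exists>z\<in>Z \<inter> Y. y = m + z"
  shows "X = Y"
proof (cases "Z \<inter> Y \<subseteq> X")
  case True
  have "Y \<subseteq> X"
  proof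
    fix y assume "y \<in> Y"
    then obtain m z where "m \<in> M" "z \<in> Z \<inter> Y" "y = m + z" using decY by blast
    then show "y \<in> X" using self_dual_add[OF p X] M True by blast
  qed
  then show ?thesis using self_dual_subset_eq[OF Y X] by simp
next
  case False
  then obtain z0 where z0: "z0 \<in> Z" "z0 \<in> Y" "z0 \<notin> X" by blast
  then have nz: "z0 \<noteq> 0\<^sub>v n" using self_dual_zero[OF p X] by auto
  have "X \<subseteq> Y"
  proof
    fix x assume "x \<in> X"
    then obtain m z where x: "m \<in> M" "z \<in> Z" "z \<in> X" "x = m + z" using decX by blast
    then obtain t where t: "z = t \<cdot>\<^sub>v z0" using line[OF z0(1) _ nz] by blast
    have "t \<in> loc_int p"
    proof (rule ccontr)
      assume "t \<notin> loc_int p"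
      then have "t \<noteq> 0" "1 / t \<in> loc_int p" using loc_int_total[OF p, of t] by auto
      moreover have "(1 / t) \<cdot>\<^sub>v z = z0"
        using \<open>t \<noteq> 0\<close> unfolding t by (intro eq_vecI) auto
      ultimately show False using self_dual_smult[OF p X _ x(3)] z0(3) by metis
    qed
    then have "z \<in> Y" unfolding t using self_dual_smult[OF p Y _ z0(2)] by blast
    then show "x \<in> Y" using x M self_dual_add[OF p Y] by blast
  qed
  then show ?thesis using self_dual_subset_eq[OF X Y] by simp
qed

text \<open>Pairing with unit vectors reads off coordinates.\<close>

lemma loc_lattice_self_dual:
  assumes p: "prime p"
  shows "self_dual p n (loc_lattice p n)"
proof -
  have "x \<bullet> y \<in> loc_int p" if "x \<in> loc_lattice p n" "y \<in> loc_lattice p n" for x y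
    using that p by (auto simp: loc_lattice_def scalar_prod_def intro!: loc_int_sum loc_int_mult)
  moreover have "x \<in> loc_lattice p n"
    if x: "x \<in> carrier_vec n" and y: "\<forall>y\<in>loc_lattice p n. x \<bullet> y \<in> loc_int p" for x
  proof -
    have "x $ i \<in> loc_int p" if "i < n" for i
    proof -
      have "unit_vec n i \<in> loc_lattice p n"
        using loc_int_of_int[OF p, of 0] loc_int_of_int[OF p, of 1] by (auto simp: loc_lattice_def unit_vec_def)
      then show ?thesis using y that x by (metis scalar_prod_right_unit)
    qed
    then show ?thesis using x by (simp add: loc_lattice_def)
  qed
  moreover have "x \<in> carrier_vec n" if "x \<in> loc_lattice p n" for x
    using that by (simp add: loc_lattice_def)
  ultimately show ?thesis unfolding self_dual_def by blast
qed

lemma loc_lattice_mult_mat: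
  assumes p: "prime p" and A: "A \<in> carrier_mat n n" and ent: "\<And>i j. i < n \<Longrightarrow> j < n \<Longrightarrow> A $$ (i, j) \<in> loc_int p"
    and x: "x \<in> loc_lattice p n"
  shows "A *\<^sub>v x \<in> loc_lattice p n"
  using A ent x unfolding loc_lattice_def
  by (auto simp: scalar_prod_def intro!: loc_int_sum loc_int_mult p)

lemma self_dual_orthogonal_image:
  fixes Q :: "rat mat"
  assumes X: "self_dual p n X" and Q: "Q \<in> carrier_mat n n" and QQ: "Q\<^sup>T * Q = 1\<^sub>m n" "Q * Q\<^sup>T = 1\<^sub>m n"
  shows "self_dual p n ((*\<^sub>v) Q ` X)"
proof -
  note car = self_dual_carrier[OF X]
  have QT: "Q\<^sup>T \<in> carrier_mat n n" using Q by simp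
  have iso: "(Q *\<^sub>v x) \<bullet> (Q *\<^sub>v y) = x \<bullet> y" if "x \<in> carrier_vec n" "y \<in> carrier_vec n" for x y
  proof -
    have "(Q\<^sup>T *\<^sub>v (Q *\<^sub>v x)) \<bullet> y = (Q *\<^sub>v x) \<bullet> (Q *\<^sub>v y)"
      using transpose_vec_mult_scalar[OF Q that(2), of "Q *\<^sub>v x"] Q that by simp
    moreover have "Q\<^sup>T *\<^sub>v (Q *\<^sub>v x) = x"
      using assoc_mult_mat_vec[OF QT Q that(1)] QQ(1) that(1) by simp
    ultimately show ?thesis by simp
  qed
  have inv: "Q *\<^sub>v (Q\<^sup>T *\<^sub>v x) = x" if "x \<in> carrier_vec n" for x
    using assoc_mult_mat_vec[OF Q QT that] QQ(2) that by simp
  show ?thesis unfolding self_dual_def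
  proof (intro equalityI subsetI CollectI conjI ballI)
    fix x assume "x \<in> (*\<^sub>v) Q ` X"
    then obtain x' where x': "x' \<in> X" "x = Q *\<^sub>v x'" by blast
    then show "x \<in> carrier_vec n" using Q car by simp
    fix y assume "y \<in> (*\<^sub>v) Q ` X"
    then obtain y' where y': "y' \<in> X" "y = Q *\<^sub>v y'" by blast
    then show "x \<bullet> y \<in> loc_int p" using x' iso car self_dual_scalar_prod[OF X] by simp
  next
    fix x assume "x \<in> {x \<in> carrier_vec n. \<forall>y\<in>(*\<^sub>v) Q ` X. x \<bullet> y \<in> loc_int p}"
    then have x: "x \<in> carrier_vec n" and xy: "\<And>y. y \<in> X \<Longrightarrow> x \<bullet> (Q *\<^sub>v y) \<in> loc_int p" by auto
    have "Q\<^sup>T *\<^sub>v x \<in> X"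
    proof (rule self_dual_memI[OF X])
      show "Q\<^sup>T *\<^sub>v x \<in> carrier_vec n" using QT x by simp
      show "(Q\<^sup>T *\<^sub>v x) \<bullet> y \<in> loc_int p" if "y \<in> X" for y
        using xy[OF that] transpose_vec_mult_scalar[OF Q car[OF that] x] by simp
    qed
    then show "x \<in> (*\<^sub>v) Q ` X" using inv[OF x] by (metis imageI)
  qed
qed

section \<open>Odd primes\<close>

text \<open>Read \<open>W c\<close> as \<open>f(S) e\<close> for the polynomial \<open>f\<close>
  with coefficients \<open>c\<close>, and split \<open>f\<close> into its constant term and
  \<open>x\<close> times the rest. The shifted coefficient vector is padded with a final 0.\<close>

lemma krylov_mat_shift:
  fixes c :: "'a :: comm_ring_1 vec"
  assumes S: "S \<in> carrier_mat n n" and c: "c \<in> carrier_vec n" and n: "n > 0"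
  shows "krylov_mat S *\<^sub>v c = c $ 0 \<cdot>\<^sub>v ones n +
    S *\<^sub>v (krylov_mat S *\<^sub>v vec n (\<lambda>k. if Suc k < n then c $ Suc k else 0))"
proof -
  let ?c = "vec n (\<lambda>k. if Suc k < n then c $ Suc k else 0)"
  obtain m where m: "n = Suc m" using n by (cases n) auto
  have "(S *\<^sub>v (krylov_mat S *\<^sub>v ?c)) $ i = (\<Sum>k<n. ?c $ k * walk_vec S (Suc k) $ i)" if "i < n" for i
    using mult_mat_vec_sum[OF S, of "walk_vec S" i "\<lambda>k. ?c $ k" n] that S
    by (simp add: krylov_mat_mult_vec[OF S] walk_vec_Suc[OF S])
  moreover have "(\<Sum>k<n. ?c $ k * walk_vec S (Suc k) $ i) = (\<Sum>k<m. c $ Suc k * walk_vec S (Suc k) $ i)" for i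
    by (simp add: m)
  moreover have "(krylov_mat S *\<^sub>v c) $ i = c $ 0 + (\<Sum>k<m. c $ Suc k * walk_vec S (Suc k) $ i)" if "i < n" for i
    using that S unfolding krylov_mat_mult_vec[OF S c] m
    by (simp add: sum.lessThan_Suc_shift del: sum.lessThan_Suc)
  ultimately show ?thesis using S
    by (intro eq_vecI) (auto simp del: index_mult_mat_vec)
qed

lemma smult_diff_zero:
  fixes z z0 :: "rat vec"
  assumes "z \<in> carrier_vec n" "z0 \<in> carrier_vec n" "z - t \<cdot>\<^sub>v z0 = 0\<^sub>v n"
  shows "z = t \<cdot>\<^sub>v z0"
proof (rule eq_vecI)
  fix i assume "i < dim_vec (t \<cdot>\<^sub>v z0)"
  then have "i < n" using assms(2) by simp
  then show "z $ i = (t \<cdot>\<^sub>v z0) $ i"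
    using arg_cong[OF assms(3), of "\<lambda>v. v $ i"] assms(1,2) by simp
qed (use assms in simp)

text \<open>\<open>P\<close> will be the permutation matrix of an isomorphism onto the converse
  graph, and \<open>V\<close> is the inverse walk matrix. That \<open>P\<close> is an involution is
  derived below from its action on the walk vectors.\<close>

locale anti_involution =
  fixes n :: nat and p :: int and S P V :: "rat mat"
  assumes n: "n > 0" and p: "prime p" "odd p"
    and S: "S \<in> carrier_mat n n" and skew: "S\<^sup>T = - S"
    and S_loc: "\<And>i j. i < n \<Longrightarrow> j < n \<Longrightarrow> S $$ (i, j) \<in> loc_int p"
    and P: "P \<in> carrier_mat n n" and P_orth: "P\<^sup>T * P = 1\<^sub>m n"
    and P_loc: "\<And>i j. i < n \<Longrightarrow> j < n \<Longrightarrow> P $$ (i, j) \<in> loc_int p"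
    and P_ones: "P *\<^sub>v ones n = ones n" and P_anti: "P * S = - (S * P)"
    and V: "V \<in> carrier_mat n n" "krylov_mat S * V = 1\<^sub>m n" "V * krylov_mat S = 1\<^sub>m n"
begin

abbreviation "W \<equiv> krylov_mat S"
abbreviation "R \<equiv> loc_int p"
abbreviation "L \<equiv> loc_lattice p n"

text \<open>The lattice spanned by the walk vectors. The maps \<open>pos\<close> and
  \<open>neg\<close> defined next are the projections onto the eigenspaces of \<open>P\<close> for 1
  and -1.\<close>

definition "M = (*\<^sub>v) W ` L"
definition "pos x = (1 / 2) \<cdot>\<^sub>v (x + P *\<^sub>v x)"
definition "neg x = (1 / 2) \<cdot>\<^sub>v (x - P *\<^sub>v x)"

lemma W: "W \<in> carrier_mat n n" using S by simp

text \<open>Here oddness of \<open>p\<close> enters: 2 is a unit, so the eigenprojections preserve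
  self-dual lattices that are stable under \<open>P\<close>.\<close>

lemma half_loc: "1 / 2 \<in> R"
proof -
  have "\<not> p dvd 2"
    using p primes_dvd_imp_eq[of p 2] by (auto simp: two_is_prime_nat)
  then show ?thesis using loc_intI[of p 2 1] by simp
qed

lemma L_self_dual: "self_dual p n L" using p by (intro loc_lattice_self_dual)

lemma W_loc: "i < n \<Longrightarrow> k < n \<Longrightarrow> W $$ (i, k) \<in> R"
proof -
  have "walk_vec S k \<in> L" for k
  proof (induction k)
    case 0
    show ?case using S loc_int_of_int[OF p(1), of 1] by (simp add: loc_lattice_def)
  next
    case (Suc k)
    then show ?case unfolding walk_vec_Suc[OF S] using S S_loc p by (intro loc_lattice_mult_mat)
  qed
  then show "i < n \<Longrightarrow> k < n \<Longrightarrow> W $$ (i, k) \<in> R"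
    using S by (simp add: krylov_mat_def loc_lattice_def)
qed

lemma M_subset_L: "M \<subseteq> L"
  unfolding M_def using loc_lattice_mult_mat[OF p(1) W W_loc] by blast

lemma L_carrier: "x \<in> L \<Longrightarrow> x \<in> carrier_vec n" by (simp add: loc_lattice_def)
lemma M_carrier: "x \<in> M \<Longrightarrow> x \<in> carrier_vec n" using M_subset_L L_carrier by blast

lemma M_add: "x \<in> M \<Longrightarrow> y \<in> M \<Longrightarrow> x + y \<in> M"
proof -
  assume "x \<in> M" "y \<in> M"
  then obtain a b where ab: "a \<in> L" "b \<in> L" "x = W *\<^sub>v a" "y = W *\<^sub>v b" unfolding M_def by blast
  then have "x + y = W *\<^sub>v (a + b)" using mult_add_distrib_mat_vec[OF W, of a b] L_carrier by simp
  then show "x + y \<in> M" unfolding M_def using self_dual_add[OF p(1) L_self_dual ab(1,2)] by simp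
qed

lemma M_smult: "c \<in> R \<Longrightarrow> x \<in> M \<Longrightarrow> c \<cdot>\<^sub>v x \<in> M"
proof -
  assume "c \<in> R" "x \<in> M"
  then obtain a where a: "a \<in> L" "x = W *\<^sub>v a" unfolding M_def by blast
  then have "c \<cdot>\<^sub>v x = W *\<^sub>v (c \<cdot>\<^sub>v a)" using mult_mat_smult_vec[OF W, of a c] L_carrier by simp
  then show "c \<cdot>\<^sub>v x \<in> M"
    unfolding M_def using self_dual_smult[OF p(1) L_self_dual \<open>c \<in> R\<close> a(1)] by simp
qed

text \<open>\<open>P\<close> fixes \<open>e\<close> and anticommutes with \<open>S\<close>, so each
  factor \<open>S\<close> contributes a sign.\<close>

lemma P_walk_vec: "P *\<^sub>v walk_vec S k = (-1) ^ k \<cdot>\<^sub>v walk_vec S k"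
proof (induction k)
  case 0
  show ?case using S P_ones by simp
next
  case (Suc k)
  have w: "walk_vec S k \<in> carrier_vec n" using S by simp
  have "P *\<^sub>v walk_vec S (Suc k) = (P * S) *\<^sub>v walk_vec S k"
    unfolding walk_vec_Suc[OF S] using assoc_mult_mat_vec[OF P S w] by simp
  also have "\<dots> = - ((S * P) *\<^sub>v walk_vec S k)"
    unfolding P_anti using P S w by (intro uminus_mult_mat_vec) simp
  also have "(S * P) *\<^sub>v walk_vec S k = S *\<^sub>v ((-1) ^ k \<cdot>\<^sub>v walk_vec S k)"
    using assoc_mult_mat_vec[OF S P w] Suc by simp
  also have "\<dots> = (-1) ^ k \<cdot>\<^sub>v walk_vec S (Suc k)"
    unfolding walk_vec_Suc[OF S] by (rule mult_mat_smult_vec[OF S w])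
  also have "- \<dots> = (-1) ^ Suc k \<cdot>\<^sub>v walk_vec S (Suc k)" by (intro eq_vecI) auto
  finally show ?case .
qed

lemma P_W: "c \<in> carrier_vec n \<Longrightarrow> P *\<^sub>v (W *\<^sub>v c) = W *\<^sub>v vec n (\<lambda>k. (-1) ^ k * c $ k)"
proof -
  assume c: "c \<in> carrier_vec n"
  have "(P *\<^sub>v (W *\<^sub>v c)) $ i = (W *\<^sub>v vec n (\<lambda>k. (-1) ^ k * c $ k)) $ i" if i: "i < n" for i
  proof -
    have "(P *\<^sub>v (W *\<^sub>v c)) $ i = (\<Sum>k<n. c $ k * (P *\<^sub>v walk_vec S k) $ i)"
      unfolding krylov_mat_mult_vec[OF S c] using S by (intro mult_mat_vec_sum[OF P _ i]) simp
    also have "\<dots> = (\<Sum>k<n. ((-1) ^ k * c $ k) * walk_vec S k $ i)"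
      using i S by (simp only: P_walk_vec) (simp add: mult_ac)
    also have "\<dots> = (W *\<^sub>v vec n (\<lambda>k. (-1) ^ k * c $ k)) $ i"
      using i by (subst krylov_mat_mult_vec[OF S]) auto
    finally show ?thesis .
  qed
  then show ?thesis using P W S by (intro eq_vecI) (auto simp del: index_mult_mat_vec)
qed

text \<open>On the basis of walk vectors \<open>P\<close> acts by signs, so its square is the
  identity.\<close>

lemma P_P: "x \<in> carrier_vec n \<Longrightarrow> P *\<^sub>v (P *\<^sub>v x) = x"
proof -
  assume x: "x \<in> carrier_vec n"
  define c where "c = V *\<^sub>v x"
  have c: "c \<in> carrier_vec n" using V x by (simp add: c_def)
  have xc: "x = W *\<^sub>v c" using assoc_mult_mat_vec[OF W V(1) x] V(2) x by (simp add: c_def)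
  have "P *\<^sub>v (P *\<^sub>v x) = W *\<^sub>v vec n (\<lambda>k. (-1) ^ k * ((-1) ^ k * c $ k))"
    unfolding xc P_W[OF c] by (subst P_W) (auto intro!: arg_cong[of _ _ "\<lambda>v. W *\<^sub>v v"])
  also have "vec n (\<lambda>k. (-1) ^ k * ((-1) ^ k * c $ k)) = c"
    using c by (intro eq_vecI) (auto simp: mult.assoc[symmetric] power_mult_distrib[symmetric])
  finally show ?thesis using xc by simp
qed

text \<open>An orthogonal involution equals its transpose.\<close>

lemma P_sym: "x \<in> carrier_vec n \<Longrightarrow> y \<in> carrier_vec n \<Longrightarrow> x \<bullet> (P *\<^sub>v y) = (P *\<^sub>v x) \<bullet> y"
proof -
  assume x: "x \<in> carrier_vec n" and y: "y \<in> carrier_vec n"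
  have PT: "P\<^sup>T \<in> carrier_mat n n" using P by simp
  have Px: "P *\<^sub>v x \<in> carrier_vec n" using P x by simp
  have "P\<^sup>T *\<^sub>v x = P\<^sup>T *\<^sub>v (P *\<^sub>v (P *\<^sub>v x))" using P_P[OF x] by simp
  also have "\<dots> = P *\<^sub>v x" using assoc_mult_mat_vec[OF PT P Px] P_orth Px by simp
  finally show ?thesis using transpose_vec_mult_scalar[OF P y x] by simp
qed

section \<open>Projections onto the two eigenspaces of \<open>P\<close>\<close>

lemma pos_carrier: "x \<in> carrier_vec n \<Longrightarrow> pos x \<in> carrier_vec n"
  and neg_carrier: "x \<in> carrier_vec n \<Longrightarrow> neg x \<in> carrier_vec n"
  using P by (auto simp: pos_def neg_def)

lemma P_carrier: "x \<in> carrier_vec n \<Longrightarrow> P *\<^sub>v x \<in> carrier_vec n" using P by simp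
lemma S_carrier: "x \<in> carrier_vec n \<Longrightarrow> S *\<^sub>v x \<in> carrier_vec n" using S by simp

lemma pos_index: "x \<in> carrier_vec n \<Longrightarrow> i < n \<Longrightarrow> pos x $ i = (x $ i + (P *\<^sub>v x) $ i) / 2"
  and neg_index: "x \<in> carrier_vec n \<Longrightarrow> i < n \<Longrightarrow> neg x $ i = (x $ i - (P *\<^sub>v x) $ i) / 2"
  using P by (auto simp: pos_def neg_def)

lemma P_lin:
  assumes "x \<in> carrier_vec n" "y \<in> carrier_vec n"
  shows "P *\<^sub>v (x + y) = P *\<^sub>v x + P *\<^sub>v y" "P *\<^sub>v (x - y) = P *\<^sub>v x - P *\<^sub>v y"
    "P *\<^sub>v (c \<cdot>\<^sub>v x) = c \<cdot>\<^sub>v (P *\<^sub>v x)"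
  using mult_add_distrib_mat_vec[OF P assms] mult_minus_distrib_mat_vec[OF P assms]
    mult_mat_smult_vec[OF P assms(1)] by auto

lemma S_lin:
  assumes "x \<in> carrier_vec n" "y \<in> carrier_vec n"
  shows "S *\<^sub>v (x + y) = S *\<^sub>v x + S *\<^sub>v y" "S *\<^sub>v (x - y) = S *\<^sub>v x - S *\<^sub>v y"
    "S *\<^sub>v (c \<cdot>\<^sub>v x) = c \<cdot>\<^sub>v (S *\<^sub>v x)"
  using mult_add_distrib_mat_vec[OF S assms] mult_minus_distrib_mat_vec[OF S assms]
    mult_mat_smult_vec[OF S assms(1)] by auto

lemma P_S: "x \<in> carrier_vec n \<Longrightarrow> P *\<^sub>v (S *\<^sub>v x) = - (S *\<^sub>v (P *\<^sub>v x))"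
  using assoc_mult_mat_vec[OF P S, of x] assoc_mult_mat_vec[OF S P, of x] P S unfolding P_anti by simp

lemma P_pos: "x \<in> carrier_vec n \<Longrightarrow> P *\<^sub>v pos x = pos x"
proof -
  assume x: "x \<in> carrier_vec n"
  have "P *\<^sub>v pos x = (1 / 2) \<cdot>\<^sub>v (P *\<^sub>v x + x)"
    unfolding pos_def using x P_carrier[OF x] by (simp add: P_lin P_P)
  also have "P *\<^sub>v x + x = x + P *\<^sub>v x" using x P_carrier[OF x] by (intro comm_add_vec)
  finally show ?thesis by (simp add: pos_def)
qed

lemma P_neg: "x \<in> carrier_vec n \<Longrightarrow> P *\<^sub>v neg x = - neg x"
proof -
  assume x: "x \<in> carrier_vec n"
  have "P *\<^sub>v neg x = (1 / 2) \<cdot>\<^sub>v (P *\<^sub>v x - x)"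
    unfolding neg_def using x P_carrier[OF x] by (simp add: P_lin P_P)
  also have "\<dots> = - neg x"
    unfolding neg_def using x P by (intro eq_vecI) (auto simp: diff_divide_distrib simp del: index_mult_mat_vec)
  finally show ?thesis .
qed

lemma pos_add_neg: "x \<in> carrier_vec n \<Longrightarrow> x = pos x + neg x"
proof (rule eq_vecI)
  assume x: "x \<in> carrier_vec n"
  show "dim_vec x = dim_vec (pos x + neg x)" using x neg_carrier[OF x] by simp
  fix i assume "i < dim_vec (pos x + neg x)"
  then have i: "i < n" using neg_carrier[OF x] by simp
  then show "x $ i = (pos x + neg x) $ i"
    using neg_carrier[OF x] pos_index[OF x i] neg_index[OF x i] by (simp add: field_simps del: index_mult_mat_vec)
qed

lemma pos_eq_diff: "x \<in> carrier_vec n \<Longrightarrow> pos x = x - neg x"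
proof (rule eq_vecI)
  assume x: "x \<in> carrier_vec n"
  show "dim_vec (pos x) = dim_vec (x - neg x)" using pos_carrier[OF x] neg_carrier[OF x] by simp
  fix i assume "i < dim_vec (x - neg x)"
  then have i: "i < n" using neg_carrier[OF x] by simp
  then show "pos x $ i = (x - neg x) $ i"
    using neg_carrier[OF x] pos_index[OF x i] neg_index[OF x i] by (simp add: field_simps del: index_mult_mat_vec)
qed

lemma neg_eq_diff: "x \<in> carrier_vec n \<Longrightarrow> neg x = x - pos x"
proof (rule eq_vecI)
  assume x: "x \<in> carrier_vec n"
  show "dim_vec (neg x) = dim_vec (x - pos x)" using pos_carrier[OF x] neg_carrier[OF x] by simp
  fix i assume "i < dim_vec (x - pos x)"
  then have i: "i < n" using pos_carrier[OF x] by simp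
  then show "neg x $ i = (x - pos x) $ i"
    using pos_carrier[OF x] pos_index[OF x i] neg_index[OF x i] by (simp add: field_simps del: index_mult_mat_vec)
qed

lemma pos_eq_self: "x \<in> carrier_vec n \<Longrightarrow> P *\<^sub>v x = x \<Longrightarrow> pos x = x"
  by (intro eq_vecI) (auto simp: pos_def)

lemma neg_eq_self: "x \<in> carrier_vec n \<Longrightarrow> P *\<^sub>v x = - x \<Longrightarrow> neg x = x"
  by (intro eq_vecI) (auto simp: neg_def)

lemma pos_lin:
  assumes x: "x \<in> carrier_vec n" and y: "y \<in> carrier_vec n"
  shows "pos (x + y) = pos x + pos y" "pos (c \<cdot>\<^sub>v x) = c \<cdot>\<^sub>v pos x"
  using x y P_carrier[OF x] P_carrier[OF y] P
  by (auto simp: pos_def P_lin[OF x y] intro!: eq_vecI simp del: index_mult_mat_vec)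
    (simp_all del: index_mult_mat_vec add: field_simps)

lemma neg_lin:
  assumes x: "x \<in> carrier_vec n" and y: "y \<in> carrier_vec n"
  shows "neg (x + y) = neg x + neg y" "neg (c \<cdot>\<^sub>v x) = c \<cdot>\<^sub>v neg x"
  using x y P_carrier[OF x] P_carrier[OF y] P
  by (auto simp: neg_def P_lin[OF x y] intro!: eq_vecI simp del: index_mult_mat_vec)
    (simp_all del: index_mult_mat_vec add: field_simps)

text \<open>Anticommutation makes \<open>S\<close> exchange the two eigenspaces.\<close>

lemma pos_S: "x \<in> carrier_vec n \<Longrightarrow> pos (S *\<^sub>v x) = S *\<^sub>v neg x"
  using P S P_carrier[of x] S_carrier[of x] S_carrier[of "P *\<^sub>v x"] unfolding pos_def neg_def
  by (auto simp: S_lin P_S intro!: eq_vecI simp del: index_mult_mat_vec)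

lemma neg_S: "x \<in> carrier_vec n \<Longrightarrow> neg (S *\<^sub>v x) = S *\<^sub>v pos x"
  using P S P_carrier[of x] S_carrier[of x] S_carrier[of "P *\<^sub>v x"] unfolding pos_def neg_def
  by (auto simp: S_lin P_S intro!: eq_vecI simp del: index_mult_mat_vec)

lemma pos_ones: "pos (ones n) = ones n"
  by (rule pos_eq_self) (auto simp: P_ones)

lemma pos_sym: "x \<in> carrier_vec n \<Longrightarrow> y \<in> carrier_vec n \<Longrightarrow> pos x \<bullet> y = x \<bullet> pos y"
proof -
  assume x: "x \<in> carrier_vec n" and y: "y \<in> carrier_vec n"
  have "pos x \<bullet> y = (1 / 2) * ((x + P *\<^sub>v x) \<bullet> y)"
    unfolding pos_def using x y P_carrier[OF x] by (intro smult_scalar_prod_distrib[of _ n]) auto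
  also have "(x + P *\<^sub>v x) \<bullet> y = x \<bullet> (y + P *\<^sub>v y)"
    using x y P_carrier[OF x] P_carrier[OF y] P_sym[OF x y]
    by (simp add: add_scalar_prod_distrib[of _ n] scalar_prod_add_distrib[of _ n])
  also have "(1 / 2) * (x \<bullet> (y + P *\<^sub>v y)) = x \<bullet> pos y"
    unfolding pos_def using x y P_carrier[OF y] by (intro scalar_prod_smult_distrib[of _ n, symmetric]) auto
  finally show ?thesis .
qed

lemma neg_sym: "x \<in> carrier_vec n \<Longrightarrow> y \<in> carrier_vec n \<Longrightarrow> neg x \<bullet> y = x \<bullet> neg y"
proof -
  assume x: "x \<in> carrier_vec n" and y: "y \<in> carrier_vec n"
  have "neg x \<bullet> y = (1 / 2) * ((x - P *\<^sub>v x) \<bullet> y)"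
    unfolding neg_def using x y P_carrier[OF x] by (intro smult_scalar_prod_distrib[of _ n]) auto
  also have "(x - P *\<^sub>v x) \<bullet> y = x \<bullet> (y - P *\<^sub>v y)"
    using x y P_carrier[OF x] P_carrier[OF y] P_sym[OF x y]
    by (simp add: minus_scalar_prod_distrib[of _ n] scalar_prod_minus_distrib[of _ n])
  also have "(1 / 2) * (x \<bullet> (y - P *\<^sub>v y)) = x \<bullet> neg y"
    unfolding neg_def using x y P_carrier[OF y] by (intro scalar_prod_smult_distrib[of _ n, symmetric]) auto
  finally show ?thesis .
qed

lemma P_L: "x \<in> L \<Longrightarrow> P *\<^sub>v x \<in> L"
  by (rule loc_lattice_mult_mat[OF p(1) P P_loc])

lemma pos_L: "x \<in> L \<Longrightarrow> pos x \<in> L"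
  unfolding pos_def
  by (intro self_dual_smult[OF p(1) L_self_dual half_loc] self_dual_add[OF p(1) L_self_dual] P_L)

lemma neg_L: "x \<in> L \<Longrightarrow> neg x \<in> L"
  unfolding neg_def
  by (intro self_dual_smult[OF p(1) L_self_dual half_loc] self_dual_diff[OF p(1) L_self_dual] P_L)

text \<open>On \<open>f(S) e\<close> the projections keep the even and the odd powers of
  \<open>S\<close> respectively. A factor \<open>S\<close> can be taken out of everything but the
  constant term, and the odd part has no constant term.\<close>

lemma M_parts:
  assumes "m \<in> M"
  shows "pos m \<in> M" "neg m \<in> M" "\<exists>a. \<exists>m'\<in>M. m = a \<cdot>\<^sub>v ones n + S *\<^sub>v m'" "\<exists>m'\<in>M. neg m = S *\<^sub>v m'"
proof -
  obtain c where c: "c \<in> L" "m = W *\<^sub>v c" using assms unfolding M_def by blast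
  have cc: "c \<in> carrier_vec n" using c L_carrier by blast
  let ?c' = "vec n (\<lambda>k. (-1) ^ k * c $ k)"
  have m_car: "m \<in> carrier_vec n" using M_carrier assms .
  have part: "W *\<^sub>v vec n (\<lambda>k. if Q k then c $ k else 0) \<in> M" for Q
    unfolding M_def using c(1) loc_int_0[OF p(1)] by (intro imageI) (auto simp: loc_lattice_def)
  have Pm: "P *\<^sub>v m = W *\<^sub>v ?c'" using P_W[OF cc] c by simp
  have "pos m = (1 / 2) \<cdot>\<^sub>v (m + W *\<^sub>v ?c')" by (simp add: pos_def Pm)
  also have "\<dots> = W *\<^sub>v ((1 / 2) \<cdot>\<^sub>v (c + ?c'))"
    unfolding c(2)
    using mult_mat_smult_vec[OF W, of "c + ?c'"] mult_add_distrib_mat_vec[OF W cc, of ?c'] cc by simp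
  also have "(1 / 2) \<cdot>\<^sub>v (c + ?c') = vec n (\<lambda>k. if even k then c $ k else 0)"
    using cc by (intro eq_vecI) auto
  finally show "pos m \<in> M" using part[of even] by simp
  have "neg m = (1 / 2) \<cdot>\<^sub>v (m - W *\<^sub>v ?c')" by (simp add: neg_def Pm)
  also have "\<dots> = W *\<^sub>v ((1 / 2) \<cdot>\<^sub>v (c - ?c'))"
    unfolding c(2)
    using mult_mat_smult_vec[OF W, of "c - ?c'"] mult_minus_distrib_mat_vec[OF W cc, of ?c'] cc by simp
  also have "(1 / 2) \<cdot>\<^sub>v (c - ?c') = vec n (\<lambda>k. if odd k then c $ k else 0)"
    using cc by (intro eq_vecI) auto
  finally have negm: "neg m = W *\<^sub>v vec n (\<lambda>k. if odd k then c $ k else 0)" .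
  then show "neg m \<in> M" using part[of odd] by simp
  have shift: "W *\<^sub>v vec n (\<lambda>k. if Suc k < n then b $ Suc k else 0) \<in> M" if "b \<in> L" for b
    unfolding M_def using that loc_int_0[OF p(1)] by (intro imageI) (auto simp: loc_lattice_def)
  show "\<exists>a. \<exists>m'\<in>M. m = a \<cdot>\<^sub>v ones n + S *\<^sub>v m'"
    using krylov_mat_shift[OF S cc n] shift[OF c(1)] c(2) by blast
  define b where "b = vec n (\<lambda>k. if odd k then c $ k else 0)"
  have b: "b \<in> L" using c(1) loc_int_0[OF p(1)] by (auto simp: b_def loc_lattice_def)
  have "b $ 0 = 0" using n by (simp add: b_def)
  let ?m' = "W *\<^sub>v vec n (\<lambda>k. if Suc k < n then b $ Suc k else 0)"
  have "neg m = 0 \<cdot>\<^sub>v ones n + S *\<^sub>v ?m'"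
    using krylov_mat_shift[OF S L_carrier[OF b] n] negm \<open>b $ 0 = 0\<close> by (simp add: b_def[symmetric])
  also have "\<dots> = S *\<^sub>v ?m'" using S W by (intro eq_vecI) auto
  finally show "\<exists>m'\<in>M. neg m = S *\<^sub>v m'" using shift[OF b] by blast
qed

text \<open>Such a \<open>z\<close> is orthogonal to every walk vector by skewness, and the walk
  vectors span the space.\<close>

lemma kernel_orthogonal_ones_eq_zero:
  assumes z: "z \<in> carrier_vec n" and Sz: "S *\<^sub>v z = 0\<^sub>v n" and e: "ones n \<bullet> z = 0"
  shows "z = 0\<^sub>v n"
proof -
  have "walk_vec S k \<bullet> z = 0" for k
  proof (cases k)
    case 0
    then show ?thesis using S e by simp
  next
    case (Suc k)
    have w: "walk_vec S k \<in> carrier_vec n" using S by simp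
    have "walk_vec S (Suc k) \<bullet> z = - (walk_vec S k \<bullet> (S *\<^sub>v z))"
      unfolding walk_vec_Suc[OF S] using skew_scalar_prod[OF S skew w z] .
    then show ?thesis using Suc w Sz by simp
  qed
  then have WTz: "W\<^sup>T *\<^sub>v z = 0\<^sub>v n"
    using S by (intro eq_vecI) (auto simp: col_krylov_mat[OF S])
  have VT: "V\<^sup>T \<in> carrier_mat n n" and WT: "W\<^sup>T \<in> carrier_mat n n" using V W by auto
  have "V\<^sup>T * W\<^sup>T = 1\<^sub>m n" using transpose_mult[OF W V(1)] V(2) by simp
  then have "z = V\<^sup>T *\<^sub>v (W\<^sup>T *\<^sub>v z)" using assoc_mult_mat_vec[OF VT WT z] z by simp
  then show ?thesis unfolding WTz using VT by (auto intro!: eq_vecI)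
qed

text \<open>The first case: \<open>M\<close> contains the \<open>-1\<close> eigenlattice, and modulo \<open>M\<close> everything lies in the line
  \<open>ker S\<close>.\<close>

lemma eq_L_if_neg_M:
  assumes X: "self_dual p n X" and SX: "\<And>x. x \<in> X \<Longrightarrow> S *\<^sub>v x \<in> X" and MX: "M \<subseteq> X"
    and negM: "\<And>x. x \<in> L \<Longrightarrow> neg x \<in> M"
  shows "L = X"
proof (rule self_dual_eq_if_common_line[OF p(1) L_self_dual X M_subset_L MX])
  let ?Z = "{z \<in> carrier_vec n. S *\<^sub>v z = 0\<^sub>v n}"
  fix z0 z assume z0: "z0 \<in> ?Z" and z: "z \<in> ?Z" and nz: "z0 \<noteq> 0\<^sub>v n"
  \<comment> \<open>On the kernel of \<open>S\<close> the scalar product with \<open>e\<close> is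
    injective, so the ratio of two such products is the required factor.\<close>
  have e0: "ones n \<bullet> z0 \<noteq> 0" using kernel_orthogonal_ones_eq_zero z0 nz by blast
  define t where "t = (ones n \<bullet> z) / (ones n \<bullet> z0)"
  have "z - t \<cdot>\<^sub>v z0 = 0\<^sub>v n"
  proof (rule kernel_orthogonal_ones_eq_zero)
    show "z - t \<cdot>\<^sub>v z0 \<in> carrier_vec n" using z z0 by simp
    show "S *\<^sub>v (z - t \<cdot>\<^sub>v z0) = 0\<^sub>v n" using z z0 S_lin(2)[of z "t \<cdot>\<^sub>v z0"] S_lin(3)[of z0 z0 t] by auto
    show "ones n \<bullet> (z - t \<cdot>\<^sub>v z0) = 0"
      using z z0 e0 by (simp add: scalar_prod_minus_distrib[of _ n] t_def)
  qed
  then show "\<exists>t. z = t \<cdot>\<^sub>v z0" using smult_diff_zero z z0 by blast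
next
  let ?Z = "{z \<in> carrier_vec n. S *\<^sub>v z = 0\<^sub>v n}"
  have dec: "\<exists>m\<in>M. \<exists>z\<in>?Z \<inter> Y. y = m + z"
    if Y: "self_dual p n Y" and SY: "\<And>x. x \<in> Y \<Longrightarrow> S *\<^sub>v x \<in> Y" and MY: "M \<subseteq> Y" and y: "y \<in> Y" for Y y
  proof -
    note car = self_dual_carrier[OF Y]
    \<comment> \<open>Moving \<open>neg\<close> to the other factor shows that \<open>neg y\<close>
      pairs integrally with \<open>L\<close>, hence lies in \<open>L\<close>. Since
      \<open>neg\<close> is idempotent, \<open>negM\<close> then puts \<open>neg y\<close> into
      \<open>M\<close>.\<close>
    have neg_y: "neg y \<in> M" if y: "y \<in> Y" for y
    proof -
      have "neg y \<in> L"
      proof (rule self_dual_memI[OF L_self_dual])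
        show "neg y \<in> carrier_vec n" using neg_carrier car y by blast
        fix x assume x: "x \<in> L"
        have "neg y \<bullet> x = y \<bullet> neg x" using neg_sym car[OF y] L_carrier[OF x] by blast
        then show "neg y \<bullet> x \<in> R" using self_dual_scalar_prod[OF Y y] negM[OF x] MY by auto
      qed
      then have "neg (neg y) \<in> M" by (rule negM)
      then show ?thesis using neg_eq_self[OF neg_carrier P_neg] car[OF y] by simp
    qed
    have yc: "y \<in> carrier_vec n" using car[OF y] .
    have "pos y = y - neg y" by (rule pos_eq_diff[OF yc])
    then have posY: "pos y \<in> Y" using self_dual_diff[OF p(1) Y y] neg_y[OF y] MY by auto
    have "neg (S *\<^sub>v pos y) = S *\<^sub>v pos y"
      using neg_S[OF pos_carrier[OF yc]] pos_eq_self[OF pos_carrier[OF yc] P_pos[OF yc]] by simp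
    moreover have "neg (S *\<^sub>v pos y) \<in> M" using neg_y[OF SY[OF posY]] .
    ultimately have "S *\<^sub>v pos y \<in> M" "neg (S *\<^sub>v pos y) = S *\<^sub>v pos y" by auto
    \<comment> \<open>\<open>S\<close> maps \<open>pos y\<close> to an element of \<open>M\<close>
      with eigenvalue -1, which by \<open>M_parts\<close> is also the image of some
      \<open>m'\<close> in \<open>M\<close>. The difference of the two preimages lies in the kernel
      of \<open>S\<close>.\<close>
    then obtain m' where m': "m' \<in> M" "S *\<^sub>v pos y = S *\<^sub>v m'" using M_parts(4) by metis
    define z where "z = pos y - m'"
    have m'c: "m' \<in> carrier_vec n" using M_carrier m' by blast
    have zc: "z \<in> carrier_vec n" using pos_carrier[OF yc] m'c by (simp add: z_def)
    have "z \<in> Y" unfolding z_def using self_dual_diff[OF p(1) Y posY] m'(1) MY by auto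
    moreover have "S *\<^sub>v z = 0\<^sub>v n"
      unfolding z_def S_lin(2)[OF pos_carrier[OF yc] m'c] m'(2) using S_carrier[OF m'c] by simp
    moreover have "y = (neg y + m') + z"
    proof -
      have "y = pos y + neg y" by (rule pos_add_neg[OF yc])
      also have "\<dots> = (neg y + m') + z"
        unfolding z_def using pos_carrier[OF yc] neg_carrier[OF yc] m'c by (intro eq_vecI) auto
      finally show ?thesis .
    qed
    moreover have "neg y + m' \<in> M" using M_add neg_y[OF y] m'(1) by blast
    ultimately show ?thesis using zc by blast
  qed
  show "\<exists>m\<in>M. \<exists>z\<in>?Z \<inter> L. y = m + z" if "y \<in> L" for y
    using dec[OF L_self_dual _ M_subset_L that] loc_lattice_mult_mat[OF p(1) S S_loc] by blast
  show "\<exists>m\<in>M. \<exists>z\<in>?Z \<inter> X. y = m + z" if "y \<in> X" for y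
    using dec[OF X SX MX that] .
qed

text \<open>The second case: \<open>M\<close> contains the \<open>+1\<close> eigenlattice, and modulo \<open>M\<close> everything lies in the line
  of those \<open>z\<close> orthogonal to \<open>e\<close> for which \<open>S z\<close> is a multiple of \<open>e\<close>.\<close>

lemma eq_L_if_pos_M:
  assumes X: "self_dual p n X" and SX: "\<And>x. x \<in> X \<Longrightarrow> S *\<^sub>v x \<in> X" and MX: "M \<subseteq> X"
    and posM: "\<And>x. x \<in> L \<Longrightarrow> pos x \<in> M"
  shows "L = X"
proof (rule self_dual_eq_if_common_line[OF p(1) L_self_dual X M_subset_L MX])
  let ?Z = "{z \<in> carrier_vec n. ones n \<bullet> z = 0 \<and> (\<exists>a. S *\<^sub>v z = a \<cdot>\<^sub>v ones n)}"
  fix z0 z assume z0: "z0 \<in> ?Z" and z: "z \<in> ?Z" and nz: "z0 \<noteq> 0\<^sub>v n"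
  obtain a0 a where a0: "S *\<^sub>v z0 = a0 \<cdot>\<^sub>v ones n" and a: "S *\<^sub>v z = a \<cdot>\<^sub>v ones n" using z0 z by blast
  \<comment> \<open>On \<open>?Z\<close> the factor \<open>a\<close> with \<open>S z = a e\<close>
    determines \<open>z\<close>, because an element of \<open>?Z\<close> in the kernel of
    \<open>S\<close> is zero.\<close>
  have nz0: "a0 \<noteq> 0"
  proof
    assume "a0 = 0"
    then have "S *\<^sub>v z0 = 0\<^sub>v n" using a0 by (auto intro!: eq_vecI)
    then show False using kernel_orthogonal_ones_eq_zero z0 nz by blast
  qed
  define t where "t = a / a0"
  have "z - t \<cdot>\<^sub>v z0 = 0\<^sub>v n"
  proof (rule kernel_orthogonal_ones_eq_zero)
    show "z - t \<cdot>\<^sub>v z0 \<in> carrier_vec n" using z z0 by simp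
    have "S *\<^sub>v (z - t \<cdot>\<^sub>v z0) = a \<cdot>\<^sub>v ones n - t \<cdot>\<^sub>v (a0 \<cdot>\<^sub>v ones n)"
      using z z0 a a0 S_lin(2)[of z "t \<cdot>\<^sub>v z0"] S_lin(3)[of z0 z0 t] by auto
    also have "\<dots> = 0\<^sub>v n" using nz0 by (intro eq_vecI) (auto simp: t_def)
    finally show "S *\<^sub>v (z - t \<cdot>\<^sub>v z0) = 0\<^sub>v n" .
    show "ones n \<bullet> (z - t \<cdot>\<^sub>v z0) = 0"
      using z z0 by (simp add: scalar_prod_minus_distrib[of _ n])
  qed
  then show "\<exists>t. z = t \<cdot>\<^sub>v z0" using smult_diff_zero z z0 by blast
next
  let ?Z = "{z \<in> carrier_vec n. ones n \<bullet> z = 0 \<and> (\<exists>a. S *\<^sub>v z = a \<cdot>\<^sub>v ones n)}"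
  have dec: "\<exists>m\<in>M. \<exists>z\<in>?Z \<inter> Y. y = m + z"
    if Y: "self_dual p n Y" and SY: "\<And>x. x \<in> Y \<Longrightarrow> S *\<^sub>v x \<in> Y" and MY: "M \<subseteq> Y" and y: "y \<in> Y" for Y y
  proof -
    note car = self_dual_carrier[OF Y]
    have pos_y: "pos y \<in> M" if y: "y \<in> Y" for y
    proof -
      have "pos y \<in> L"
      proof (rule self_dual_memI[OF L_self_dual])
        show "pos y \<in> carrier_vec n" using pos_carrier car y by blast
        fix x assume x: "x \<in> L"
        have "pos y \<bullet> x = y \<bullet> pos x" using pos_sym car[OF y] L_carrier[OF x] by blast
        then show "pos y \<bullet> x \<in> R" using self_dual_scalar_prod[OF Y y] posM[OF x] MY by auto
      qed
      then have "pos (pos y) \<in> M" by (rule posM)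
      then show ?thesis using pos_eq_self[OF pos_carrier P_pos] car[OF y] by simp
    qed
    have yc: "y \<in> carrier_vec n" using car[OF y] .
    note nc = neg_carrier[OF yc] and pc = pos_carrier[OF yc]
    have "neg y = y - pos y" by (rule neg_eq_diff[OF yc])
    then have negY: "neg y \<in> Y" using self_dual_diff[OF p(1) Y y] pos_y[OF y] MY by auto
    have pS: "pos (S *\<^sub>v neg y) = S *\<^sub>v neg y"
      using pos_S[OF nc] neg_eq_self[OF nc P_neg[OF yc]] by simp
    moreover have "pos (S *\<^sub>v neg y) \<in> M" using pos_y[OF SY[OF negY]] .
    ultimately have "S *\<^sub>v neg y \<in> M" by simp
    then obtain a m' where m': "m' \<in> M" "S *\<^sub>v neg y = a \<cdot>\<^sub>v ones n + S *\<^sub>v m'" using M_parts(3) by metis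
    have m'c: "m' \<in> carrier_vec n" using M_carrier m' by blast
    note nm = neg_carrier[OF m'c]
    \<comment> \<open>Applying \<open>pos\<close> leaves the left side fixed and replaces
      \<open>m'\<close> by \<open>neg m'\<close>. Then \<open>z\<close> below is a difference of two
      vectors with eigenvalue -1 and therefore orthogonal to the fixed vector
      \<open>e\<close>.\<close>
    have "S *\<^sub>v neg y = pos (a \<cdot>\<^sub>v ones n + S *\<^sub>v m')" using pS m'(2) by simp
    also have "\<dots> = a \<cdot>\<^sub>v ones n + S *\<^sub>v neg m'"
      using pos_lin(1)[of "a \<cdot>\<^sub>v ones n" "S *\<^sub>v m'"] pos_lin(2)[of "ones n" "ones n" a] S_carrier[OF m'c] pos_ones
        pos_S[OF m'c] by simp
    finally have Sn: "S *\<^sub>v neg y = a \<cdot>\<^sub>v ones n + S *\<^sub>v neg m'" .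
    define z where "z = neg y - neg m'"
    have zc: "z \<in> carrier_vec n" using nc nm by (simp add: z_def)
    have "z \<in> Y" unfolding z_def using self_dual_diff[OF p(1) Y negY] M_parts(2)[OF m'(1)] MY by auto
    moreover have "S *\<^sub>v z = a \<cdot>\<^sub>v ones n"
      unfolding z_def S_lin(2)[OF nc nm] Sn using S by (intro eq_vecI) (auto simp del: index_mult_mat_vec)
    moreover have "ones n \<bullet> z = 0"
    proof -
      have "neg (ones n) = 0\<^sub>v n" unfolding neg_def P_ones by (intro eq_vecI) auto
      then have "ones n \<bullet> neg x = 0" if "x \<in> carrier_vec n" for x
        using neg_sym[of "ones n" x] that by simp
      then show ?thesis unfolding z_def using yc m'c nc nm by (simp add: scalar_prod_minus_distrib[of _ n])
    qed
    moreover have "y = (pos y + neg m') + z"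
    proof -
      have "y = pos y + neg y" by (rule pos_add_neg[OF yc])
      also have "\<dots> = (pos y + neg m') + z"
        unfolding z_def using pc nc nm by (intro eq_vecI) auto
      finally show ?thesis .
    qed
    moreover have "pos y + neg m' \<in> M" using M_add pos_y[OF y] M_parts(2)[OF m'(1)] by blast
    ultimately show ?thesis using zc by blast
  qed
  show "\<exists>m\<in>M. \<exists>z\<in>?Z \<inter> L. y = m + z" if "y \<in> L" for y
    using dec[OF L_self_dual _ M_subset_L that] loc_lattice_mult_mat[OF p(1) S S_loc] by blast
  show "\<exists>m\<in>M. \<exists>z\<in>?Z \<inter> X. y = m + z" if "y \<in> X" for y
    using dec[OF X SX MX that] .
qed

text \<open>Since \<open>L / M\<close> is cyclic over a local ring and splits into its two eigenparts, one of these parts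
  vanishes.\<close>

lemma self_dual_eq_L:
  assumes X: "self_dual p n X" and SX: "\<And>x. x \<in> X \<Longrightarrow> S *\<^sub>v x \<in> X" and MX: "M \<subseteq> X"
    and g: "g \<in> L" and cyc: "\<And>x. x \<in> L \<Longrightarrow> \<exists>m\<in>M. \<exists>c\<in>R. x = m + c \<cdot>\<^sub>v g"
  shows "L = X"
proof -
  have gc: "g \<in> carrier_vec n" using L_carrier[OF g] .
  note pc = pos_carrier[OF gc] and nc = neg_carrier[OF gc]
  obtain m1 c1 where ng: "m1 \<in> M" "c1 \<in> R" "neg g = m1 + c1 \<cdot>\<^sub>v g" using cyc[OF neg_L[OF g]] by blast
  obtain m2 c2 where pg: "m2 \<in> M" "c2 \<in> R" "pos g = m2 + c2 \<cdot>\<^sub>v g" using cyc[OF pos_L[OF g]] by blast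
  have mc: "m1 \<in> carrier_vec n" "m2 \<in> carrier_vec n" using ng pg M_carrier by auto
  have case_neg: "L = X" if "neg g \<in> M"
  proof (rule eq_L_if_neg_M[OF X SX MX])
    fix x assume "x \<in> L"
    then obtain m c where x: "m \<in> M" "c \<in> R" "x = m + c \<cdot>\<^sub>v g" using cyc by blast
    then have "neg x = neg m + c \<cdot>\<^sub>v neg g"
      using neg_lin(1)[of m "c \<cdot>\<^sub>v g"] neg_lin(2)[OF gc gc, of c] M_carrier gc by simp
    then show "neg x \<in> M" using M_add M_smult M_parts(2) x that by simp
  qed
  have case_pos: "L = X" if "pos g \<in> M"
  proof (rule eq_L_if_pos_M[OF X SX MX])
    fix x assume "x \<in> L"
    then obtain m c where x: "m \<in> M" "c \<in> R" "x = m + c \<cdot>\<^sub>v g" using cyc by blast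
    then have "pos x = pos m + c \<cdot>\<^sub>v pos g"
      using pos_lin(1)[of m "c \<cdot>\<^sub>v g"] pos_lin(2)[OF gc gc, of c] M_carrier gc by simp
    then show "pos x \<in> M" using M_add M_smult M_parts(1) x that by simp
  qed
  have neg1: "-1 \<in> R" using loc_int_of_int[OF p(1), of "-1"] by simp
  have "1 - c1 - c2 \<in> R"
    using loc_int_diff[OF p(1) loc_int_diff[OF p(1) _ ng(2)] pg(2)] loc_int_of_int[OF p(1), of 1] by simp
  \<comment> \<open>The three ring elements add up to 1, so one is a unit. If it is
    \<open>1 - c1 - c2\<close>, adding the relations for \<open>neg g\<close> and
    \<open>pos g\<close> puts \<open>g\<close> into \<open>M\<close>. If it is \<open>c1\<close>,
    applying \<open>pos\<close> to the relation for \<open>neg g\<close> puts \<open>pos g\<close>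
    into \<open>M\<close>; the case of \<open>c2\<close> is symmetric.\<close>
  then have "1 - c1 - c2 \<noteq> 0 \<and> 1 / (1 - c1 - c2) \<in> R \<or> c1 \<noteq> 0 \<and> 1 / c1 \<in> R \<or> c2 \<noteq> 0 \<and> 1 / c2 \<in> R"
    using ng(2) pg(2) by (intro loc_int_three_summands[OF p(1)]) auto
  then consider "1 - c1 - c2 \<noteq> 0" "1 / (1 - c1 - c2) \<in> R" | "c1 \<noteq> 0" "1 / c1 \<in> R" | "c2 \<noteq> 0" "1 / c2 \<in> R"
    by blast
  then show ?thesis
  proof cases
    case 1
    have "g = (1 / (1 - c1 - c2)) \<cdot>\<^sub>v (m1 + m2)"
    proof (rule eq_vecI)
      fix i assume "i < dim_vec ((1 / (1 - c1 - c2)) \<cdot>\<^sub>v (m1 + m2))"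
      then have i: "i < n" using mc by simp
      have "g $ i = pos g $ i + neg g $ i"
        using arg_cong[OF pos_add_neg[OF gc], of "\<lambda>v. v $ i"] i nc by simp
      also have "\<dots> = m2 $ i + c2 * g $ i + (m1 $ i + c1 * g $ i)"
        unfolding ng(3) pg(3) using i gc mc by simp
      finally have "(1 - c1 - c2) * g $ i = m1 $ i + m2 $ i" by (simp add: algebra_simps)
      then show "g $ i = ((1 / (1 - c1 - c2)) \<cdot>\<^sub>v (m1 + m2)) $ i"
        using i mc 1(1) by (simp add: field_simps)
    qed (use gc mc in simp)
    then have "g \<in> M" using M_smult[OF 1(2)] M_add ng(1) pg(1) by metis
    then show ?thesis using case_neg M_parts(2) by blast
  next
    case 2
    have "0\<^sub>v n = pos (neg g)"
      unfolding pos_def P_neg[OF gc] using nc by (intro eq_vecI) auto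
    also have "\<dots> = pos m1 + c1 \<cdot>\<^sub>v pos g"
      using arg_cong[OF ng(3), of pos] pos_lin(1)[OF mc(1), of "c1 \<cdot>\<^sub>v g"] pos_lin(2)[OF gc gc, of c1] gc by simp
    finally have eq: "0\<^sub>v n = pos m1 + c1 \<cdot>\<^sub>v pos g" .
    have "pos g = (1 / c1) \<cdot>\<^sub>v ((-1) \<cdot>\<^sub>v pos m1)"
    proof (rule eq_vecI)
      fix i assume "i < dim_vec ((1 / c1) \<cdot>\<^sub>v ((-1) \<cdot>\<^sub>v pos m1))"
      then have i: "i < n" using pos_carrier[OF mc(1)] by simp
      have "0 = pos m1 $ i + c1 * pos g $ i"
        using arg_cong[OF eq, of "\<lambda>v. v $ i"] i pc pos_carrier[OF mc(1)] by simp
      then show "pos g $ i = ((1 / c1) \<cdot>\<^sub>v ((-1) \<cdot>\<^sub>v pos m1)) $ i"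
        using i pos_carrier[OF mc(1)] 2(1) by (simp add: field_simps)
    qed (use pc pos_carrier[OF mc(1)] in simp)
    then show ?thesis using case_pos M_smult[OF 2(2) M_smult[OF neg1 M_parts(1)[OF ng(1)]]] by simp
  next
    case 3
    have "0\<^sub>v n = neg (pos g)"
      unfolding neg_def P_pos[OF gc] using pc by (intro eq_vecI) auto
    also have "\<dots> = neg m2 + c2 \<cdot>\<^sub>v neg g"
      using arg_cong[OF pg(3), of neg] neg_lin(1)[OF mc(2), of "c2 \<cdot>\<^sub>v g"] neg_lin(2)[OF gc gc, of c2] gc by simp
    finally have eq: "0\<^sub>v n = neg m2 + c2 \<cdot>\<^sub>v neg g" .
    have "neg g = (1 / c2) \<cdot>\<^sub>v ((-1) \<cdot>\<^sub>v neg m2)"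
    proof (rule eq_vecI)
      fix i assume "i < dim_vec ((1 / c2) \<cdot>\<^sub>v ((-1) \<cdot>\<^sub>v neg m2))"
      then have i: "i < n" using neg_carrier[OF mc(2)] by simp
      have "0 = neg m2 $ i + c2 * neg g $ i"
        using arg_cong[OF eq, of "\<lambda>v. v $ i"] i nc neg_carrier[OF mc(2)] by simp
      then show "neg g $ i = ((1 / c2) \<cdot>\<^sub>v ((-1) \<cdot>\<^sub>v neg m2)) $ i"
        using i neg_carrier[OF mc(2)] 3(1) by (simp add: field_simps)
    qed (use nc neg_carrier[OF mc(2)] in simp)
    then show ?thesis using case_neg M_smult[OF 3(2) M_smult[OF neg1 M_parts(2)[OF pg(1)]]] by simp
  qed
qed

end

section \<open>The intertwining orthogonal matrix\<close>

lemma inverse_matE: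
  fixes A :: "'a :: field mat"
  assumes A: "A \<in> carrier_mat n n" and "det A \<noteq> 0"
  obtains B where "B \<in> carrier_mat n n" "A * B = 1\<^sub>m n" "B * A = 1\<^sub>m n"
proof
  let ?B = "(1 / det A) \<cdot>\<^sub>m adj_mat A"
  note adj = adj_mat[OF A]
  show "?B \<in> carrier_mat n n" using adj(1) by simp
  have one: "(1 / det A) \<cdot>\<^sub>m (det A \<cdot>\<^sub>m 1\<^sub>m n) = 1\<^sub>m n"
    using assms(2) by (intro eq_matI) auto
  show "A * ?B = 1\<^sub>m n" using mult_smult_distrib[OF A adj(1)] adj(2) one by simp
  show "?B * A = 1\<^sub>m n" using mult_smult_assoc_mat[OF adj(1) A] adj(3) one by simp
qed

lemma unimodular_inverseE:
  assumes "unimodular n U"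
  obtains V where "V \<in> carrier_mat n n" "U * V = 1\<^sub>m n" "V * U = 1\<^sub>m n"
proof
  have U: "U \<in> carrier_mat n n" and d: "det U = 1 \<or> det U = -1" using assms by (auto simp: unimodular_def)
  let ?B = "det U \<cdot>\<^sub>m adj_mat U"
  note adj = adj_mat[OF U]
  show "?B \<in> carrier_mat n n" using adj(1) by simp
  have one: "det U \<cdot>\<^sub>m (det U \<cdot>\<^sub>m 1\<^sub>m n) = 1\<^sub>m n"
    using d by (intro eq_matI) auto
  show "U * ?B = 1\<^sub>m n" using mult_smult_distrib[OF U adj(1)] adj(2) one by simp
  show "?B * U = 1\<^sub>m n" using mult_smult_assoc_mat[OF adj(1) U] adj(3) one by simp
qed

text \<open>Take \<open>Q = A B^(-1)\<close> for the two walk matrices. Equality of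
  \<open>A^T A\<close> and \<open>B^T B\<close> makes \<open>Q\<close> orthogonal, equality of
  \<open>A^T S A\<close> and \<open>B^T T B\<close> gives \<open>Q^T S Q = T\<close>, and
  \<open>e\<close> is the first column of both walk matrices.\<close>

lemma regular_orthogonal_exists:
  fixes S T :: "'a :: field_char_0 mat"
  assumes S: "S \<in> carrier_mat n n" "S\<^sup>T = - S" and T: "T \<in> carrier_mat n n" "T\<^sup>T = - T"
    and n: "n > 0"
    and eq: "\<And>k. walk_count S k = walk_count T k"
    and nz: "det (krylov_mat S) \<noteq> 0"
  obtains Q where "Q \<in> carrier_mat n n" "Q\<^sup>T * Q = 1\<^sub>m n" "Q * Q\<^sup>T = 1\<^sub>m n" "S * Q = Q * T"
    "Q *\<^sub>v ones n = ones n" "krylov_mat S = Q * krylov_mat T"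
proof -
  define A where "A = krylov_mat S"
  define B where "B = krylov_mat T"
  have A: "A \<in> carrier_mat n n" and B: "B \<in> carrier_mat n n" using S T by (auto simp: A_def B_def)
  have g1: "A\<^sup>T * A = B\<^sup>T * B" and g2: "A\<^sup>T * (S * A) = B\<^sup>T * (T * B)"
    unfolding A_def B_def krylov_gram[OF S] krylov_gram[OF T] eq by auto
  have "det (A\<^sup>T * A) = det A * det A" "det (B\<^sup>T * B) = det B * det B"
    using A B by (simp_all add: det_mult[of _ n] det_transpose)
  then have "det B \<noteq> 0" using g1 nz by (auto simp: A_def)
  then obtain V where V: "V \<in> carrier_mat n n" "B * V = 1\<^sub>m n" "V * B = 1\<^sub>m n"
    using inverse_matE[OF B] by blast
  define Q where "Q = A * V"
  have Q: "Q \<in> carrier_mat n n" using A V by (simp add: Q_def)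
  have QT: "Q\<^sup>T = V\<^sup>T * A\<^sup>T" unfolding Q_def by (rule transpose_mult[OF A V(1)])
  have c: "V\<^sup>T \<in> carrier_mat n n" "A\<^sup>T \<in> carrier_mat n n" "B\<^sup>T \<in> carrier_mat n n" using A B V by auto
  have AQ: "A = Q * B" unfolding Q_def using assoc_mult_mat[OF A V(1) B] V(3) A by simp
  \<comment> \<open>Used twice: with identity matrices for orthogonality, and with \<open>S\<close>
    and \<open>T\<close> for the intertwining relation.\<close>
  have sandwich: "Q\<^sup>T * (X * Q) = Y"
    if X: "X \<in> carrier_mat n n" and Y: "Y \<in> carrier_mat n n" and XY: "A\<^sup>T * (X * A) = B\<^sup>T * (Y * B)" for X Y
  proof -
    have XA: "X * A \<in> carrier_mat n n" and YB: "Y * B \<in> carrier_mat n n" using X Y A B by auto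
    have "X * Q = (X * A) * V" unfolding Q_def using assoc_mult_mat[OF X A V(1)] by simp
    then have "Q\<^sup>T * (X * Q) = V\<^sup>T * (A\<^sup>T * ((X * A) * V))"
      unfolding QT using assoc_mult_mat[OF c(1,2), of "(X * A) * V" n] XA V(1) by simp
    also have "A\<^sup>T * ((X * A) * V) = (A\<^sup>T * (X * A)) * V" using assoc_mult_mat[OF c(2) XA V(1)] by simp
    also have "\<dots> = B\<^sup>T * ((Y * B) * V)" unfolding XY using assoc_mult_mat[OF c(3) YB V(1)] by simp
    also have "(Y * B) * V = Y" using assoc_mult_mat[OF Y B V(1)] V(2) Y by simp
    also have "V\<^sup>T * (B\<^sup>T * Y) = (V\<^sup>T * B\<^sup>T) * Y" using assoc_mult_mat[OF c(1,3) Y] by simp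
    also have "V\<^sup>T * B\<^sup>T = 1\<^sub>m n" using transpose_mult[OF B V(1)] V(2) by simp
    finally show ?thesis using Y by simp
  qed
  have QQ: "Q\<^sup>T * Q = 1\<^sub>m n" using sandwich[of "1\<^sub>m n" "1\<^sub>m n"] g1 A B Q by simp
  have QT': "Q\<^sup>T \<in> carrier_mat n n" using Q by simp
  have QQ': "Q * Q\<^sup>T = 1\<^sub>m n" by (rule mat_mult_left_right_inverse[OF QT' Q QQ])
  have "Q\<^sup>T * (S * Q) = T" using sandwich[OF S(1) T(1) g2] .
  then have "Q * T = Q * (Q\<^sup>T * (S * Q))" by simp
  also have "\<dots> = (Q * Q\<^sup>T) * (S * Q)" using assoc_mult_mat[OF Q QT', of "S * Q" n] S Q by simp
  also have "\<dots> = S * Q" unfolding QQ' using S Q by simp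
  finally have SQ: "S * Q = Q * T" by simp
  have "ones n = col A 0" using n S(1) by (simp add: A_def col_krylov_mat)
  also have "\<dots> = Q *\<^sub>v col B 0" unfolding AQ using n by (intro col_mult2[OF Q B]) simp
  also have "col B 0 = ones n" using n T(1) by (simp add: B_def col_krylov_mat)
  finally have "Q *\<^sub>v ones n = ones n" by simp
  with Q QQ QQ' SQ AQ show ?thesis unfolding A_def B_def by (intro that)
qed

text \<open>In each row the entries and also their squares add up to 1. As \<open>z * z - z\<close>
  is nonnegative for integers, every entry is 0 or 1, so each row has a single 1; the column norms
  make the positions distinct.\<close>

lemma integral_orthogonal_permutation:
  fixes Q :: "rat mat"
  assumes Q: "Q \<in> carrier_mat n n" and QQ: "Q\<^sup>T * Q = 1\<^sub>m n" "Q * Q\<^sup>T = 1\<^sub>m n"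
    and e: "Q *\<^sub>v ones n = ones n" and int: "\<And>i j. i < n \<Longrightarrow> j < n \<Longrightarrow> Q $$ (i, j) \<in> \<int>"
  obtains p where "bij_betw p {..<n} {..<n}"
    "\<And>i j. i < n \<Longrightarrow> j < n \<Longrightarrow> Q $$ (i, j) = (if j = p i then 1 else 0)"
proof -
  have row1: "(\<Sum>j<n. Q $$ (i, j)) = 1" if "i < n" for i
  proof -
    have "(Q *\<^sub>v ones n) $ i = 1" using e that by simp
    then show ?thesis using Q that by (simp add: scalar_prod_def atLeast0LessThan)
  qed
  have row2: "(\<Sum>j<n. Q $$ (i, j) * Q $$ (i, j)) = 1" if "i < n" for i
  proof -
    have "(Q * Q\<^sup>T) $$ (i, i) = 1" using QQ that by simp
    then show ?thesis using Q that by (simp add: scalar_prod_def atLeast0LessThan)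
  qed
  have col2: "(\<Sum>i<n. Q $$ (i, j) * Q $$ (i, j)) = 1" if "j < n" for j
  proof -
    have "(Q\<^sup>T * Q) $$ (j, j) = 1" using QQ that by simp
    then show ?thesis using Q that by (simp add: scalar_prod_def atLeast0LessThan)
  qed
  have Q01: "Q $$ (i, j) = 0 \<or> Q $$ (i, j) = 1" if ij: "i < n" "j < n" for i j
  proof -
    have nonneg: "0 \<le> Q $$ (i, k) * Q $$ (i, k) - Q $$ (i, k)" if k: "k < n" for k
    proof -
      obtain z where z: "Q $$ (i, k) = of_int z" using int[OF ij(1) k] by (elim Ints_cases)
      have "0 \<le> z * z - z"
      proof (cases "z \<le> 0")
        case False
        then have "z * 1 \<le> z * z" by (intro mult_left_mono) auto
        then show ?thesis by simp
      qed (use zero_le_square[of z] in linarith)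
      then have "(0 :: rat) \<le> of_int (z * z - z)" by (simp only: of_int_0_le_iff)
      then show ?thesis using z by simp
    qed
    have "(\<Sum>k<n. Q $$ (i, k) * Q $$ (i, k) - Q $$ (i, k)) = 0"
      using row1[OF ij(1)] row2[OF ij(1)] by (simp add: sum_subtractf)
    then have "\<forall>k\<in>{..<n}. Q $$ (i, k) * Q $$ (i, k) - Q $$ (i, k) = 0"
      using nonneg by (subst (asm) sum_nonneg_eq_0_iff) auto
    then have "Q $$ (i, j) * (Q $$ (i, j) - 1) = 0" using ij by (simp add: algebra_simps)
    then show ?thesis by simp
  qed
  have ex: "\<exists>j<n. Q $$ (i, j) = 1" if "i < n" for i
  proof (rule ccontr)
    assume "\<not> ?thesis"
    then have "(\<Sum>j<n. Q $$ (i, j)) = 0" using Q01[OF that] by (intro sum.neutral) auto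
    then show False using row1[OF that] by simp
  qed
  define p where "p i = (SOME j. j < n \<and> Q $$ (i, j) = 1)" for i
  have p: "p i < n" "Q $$ (i, p i) = 1" if "i < n" for i
    using someI_ex[OF ex[OF that]] unfolding p_def by auto
  have nn: "0 \<le> Q $$ (i, j)" if "i < n" "j < n" for i j
    using Q01[OF that] by (elim disjE) simp_all
  have uniq: "j = p i" if "i < n" "j < n" "Q $$ (i, j) = 1" for i j
  proof (rule ccontr)
    assume ne: "j \<noteq> p i"
    have "(\<Sum>k\<in>{j, p i}. Q $$ (i, k)) \<le> (\<Sum>k<n. Q $$ (i, k))"
      using that p(1)[OF that(1)] nn[OF that(1)] by (intro sum_mono2) auto
    then show False using ne that(3) p(2)[OF that(1)] row1[OF that(1)] by simp
  qed
  have inj: "inj_on p {..<n}"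
  proof (rule inj_onI, rule ccontr)
    fix i k assume ik: "i \<in> {..<n}" "k \<in> {..<n}" "p i = p k" "i \<noteq> k"
    have "(\<Sum>l\<in>{i, k}. Q $$ (l, p i) * Q $$ (l, p i)) \<le> (\<Sum>l<n. Q $$ (l, p i) * Q $$ (l, p i))"
      using ik by (intro sum_mono2) auto
    moreover have "Q $$ (i, p i) = 1" "Q $$ (k, p i) = 1" "p i < n" using ik p[of i] p[of k] by auto
    ultimately show False using ik(4) col2[of "p i"] by simp
  qed
  have "p ` {..<n} \<subseteq> {..<n}" using p(1) by blast
  then have "p ` {..<n} = {..<n}" by (rule endo_inj_surj[OF finite_lessThan _ inj])
  then have "bij_betw p {..<n} {..<n}" using inj by (simp add: bij_betw_def)
  moreover have "Q $$ (i, j) = (if j = p i then 1 else 0)" if "i < n" "j < n" for i j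
  proof (cases "j = p i")
    case True
    then show ?thesis using p(2)[OF that(1)] by simp
  next
    case False
    then have "Q $$ (i, j) \<noteq> 1" using uniq[OF that] by blast
    then show ?thesis using Q01[OF that] False by simp
  qed
  ultimately show ?thesis by (rule that)
qed

section \<open>Transfer between integers and rationals\<close>

lemma walk_vec_of_int:
  assumes S: "S \<in> carrier_mat n n"
  shows "walk_vec (map_mat rat_of_int S) k = map_vec rat_of_int (walk_vec S k)"
proof (induction k)
  case 0
  have "map_mat rat_of_int S \<in> carrier_mat n n" using S by simp
  then show ?case using S by (auto intro!: eq_vecI)
next
  case (Suc k)
  have S': "map_mat rat_of_int S \<in> carrier_mat n n" using S by simp
  show ?case unfolding walk_vec_Suc[OF S'] walk_vec_Suc[OF S] Suc
    by (rule of_int_hom.mult_mat_vec_hom[OF S walk_vec_carrier[OF S], symmetric])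
qed

lemma krylov_mat_of_int:
  assumes S: "S \<in> carrier_mat n n"
  shows "krylov_mat (map_mat rat_of_int S) = map_mat rat_of_int (krylov_mat S)"
  using S by (intro eq_matI) (auto simp: krylov_mat_def walk_vec_of_int[OF S])

lemma scalar_prod_of_int:
  assumes "x \<in> carrier_vec n" "y \<in> carrier_vec n"
  shows "map_vec rat_of_int x \<bullet> map_vec rat_of_int y = rat_of_int (x \<bullet> y)"
  using assms by (simp add: scalar_prod_def)

lemma walk_count_of_int:
  assumes S: "S \<in> carrier_mat n n"
  shows "walk_count (map_mat rat_of_int S) k = rat_of_int (walk_count S k)"
proof -
  have "ones n = map_vec rat_of_int (ones n)" by (intro eq_vecI) auto
  then show ?thesis
    using S scalar_prod_of_int[of "ones n" n "walk_vec S k"] by (simp add: walk_count_def walk_vec_of_int[OF S])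
qed

lemma common_denominator:
  fixes f :: "nat \<Rightarrow> rat"
  shows "\<exists>N::int. N > 0 \<and> (\<forall>i<n. of_int N * f i \<in> \<int>)"
proof (induction n)
  case 0
  then show ?case by (intro exI[of _ 1]) simp
next
  case (Suc n)
  then obtain N :: int where N: "N > 0" "\<forall>i<n. of_int N * f i \<in> \<int>" by blast
  obtain a b where ab: "f n = of_int a / of_int b" "coprime a b" "b > 0" by (rule rat_fraction)
  have "of_int (N * b) * f i \<in> \<int>" if "i < Suc n" for i
  proof (cases "i = n")
    case True
    then have "of_int (N * b) * f i = of_int (N * a)" using ab by simp
    then show ?thesis by (simp only: Ints_of_int)
  next
    case False
    then have "of_int N * f i \<in> \<int>" using N that by (simp add: less_Suc_eq)
    from Ints_mult[OF Ints_of_int[of b] this] show ?thesis by (simp add: mult_ac)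
  qed
  then show ?case using N ab by (intro exI[of _ "N * b"]) auto
qed

lemma odd_part:
  fixes N :: int
  assumes "N > 0"
  obtains k m where "N = 2 ^ k * m" "odd m"
proof -
  obtain m where "N = 2 ^ multiplicity 2 N * m" "\<not> 2 dvd m"
    by (rule multiplicity_decompose'[of N 2]) (use assms in auto)
  then show ?thesis by (rule that)
qed

text \<open>The odd denominator of \<open>t\<close> can be cleared without affecting divisibility by
  powers of 2.\<close>

lemma dvd_if_loc_int_multiple:
  assumes "rat_of_int k = of_int (2 ^ e) * t" "t \<in> loc_int 2"
  shows "2 ^ e dvd k"
proof -
  obtain a b where ab: "t = of_int a / of_int b" "\<not> 2 dvd b" "b \<noteq> 0" using assms(2) by (rule loc_intE)
  have "rat_of_int (k * b) = of_int (2 ^ e * a)" using assms(1) ab by simp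
  then have "k * b = 2 ^ e * a" by (simp only: of_int_eq_iff)
  then have "2 ^ e dvd k * b" by simp
  moreover have "coprime (2 ^ e) b" using ab(2) by simp
  ultimately show ?thesis by (simp add: coprime_dvd_mult_left_iff)
qed

lemma skew_adj_carrier [simp]: "skew_adj n E \<in> carrier_mat n n"
  by (simp add: skew_adj_def)

lemma skew_adj_skew: "oriented_graph n E \<Longrightarrow> (skew_adj n E)\<^sup>T = - skew_adj n E"
  unfolding oriented_graph_def by (intro eq_matI) (auto simp: skew_adj_def)

lemma walk_matrix_eq_krylov_mat: "walk_matrix n E = krylov_mat (skew_adj n E)"
  by (intro eq_matI) (auto simp: walk_matrix_def krylov_mat_def walk_vec_def skew_adj_def)

lemma transpose_uminus_of_int:
  assumes "S\<^sup>T = - S"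
  shows "(map_mat rat_of_int S)\<^sup>T = - map_mat rat_of_int S"
proof -
  have "(map_mat rat_of_int S)\<^sup>T = map_mat rat_of_int (- S)"
    unfolding map_mat_transpose assms ..
  also have "\<dots> = - map_mat rat_of_int S" by (intro eq_matI) auto
  finally show ?thesis .
qed

lemma mult_of_int_mat:
  assumes "A \<in> carrier_mat n n" "B \<in> carrier_mat n n"
  shows "map_mat rat_of_int (A * B) = map_mat rat_of_int A * map_mat rat_of_int B"
  using assms by (intro of_int_hom.mat_hom_mult)

text \<open>At an odd prime all diagonal entries of the Smith form except possibly the last are
  units, so modulo the image of \<open>A\<close> the lattice is generated by the image
  \<open>g\<close> of the last unit vector under \<open>U1\<close>.\<close>

lemma smith_form_cyclic_quotient:
  assumes p: "prime p" "odd p" and n: "n \<ge> 2" and sf: "has_smith_form n A (target_snf n d)"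
  obtains g where "g \<in> loc_lattice p n"
    "\<And>x. x \<in> loc_lattice p n \<Longrightarrow>
       \<exists>m\<in>(*\<^sub>v) (map_mat rat_of_int A) ` loc_lattice p n. \<exists>c\<in>loc_int p. x = m + c \<cdot>\<^sub>v g"
proof -
  define ds where "ds = target_snf n d"
  define D where "D = mat n n (\<lambda>(i, j). if i = j then ds ! i else 0)"
  obtain U1 U2 where U: "unimodular n U1" "unimodular n U2" "A = U1 * D * U2"
    using sf unfolding has_smith_form_def D_def ds_def by blast
  obtain V1 where V1: "V1 \<in> carrier_mat n n" "U1 * V1 = 1\<^sub>m n" "V1 * U1 = 1\<^sub>m n"
    using unimodular_inverseE[OF U(1)] by blast
  obtain V2 where V2: "V2 \<in> carrier_mat n n" "U2 * V2 = 1\<^sub>m n" "V2 * U2 = 1\<^sub>m n"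
    using unimodular_inverseE[OF U(2)] by blast
  have c: "U1 \<in> carrier_mat n n" "U2 \<in> carrier_mat n n" "D \<in> carrier_mat n n"
    using U by (auto simp: unimodular_def D_def)
  let ?h = "map_mat rat_of_int"
  have hL: "?h B *\<^sub>v x \<in> loc_lattice p n" if "B \<in> carrier_mat n n" "x \<in> loc_lattice p n" for B x
    using that by (intro loc_lattice_mult_mat) (auto simp: p loc_int_of_int)
  have hc: "?h B \<in> carrier_mat n n" if "B \<in> carrier_mat n n" for B using that by simp
  have one: "?h (1\<^sub>m n) = 1\<^sub>m n" by (intro eq_matI) auto
  have UV: "?h U1 * ?h V1 = 1\<^sub>m n" "?h U2 * ?h V2 = 1\<^sub>m n"
    using mult_of_int_mat[OF c(1) V1(1)] V1(2) mult_of_int_mat[OF c(2) V2(1)] V2(2) one by simp_all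
  define g where "g = ?h U1 *\<^sub>v unit_vec n (n - 1)"
  have unit: "unit_vec n (n - 1) \<in> loc_lattice p n"
    using loc_int_of_int[OF p(1), of 0] loc_int_of_int[OF p(1), of 1] by (auto simp: loc_lattice_def unit_vec_def)
  have two: "\<not> p dvd 2" using p primes_dvd_imp_eq[of p 2] by auto
  have "\<exists>m\<in>(*\<^sub>v) (?h A) ` loc_lattice p n. \<exists>c\<in>loc_int p. x = m + c \<cdot>\<^sub>v g" if x: "x \<in> loc_lattice p n" for x
  proof -
    have xc: "x \<in> carrier_vec n" using x by (simp add: loc_lattice_def)
    define y where "y = ?h V1 *\<^sub>v x"
    have y: "y \<in> loc_lattice p n" unfolding y_def by (rule hL[OF V1(1) x])
    have yc: "y \<in> carrier_vec n" using y by (simp add: loc_lattice_def)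
    have xy: "x = ?h U1 *\<^sub>v y"
      unfolding y_def using assoc_mult_mat_vec[OF hc[OF c(1)] hc[OF V1(1)] xc] UV(1) xc by simp
    \<comment> \<open>\<open>D w\<close> agrees with \<open>y\<close> except in the last coordinate,
      where it is 0; that coordinate of \<open>y\<close> becomes the factor of
      \<open>g\<close>.\<close>
    define w where "w = vec n (\<lambda>i. if i < n - 1 then (1 / of_int (ds ! i)) * y $ i else 0)"
    have unit_ds: "\<not> p dvd ds ! i" "ds ! i \<noteq> 0" if "i < n - 1" for i
      using that two p(1) not_prime_unit[of p] target_snf_nth[OF n, of i d] by (auto simp: ds_def)
    have w: "w \<in> loc_lattice p n"
    proof -
      have "w $ i \<in> loc_int p" if "i < n" for i
      proof (cases "i < n - 1")
        case True
        have "y $ i \<in> loc_int p" using y that by (simp add: loc_lattice_def)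
        from loc_int_mult[OF p(1) loc_intI[OF unit_ds(1)[OF True], of 1] this] True that
        show ?thesis by (simp add: w_def)
      next
        case False
        then show ?thesis using that loc_int_0[OF p(1)] by (simp add: w_def)
      qed
      then show ?thesis by (simp add: loc_lattice_def w_def)
    qed
    have wc: "w \<in> carrier_vec n" by (simp add: w_def)
    define x2 where "x2 = ?h V2 *\<^sub>v w"
    have x2: "x2 \<in> loc_lattice p n" unfolding x2_def by (rule hL[OF V2(1) w])
    have x2c: "x2 \<in> carrier_vec n" using x2 by (simp add: loc_lattice_def)
    have Dw: "?h D *\<^sub>v w = vec n (\<lambda>i. if i < n - 1 then y $ i else 0)"
    proof -
      have "?h D = mat n n (\<lambda>(i, j). if i = j then of_int (ds ! i) else 0)"
        by (intro eq_matI) (auto simp: D_def)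
      then have "?h D *\<^sub>v w = vec n (\<lambda>i. of_int (ds ! i) * w $ i)"
        using diagonal_mult_vec[OF wc, of "\<lambda>i. of_int (ds ! i)"] by simp
      also have "\<dots> = vec n (\<lambda>i. if i < n - 1 then y $ i else 0)"
        using unit_ds(2) by (intro eq_vecI) (auto simp: w_def)
      finally show ?thesis .
    qed
    have "?h A *\<^sub>v x2 = ?h U1 *\<^sub>v (?h D *\<^sub>v w)"
    proof -
      have "?h A = ?h U1 * ?h D * ?h U2"
        unfolding U(3) using c by (simp add: mult_of_int_mat[of _ n])
      then have "?h A *\<^sub>v x2 = (?h U1 * ?h D) *\<^sub>v (?h U2 *\<^sub>v x2)"
        using assoc_mult_mat_vec[of "?h U1 * ?h D" n n "?h U2" n x2] c x2c by simp
      also have "?h U2 *\<^sub>v x2 = w"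
        unfolding x2_def using assoc_mult_mat_vec[OF hc[OF c(2)] hc[OF V2(1)] wc] UV(2) wc by simp
      also have "(?h U1 * ?h D) *\<^sub>v w = ?h U1 *\<^sub>v (?h D *\<^sub>v w)"
        by (rule assoc_mult_mat_vec[OF hc[OF c(1)] hc[OF c(3)] wc])
      finally show ?thesis .
    qed
    moreover have "x = ?h U1 *\<^sub>v (?h D *\<^sub>v w) + y $ (n - 1) \<cdot>\<^sub>v g"
    proof -
      have "y = ?h D *\<^sub>v w + y $ (n - 1) \<cdot>\<^sub>v unit_vec n (n - 1)"
        unfolding Dw using yc n by (intro eq_vecI) (auto simp: unit_vec_def not_less dest: le_antisym)
      then have "x = ?h U1 *\<^sub>v (?h D *\<^sub>v w + y $ (n - 1) \<cdot>\<^sub>v unit_vec n (n - 1))" using xy by simp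
      also have "\<dots> = ?h U1 *\<^sub>v (?h D *\<^sub>v w) + ?h U1 *\<^sub>v (y $ (n - 1) \<cdot>\<^sub>v unit_vec n (n - 1))"
        using c(3) wc by (intro mult_add_distrib_mat_vec[OF hc[OF c(1)]]) auto
      also have "?h U1 *\<^sub>v (y $ (n - 1) \<cdot>\<^sub>v unit_vec n (n - 1)) = y $ (n - 1) \<cdot>\<^sub>v g"
        unfolding g_def by (intro mult_mat_smult_vec[OF hc[OF c(1)]]) simp
      finally show ?thesis .
    qed
    ultimately have "x = ?h A *\<^sub>v x2 + y $ (n - 1) \<cdot>\<^sub>v g" by simp
    moreover have "y $ (n - 1) \<in> loc_int p" using y n by (simp add: loc_lattice_def)
    ultimately show ?thesis using x2 by blast
  qed
  moreover have "g \<in> loc_lattice p n" unfolding g_def by (rule hL[OF c(1) unit])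
  ultimately show ?thesis by (intro that)
qed

section \<open>Integrality of \<open>Q\<close> at each prime\<close>

locale intertwined =
  fixes n :: nat and S T :: "int mat" and Q :: "rat mat"
  assumes n: "n > 0"
    and S: "S \<in> carrier_mat n n" and S_skew: "S\<^sup>T = - S" and T: "T \<in> carrier_mat n n"
    and Q: "Q \<in> carrier_mat n n" and QQ: "Q\<^sup>T * Q = 1\<^sub>m n" "Q * Q\<^sup>T = 1\<^sub>m n"
    and SQ: "map_mat rat_of_int S * Q = Q * map_mat rat_of_int T"
    and Q_ones: "Q *\<^sub>v ones n = ones n"
    and WQ: "krylov_mat (map_mat rat_of_int S) = Q * krylov_mat (map_mat rat_of_int T)"
begin

abbreviation "Sr \<equiv> map_mat rat_of_int S"
abbreviation "Tr \<equiv> map_mat rat_of_int T"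
definition "X p = (*\<^sub>v) Q ` loc_lattice p n"

lemma Sr: "Sr \<in> carrier_mat n n" and Tr: "Tr \<in> carrier_mat n n" using S T by auto

lemma int_mat_loc_lattice:
  "prime p \<Longrightarrow> B \<in> carrier_mat n n \<Longrightarrow> x \<in> loc_lattice p n \<Longrightarrow> map_mat rat_of_int B *\<^sub>v x \<in> loc_lattice p n"
  by (intro loc_lattice_mult_mat) (auto simp: loc_int_of_int)

lemma X_self_dual: "prime p \<Longrightarrow> self_dual p n (X p)"
  unfolding X_def by (intro self_dual_orthogonal_image loc_lattice_self_dual Q QQ)

text \<open>Applying \<open>S\<close> to \<open>Q y\<close> amounts to applying \<open>Q\<close> to
  \<open>T y\<close>, and \<open>T\<close> is integral.\<close>

lemma S_X:
  assumes p: "prime p" and x: "x \<in> X p"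
  shows "Sr *\<^sub>v x \<in> X p"
proof -
  obtain y where y: "y \<in> loc_lattice p n" "x = Q *\<^sub>v y" using x unfolding X_def by blast
  have yc: "y \<in> carrier_vec n" using y by (simp add: loc_lattice_def)
  have "Sr *\<^sub>v x = Q *\<^sub>v (Tr *\<^sub>v y)"
    using assoc_mult_mat_vec[OF Sr Q yc] assoc_mult_mat_vec[OF Q Tr yc] SQ y(2) by simp
  then show ?thesis unfolding X_def using int_mat_loc_lattice[OF p T y(1)] by simp
qed

lemma pow_S_X:
  assumes p: "prime p" and x: "x \<in> X p"
  shows "Sr ^\<^sub>m j *\<^sub>v x \<in> X p"
proof (induction j)
  case 0
  show ?case using x self_dual_carrier[OF X_self_dual[OF p] x] Sr by simp
next
  case (Suc j)
  have "Sr ^\<^sub>m Suc j *\<^sub>v x = Sr *\<^sub>v (Sr ^\<^sub>m j *\<^sub>v x)"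
    unfolding pow_mat_Suc_left[OF Sr]
    by (rule assoc_mult_mat_vec[OF Sr pow_carrier_mat[OF Sr] self_dual_carrier[OF X_self_dual[OF p] x]])
  then show ?case using S_X[OF p Suc] by simp
qed

lemma walk_vec_X:
  assumes p: "prime p"
  shows "walk_vec Sr k \<in> X p"
proof -
  have "ones n \<in> loc_lattice p n" using loc_int_of_int[OF p, of 1] by (simp add: loc_lattice_def)
  then have "ones n \<in> X p" unfolding X_def using Q_ones by (metis imageI)
  then show ?thesis using pow_S_X[OF p, of "ones n" k] Sr by (simp add: walk_vec_def)
qed

text \<open>The columns of \<open>Q\<close> are the images of the unit vectors.\<close>

lemma entry_in_loc_int:
  assumes p: "prime p" and "X p \<subseteq> loc_lattice p n" and "i < n" "j < n"
  shows "Q $$ (i, j) \<in> loc_int p"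
proof -
  have "unit_vec n j \<in> loc_lattice p n"
    using loc_int_of_int[OF p, of 0] loc_int_of_int[OF p, of 1] by (auto simp: loc_lattice_def unit_vec_def)
  then have "Q *\<^sub>v unit_vec n j \<in> loc_lattice p n" using assms(2) unfolding X_def by blast
  moreover have "(Q *\<^sub>v unit_vec n j) $ i = Q $$ (i, j)" using Q assms(3,4) by simp
  ultimately show ?thesis using assms(3) by (auto simp: loc_lattice_def)
qed

lemma odd_prime_integral:
  assumes p: "prime p" "odd p" and n2: "n \<ge> 2"
    and sf: "has_smith_form n (krylov_mat S) (target_snf n d)"
    and nz: "det (krylov_mat S) \<noteq> 0"
    and P: "P \<in> carrier_mat n n" "P\<^sup>T * P = 1\<^sub>m n" "P *\<^sub>v ones n = ones n" "P * S = - (S * P)"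
    and ij: "i < n" "j < n"
  shows "Q $$ (i, j) \<in> loc_int p"
proof -
  have "det (krylov_mat Sr) \<noteq> 0" unfolding krylov_mat_of_int[OF S] using nz by simp
  then obtain V where V: "V \<in> carrier_mat n n" "krylov_mat Sr * V = 1\<^sub>m n" "V * krylov_mat Sr = 1\<^sub>m n"
    using inverse_matE[OF krylov_mat_carrier[OF Sr]] by blast
  let ?P = "map_mat rat_of_int P"
  interpret A: anti_involution n p Sr ?P V
  proof
    show "Sr\<^sup>T = - Sr" by (rule transpose_uminus_of_int[OF S_skew])
    have "?P\<^sup>T * ?P = map_mat rat_of_int (P\<^sup>T * P)"
      using P(1) by (simp add: map_mat_transpose mult_of_int_mat[of _ n])
    also have "\<dots> = 1\<^sub>m n" unfolding P(2) by (intro eq_matI) auto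
    finally show "?P\<^sup>T * ?P = 1\<^sub>m n" .
    have e: "map_vec rat_of_int (ones n) = ones n" by (intro eq_vecI) auto
    have "?P *\<^sub>v map_vec rat_of_int (ones n) = map_vec rat_of_int (P *\<^sub>v ones n)"
      by (rule of_int_hom.mult_mat_vec_hom[OF P(1), symmetric]) simp
    then show "?P *\<^sub>v ones n = ones n" unfolding P(3) e .
    have "?P * Sr = map_mat rat_of_int (- (S * P))"
      using P(1,4) S by (simp add: mult_of_int_mat[of _ n, symmetric])
    also have "\<dots> = - map_mat rat_of_int (S * P)" using S P(1) by (intro eq_matI) auto
    also have "map_mat rat_of_int (S * P) = Sr * ?P" using S P(1) by (rule mult_of_int_mat)
    finally show "?P * Sr = - (Sr * ?P)" .
  qed (use n p V S P in \<open>auto simp: loc_int_of_int\<close>)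
  obtain g where g: "g \<in> loc_lattice p n" "\<And>x. x \<in> loc_lattice p n \<Longrightarrow>
      \<exists>m\<in>(*\<^sub>v) (map_mat rat_of_int (krylov_mat S)) ` loc_lattice p n. \<exists>c\<in>loc_int p. x = m + c \<cdot>\<^sub>v g"
    by (rule smith_form_cyclic_quotient[OF p n2 sf]) (rule that)
  have "loc_lattice p n = X p"
  proof (rule A.self_dual_eq_L[OF X_self_dual[OF p(1)] S_X[OF p(1)] _ g(1)])
    show "\<exists>m\<in>A.M. \<exists>c\<in>loc_int p. x = m + c \<cdot>\<^sub>v g" if "x \<in> loc_lattice p n" for x
      using g(2)[OF that] unfolding A.M_def krylov_mat_of_int[OF S] .
    \<comment> \<open>The walk matrix of \<open>S\<close> is \<open>Q\<close> times that of
      \<open>T\<close>, and the latter is integral.\<close>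
    show "A.M \<subseteq> X p"
    proof
      fix m assume "m \<in> A.M"
      then obtain x where x: "x \<in> loc_lattice p n" "m = krylov_mat Sr *\<^sub>v x" unfolding A.M_def by blast
      have xc: "x \<in> carrier_vec n" using x by (simp add: loc_lattice_def)
      have "m = Q *\<^sub>v (krylov_mat Tr *\<^sub>v x)"
        unfolding x(2) WQ by (rule assoc_mult_mat_vec[OF Q krylov_mat_carrier[OF Tr] xc])
      moreover have "krylov_mat Tr *\<^sub>v x \<in> loc_lattice p n"
        unfolding krylov_mat_of_int[OF T] by (rule int_mat_loc_lattice[OF p(1) krylov_mat_carrier[OF T] x(1)])
      ultimately show "m \<in> X p" unfolding X_def by blast
    qed
  qed
  then show ?thesis using entry_in_loc_int[OF p(1) _ ij] by simp
qed

text \<open>Doubling \<open>y\<close> gives an integral vector \<open>u\<close>. The pairings of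
  \<open>y\<close> with walk vectors and of \<open>S^j y\<close> with itself lie in the localization
  at 2, so for \<open>u\<close> they become divisible by 2 and 4.\<close>

lemma halving:
  assumes n2: "n \<ge> 2" and d: "odd d" and sf: "has_smith_form n (krylov_mat S) (target_snf n d)"
    and y: "y \<in> X 2" and int: "\<And>i. i < n \<Longrightarrow> 2 * y $ i \<in> \<int>" and i: "i < n"
  shows "y $ i \<in> \<int>"
proof -
  have two: "prime (2 :: int)" by simp
  note sd = X_self_dual[OF two]
  have yc: "y \<in> carrier_vec n" by (rule self_dual_carrier[OF sd y])
  define u where "u = vec n (\<lambda>i. \<lfloor>2 * y $ i\<rfloor>)"
  have u: "u \<in> carrier_vec n" by (simp add: u_def)
  have uy: "map_vec rat_of_int u = 2 \<cdot>\<^sub>v y"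
    using int yc by (intro eq_vecI) (auto simp: u_def elim!: Ints_cases)
  have "even (u $ i)"
  proof (rule two_divisible_if_isotropic[OF S S_skew n2 d sf u _ _ i])
    fix k
    have "rat_of_int (walk_vec S k \<bullet> u) = walk_vec Sr k \<bullet> (2 \<cdot>\<^sub>v y)"
      unfolding uy[symmetric] walk_vec_of_int[OF S] by (rule scalar_prod_of_int[OF walk_vec_carrier[OF S] u, symmetric])
    also have "\<dots> = of_int (2 ^ 1) * (walk_vec Sr k \<bullet> y)"
      by (subst scalar_prod_smult_distrib[OF walk_vec_carrier[OF Sr] yc]) simp
    finally have "2 ^ 1 dvd walk_vec S k \<bullet> u"
      by (rule dvd_if_loc_int_multiple) (rule self_dual_scalar_prod[OF sd walk_vec_X[OF two] y])
    then show "even (walk_vec S k \<bullet> u)" by simp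
  next
    fix j
    have Pc: "S ^\<^sub>m j *\<^sub>v u \<in> carrier_vec n"
      by (rule mult_mat_vec_carrier[OF pow_carrier_mat[OF S] u])
    have "map_vec rat_of_int (S ^\<^sub>m j *\<^sub>v u) = map_mat rat_of_int (S ^\<^sub>m j) *\<^sub>v map_vec rat_of_int u"
      by (rule of_int_hom.mult_mat_vec_hom[OF pow_carrier_mat[OF S] u])
    also have "map_mat rat_of_int (S ^\<^sub>m j) = Sr ^\<^sub>m j" by (rule of_int_hom.mat_hom_pow[OF S])
    also have "Sr ^\<^sub>m j *\<^sub>v map_vec rat_of_int u = 2 \<cdot>\<^sub>v (Sr ^\<^sub>m j *\<^sub>v y)"
      unfolding uy by (rule mult_mat_smult_vec[OF pow_carrier_mat[OF Sr] yc])
    finally have h: "map_vec rat_of_int (S ^\<^sub>m j *\<^sub>v u) = 2 \<cdot>\<^sub>v (Sr ^\<^sub>m j *\<^sub>v y)" .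
    have Py: "Sr ^\<^sub>m j *\<^sub>v y \<in> X 2" by (rule pow_S_X[OF two y])
    have "rat_of_int ((S ^\<^sub>m j *\<^sub>v u) \<bullet> (S ^\<^sub>m j *\<^sub>v u)) =
        (2 \<cdot>\<^sub>v (Sr ^\<^sub>m j *\<^sub>v y)) \<bullet> (2 \<cdot>\<^sub>v (Sr ^\<^sub>m j *\<^sub>v y))"
      unfolding h[symmetric] by (rule scalar_prod_of_int[OF Pc Pc, symmetric])
    also have "\<dots> = of_int (2 ^ 2) * ((Sr ^\<^sub>m j *\<^sub>v y) \<bullet> (Sr ^\<^sub>m j *\<^sub>v y))"
      using self_dual_carrier[OF sd Py]
      by (simp add: smult_scalar_prod_distrib[of _ n] scalar_prod_smult_distrib[of _ n] del: scalar_prod_smult_left scalar_prod_smult_right)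
    finally have "2 ^ 2 dvd (S ^\<^sub>m j *\<^sub>v u) \<bullet> (S ^\<^sub>m j *\<^sub>v u)"
      by (rule dvd_if_loc_int_multiple) (rule self_dual_scalar_prod[OF sd Py Py])
    then show "4 dvd (S ^\<^sub>m j *\<^sub>v u) \<bullet> (S ^\<^sub>m j *\<^sub>v u)" by simp
  qed
  then obtain k where "u $ i = 2 * k" by (elim evenE)
  moreover have "rat_of_int (u $ i) = 2 * y $ i"
    using arg_cong[OF uy, of "\<lambda>v. v $ i"] i u yc by simp
  ultimately have "y $ i = of_int k" by simp
  then show ?thesis by simp
qed

text \<open>The odd part of the common denominator of a column of \<open>Q\<close> can be cleared
  within the lattice; the remaining power of 2 is removed by repeated halving.\<close>

lemma two_integral:
  assumes n2: "n \<ge> 2" and d: "odd d" and sf: "has_smith_form n (krylov_mat S) (target_snf n d)"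
    and ij: "i < n" "j < n"
  shows "Q $$ (i, j) \<in> loc_int 2"
proof -
  have two: "prime (2 :: int)" by simp
  note sd = X_self_dual[OF two]
  \<comment> \<open>The induction hypothesis is applied to \<open>2 y\<close>, whose integrality is
    what \<open>halving\<close> requires for \<open>y\<close>.\<close>
  have powers: "\<forall>i<n. y $ i \<in> \<int>" if "y \<in> X 2" "\<forall>i<n. 2 ^ k * y $ i \<in> \<int>" for y k
    using that
  proof (induction k arbitrary: y)
    case (Suc k)
    have "2 \<cdot>\<^sub>v y \<in> X 2"
      using self_dual_smult[OF two sd _ Suc.prems(1), of 2] loc_int_of_int[OF two, of 2] by simp
    moreover have yc: "y \<in> carrier_vec n" by (rule self_dual_carrier[OF sd Suc.prems(1)])
    ultimately have "\<forall>i<n. (2 \<cdot>\<^sub>v y) $ i \<in> \<int>"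
      using Suc.prems(2) by (intro Suc.IH) (auto simp: mult_ac)
    then show ?case using halving[OF n2 d sf Suc.prems(1)] yc by simp
  qed simp
  define q where "q = Q *\<^sub>v unit_vec n j"
  have "unit_vec n j \<in> loc_lattice 2 n"
    using loc_int_of_int[OF two, of 0] loc_int_of_int[OF two, of 1] by (auto simp: loc_lattice_def unit_vec_def)
  then have q: "q \<in> X 2" unfolding q_def X_def by blast
  have qc: "q \<in> carrier_vec n" by (rule self_dual_carrier[OF sd q])
  obtain N :: int where N: "N > 0" "\<forall>i<n. of_int N * q $ i \<in> \<int>"
    using common_denominator[of n "\<lambda>i. q $ i"] by blast
  obtain k m where km: "N = 2 ^ k * m" "odd m" using odd_part[OF N(1)] by blast
  have "of_int m \<cdot>\<^sub>v q \<in> X 2" by (rule self_dual_smult[OF two sd loc_int_of_int[OF two] q])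
  moreover have "\<forall>i<n. 2 ^ k * (of_int m \<cdot>\<^sub>v q) $ i \<in> \<int>"
    using N(2) qc by (simp add: km(1) mult.assoc)
  ultimately have "(of_int m \<cdot>\<^sub>v q) $ i \<in> \<int>" using powers ij(1) by blast
  then obtain z where z: "of_int m * q $ i = of_int z" using qc ij(1) by (auto elim: Ints_cases)
  have "m \<noteq> 0" using km(2) by auto
  then have "q $ i = of_int z / of_int m" using z by (simp add: field_simps)
  moreover have "q $ i = Q $$ (i, j)" using Q ij by (simp add: q_def)
  ultimately show ?thesis using loc_intI[of 2 m z] km(2) by simp
qed

end

section \<open>Self-converse graphs and the final assembly\<close>

lemma self_converse_anti_automorphism:
  assumes og: "oriented_graph n E" and sc: "self_converse n E"
  obtains P :: "int mat" where "P \<in> carrier_mat n n" "P\<^sup>T * P = 1\<^sub>m n" "P *\<^sub>v ones n = ones n"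
    "P * skew_adj n E = - (skew_adj n E * P)"
proof -
  obtain p where bij: "bij_betw p {..<n} {..<n}" and pE: "\<And>i j. i < n \<Longrightarrow> j < n \<Longrightarrow> E i j \<longleftrightarrow> E (p j) (p i)"
    using sc unfolding self_converse_def isomorphic_og_def converse_graph_def by blast
  define S where "S = skew_adj n E"
  have S: "S \<in> carrier_mat n n" by (simp add: S_def)
  define P :: "int mat" where "P = mat n n (\<lambda>(i, j). if j = p i then 1 else 0)"
  have P: "P \<in> carrier_mat n n" by (simp add: P_def)
  have pn: "p i < n" if "i < n" for i using bij that by (auto simp: bij_betw_def)
  have inj: "p i = p j \<longleftrightarrow> i = j" if "i < n" "j < n" for i j
    using bij that by (auto simp: bij_betw_def inj_on_def)
  have surj: "\<exists>l<n. p l = j" if "j < n" for j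
  proof -
    have "j \<in> p ` {..<n}" using bij that by (simp add: bij_betw_def)
    then show ?thesis by auto
  qed
  \<comment> \<open>The permutation reverses all arcs, so it negates the entries of
    \<open>S\<close>; this becomes the anticommutation of \<open>S\<close> with the permutation
    matrix \<open>P\<close>.\<close>
  have Sp: "S $$ (p i, p j) = - S $$ (i, j)" if "i < n" "j < n" for i j
    using that pn pE[OF that] pE[OF that(2,1)] og by (auto simp: S_def skew_adj_def oriented_graph_def)
  have "P\<^sup>T * P = 1\<^sub>m n"
  proof (rule eq_matI)
    fix i j assume "i < dim_row (1\<^sub>m n :: int mat)" "j < dim_col (1\<^sub>m n :: int mat)"
    then have ij: "i < n" "j < n" by auto
    obtain l where l: "l < n" "p l = i" using surj[OF ij(1)] by blast
    have "(P\<^sup>T * P) $$ (i, j) = (\<Sum>k<n. (if i = p k then 1 else 0) * (if j = p k then 1 else 0))"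
      using ij by (simp add: P_def scalar_prod_def atLeast0LessThan)
    also have "\<dots> = (\<Sum>k<n. if k = l then (if i = j then 1 else 0) else 0)"
      using l inj by (intro sum.cong) auto
    also have "\<dots> = 1\<^sub>m n $$ (i, j)" using l ij by simp
    finally show "(P\<^sup>T * P) $$ (i, j) = 1\<^sub>m n $$ (i, j)" .
  qed (use P in auto)
  moreover have "P *\<^sub>v ones n = ones n"
    using pn by (intro eq_vecI) (auto simp: P_def scalar_prod_def atLeast0LessThan)
  moreover have "P * S = - (S * P)"
  proof (rule eq_matI)
    fix i j assume "i < dim_row (- (S * P))" "j < dim_col (- (S * P))"
    then have ij: "i < n" "j < n" using S P by auto
    obtain l where l: "l < n" "p l = j" using surj[OF ij(2)] by blast
    have "(P * S) $$ (i, j) = (\<Sum>k<n. (if k = p i then 1 else 0) * S $$ (k, j))"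
      using ij S by (simp add: P_def scalar_prod_def atLeast0LessThan)
    also have "\<dots> = (\<Sum>k<n. if k = p i then S $$ (p i, j) else 0)" by (intro sum.cong) auto
    also have "\<dots> = - S $$ (i, l)" using pn[OF ij(1)] Sp[OF ij(1) l(1)] l(2) by simp
    also have "S $$ (i, l) = (\<Sum>k<n. if k = l then S $$ (i, l) else 0)" using l by simp
    also have "\<dots> = (\<Sum>k<n. S $$ (i, k) * (if j = p k then 1 else 0))"
      using l inj by (intro sum.cong) auto
    also have "- \<dots> = (- (S * P)) $$ (i, j)"
      using ij S by (simp add: P_def scalar_prod_def atLeast0LessThan)
    finally show "(P * S) $$ (i, j) = (- (S * P)) $$ (i, j)" .
  qed (use S P in auto)
  ultimately show ?thesis using P unfolding S_def by (intro that)
qed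

theorem theorem1p6:
  fixes n :: nat and E :: "nat \<Rightarrow> nat \<Rightarrow> bool" and d :: int
  assumes "n \<ge> 2"
    and "oriented_graph n E"
    and "self_converse n E"
    and "odd d"
    and "has_smith_form n (walk_matrix n E) (target_snf n d)"
  shows "DGSS n E"
  unfolding DGSS_def
proof (intro allI impI)
  fix F
  assume F: "oriented_graph n F" and spec1: "spec (skew_adj n E) = spec (skew_adj n F)"
    and spec2: "spec (all_ones_mat n - skew_adj n E) = spec (all_ones_mat n - skew_adj n F)"
  have n: "n > 0" using assms(1) by simp
  define S where "S = skew_adj n E"
  define T where "T = skew_adj n F"
  have S: "S \<in> carrier_mat n n" "S\<^sup>T = - S" and T: "T \<in> carrier_mat n n" "T\<^sup>T = - T"
    using skew_adj_skew assms(2) F by (auto simp: S_def T_def)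
  have sf: "has_smith_form n (krylov_mat S) (target_snf n d)"
    using assms(5) by (simp add: walk_matrix_eq_krylov_mat S_def)
  have "det (krylov_mat S) \<noteq> 0"
    using smith_form_det[OF sf] assms(4) unfolding prod_target_snf[OF assms(1)] by auto
  have J: "all_ones_mat n - S \<in> carrier_mat n n" "all_ones_mat n - T \<in> carrier_mat n n"
    using S(1) T(1) by (simp_all add: minus_carrier_mat)
  have "char_poly S = char_poly T"
    using char_poly_eq_if_spec_eq[OF S(1) T(1)] spec1 by (simp add: S_def T_def)
  moreover have "char_poly (all_ones_mat n - S) = char_poly (all_ones_mat n - T)"
    using char_poly_eq_if_spec_eq[OF J] spec2 by (simp add: S_def T_def)
  ultimately have wc: "walk_count S k = walk_count T k" for k
    unfolding all_ones_mat_def by (intro walk_count_determined[OF S T n])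
  let ?S = "map_mat rat_of_int S" and ?T = "map_mat rat_of_int T"
  have Sr: "?S \<in> carrier_mat n n" "?S\<^sup>T = - ?S" and Tr: "?T \<in> carrier_mat n n" "?T\<^sup>T = - ?T"
    using S T transpose_uminus_of_int by auto
  have "det (krylov_mat ?S) \<noteq> 0"
    unfolding krylov_mat_of_int[OF S(1)] using \<open>det (krylov_mat S) \<noteq> 0\<close> by simp
  moreover have "walk_count ?S k = walk_count ?T k" for k
    using wc by (simp add: walk_count_of_int[OF S(1)] walk_count_of_int[OF T(1)])
  note nzwc = calculation this
  obtain Q where Q: "Q \<in> carrier_mat n n" "Q\<^sup>T * Q = 1\<^sub>m n" "Q * Q\<^sup>T = 1\<^sub>m n" "?S * Q = Q * ?T"
    "Q *\<^sub>v ones n = ones n" "krylov_mat ?S = Q * krylov_mat ?T"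
    by (rule regular_orthogonal_exists[OF Sr Tr n nzwc(2,1)]) (rule that)
  interpret I: intertwined n S T Q
    by standard (use n S T Q in auto)
  obtain P :: "int mat" where P: "P \<in> carrier_mat n n" "P\<^sup>T * P = 1\<^sub>m n" "P *\<^sub>v ones n = ones n"
    "P * S = - (S * P)"
    by (rule self_converse_anti_automorphism[OF assms(2,3), folded S_def]) (rule that)
  \<comment> \<open>Integrality is checked prime by prime: at 2 by the halving argument, at odd
    primes by comparing the lattices \<open>L\<close> and \<open>Q L\<close>.\<close>
  have "Q $$ (i, j) \<in> \<int>" if ij: "i < n" "j < n" for i j
  proof (rule Ints_if_all_loc_int)
    fix p :: int assume p: "prime p"
    show "Q $$ (i, j) \<in> loc_int p"
    proof (cases "p = 2")
      case True
      then show ?thesis using I.two_integral[OF assms(1,4) sf ij] by simp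
    next
      case False
      then have "odd p" using p primes_dvd_imp_eq[of 2 p] by auto
      then show ?thesis
        using I.odd_prime_integral[OF p _ assms(1) sf \<open>det (krylov_mat S) \<noteq> 0\<close> P ij] by simp
    qed
  qed
  then obtain p where p: "bij_betw p {..<n} {..<n}"
    "\<And>i j. i < n \<Longrightarrow> j < n \<Longrightarrow> Q $$ (i, j) = (if j = p i then 1 else 0)"
    by (rule integral_orthogonal_permutation[OF Q(1-3,5)]) (assumption, assumption, rule that)
  have pn: "p i < n" if "i < n" for i using p(1) that by (auto simp: bij_betw_def)
  have inj: "p i = p j \<longleftrightarrow> i = j" if "i < n" "j < n" for i j
    using p(1) that by (auto simp: bij_betw_def inj_on_def)
  \<comment> \<open>Compare the entries at \<open>(i, p j)\<close> in \<open>S Q = Q T\<close>: on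
    each side the permutation matrix \<open>Q\<close> selects a single term.\<close>
  have ST: "S $$ (i, j) = T $$ (p i, p j)" if ij: "i < n" "j < n" for i j
  proof -
    have "(?S * Q) $$ (i, p j) = (\<Sum>k<n. of_int (S $$ (i, k)) * Q $$ (k, p j))"
      using ij pn S(1) Q(1) by (simp add: scalar_prod_def atLeast0LessThan)
    also have "\<dots> = (\<Sum>k<n. if k = j then of_int (S $$ (i, j)) else 0)"
      using ij pn inj by (intro sum.cong) (auto simp: p(2))
    finally have 1: "(?S * Q) $$ (i, p j) = of_int (S $$ (i, j))" using ij by simp
    have "(Q * ?T) $$ (i, p j) = (\<Sum>k<n. Q $$ (i, k) * of_int (T $$ (k, p j)))"
      using ij pn T(1) Q(1) by (simp add: scalar_prod_def atLeast0LessThan)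
    also have "\<dots> = (\<Sum>k<n. if k = p i then of_int (T $$ (p i, p j)) else 0)"
      using ij by (intro sum.cong) (auto simp: p(2))
    finally have "(Q * ?T) $$ (i, p j) = of_int (T $$ (p i, p j))" using ij pn by simp
    with 1 show ?thesis using Q(4) by simp
  qed
  have "E i j \<longleftrightarrow> F (p i) (p j)" if ij: "i < n" "j < n" for i j
  proof -
    have "E i j \<longleftrightarrow> S $$ (i, j) = 1" using ij by (simp add: S_def skew_adj_def)
    also have "\<dots> \<longleftrightarrow> T $$ (p i, p j) = 1" using ST[OF ij] by simp
    also have "\<dots> \<longleftrightarrow> F (p i) (p j)" using ij pn by (simp add: T_def skew_adj_def)
    finally show ?thesis .
  qed
  then show "isomorphic_og n E F" unfolding isomorphic_og_def using p(1) by blast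
qed

end
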